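(* Consider the monotone follower problem $$V(x)=\inf_{\theta\in\mathcal{A}}E_x\left[\int_0^\infty c(X_t-\theta_t)e^{-rt}\,dt+\int_0^\infty Ke^{-rt}\,d\theta_t\right],$$ where $K\ge0$ is a constant, $c:\mathbb{R}\to\mathbb{R}$ is continuously differentiable, bounded from below and has an increasing derivative $c_x$, and $X$ is a Lévy process such that $E_x\left[\int_0^\infty c(X_t)e^{-rt}\,dt\right]<\infty$. Suppose that $\int_{x>1}x^2\,\nu(dx)<\infty$, where $\nu$ is the Lévy measure of $X$. Let $$\kappa(x):=\frac1rE_0\left[c_x\left(x+\underline{X}_{T(r)}\right)\right]-K$$ and suppose that there exists $x^*\in\mathbb{R}$ which solves $\kappa(x^* )=0$. Then the optimal control $\theta^*$ for the monotone follower problem (i.e. the control attaining the infimum in $V(x)$) is given by $$\theta^*_t=\sup_{0\le u\le t}(X_u-x^* )^+\qquad\forall\,t\ge0.$$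
   Context: $(\Omega,\mathcal{F},\mathbb{F}=(\mathcal{F}_t)_{t\ge0},(P_x)_{x\in\mathbb{R}})$ are filtered probability spaces, $X=(X_t)_{t\ge0}$ is a real-valued $\mathbb{F}$-adapted Lévy process with $X_0=x$ under $P_x$, $E_x$ is expectation under $P_x$, and $r>0$ is a constant. $\mathcal{A}$ is the set of singular controls: increasing (nondecreasing) adapted càdlàg processes $\theta$ with $\theta_{0-}=0$ and $\left\|\int_0^\infty e^{-rt}\,d\theta_t\right\|_{L^2(P_x)}<\infty$. Integrals $\int_0^\infty\cdot\,d\theta_t$ are over $[0,\infty)$ and include the jump of $\theta$ at time $0$. $\underline{X}_t=\inf_{0\le s\le t}X_s$, $T(r)$ is an exponentially distributed random variable with parameter $r$ independent of $X$, and $y^+=\max(y,0)$. *)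

theory Defs
  imports "HOL-Probability.Probability"
begin

text \<open>
  Time runs through \<open>[0,\<infinity>)\<close>, represented by nonnegative reals; the values of processes at
  negative times are irrelevant. A filtration over \<open>[0,\<infinity>)\<close> is an instance of
  the library locale \<^locale>\<open>filtration\<close> with index type \<^typ>\<open>real\<close> by taking
  \<open>F t = F 0\<close> for \<open>t < 0\<close>.
\<close>

definition cadlag :: "(real \<Rightarrow> real) \<Rightarrow> bool" where
  "cadlag f \<longleftrightarrow>
     (\<forall>t\<ge>0. continuous (at_right t) f) \<and> (\<forall>t>0. \<exists>l. (f \<longlongrightarrow> l) (at_left t))"

definition jump :: "(real \<Rightarrow> real) \<Rightarrow> real \<Rightarrow> real" where
  "jump f t = f t - Lim (at_left t) f"

definition adapted :: "(real \<Rightarrow> 'a measure) \<Rightarrow> (real \<Rightarrow> 'a \<Rightarrow> real) \<Rightarrow> bool" where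
  "adapted F X \<longleftrightarrow> (\<forall>t\<ge>0. X t \<in> borel_measurable (F t))"


text \<open>
  Levy processes relative to a filtration: increments after time \<open>s\<close> are independent of \<open>F s\<close>,
  not only of the past of \<open>X\<close>. Stochastic continuity is implied by stationarity and
  right-continuity of the paths.
\<close>

locale levy_process = prob_space M + filtration "space M" F
  for M :: "'a measure" and F :: "real \<Rightarrow> 'a measure" +
  fixes X :: "real \<Rightarrow> 'a \<Rightarrow> real"
  assumes subalgebra_F: "\<And>t. 0 \<le> t \<Longrightarrow> subalgebra M (F t)"
    and adapted_X: "adapted F X"
    and cadlag_paths: "\<And>\<omega>. \<omega> \<in> space M \<Longrightarrow> cadlag (\<lambda>t. X t \<omega>)"
    and independent_increments: "\<And>s t. 0 \<le> s \<Longrightarrow> s \<le> t \<Longrightarrow>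
      indep_set (sets (F s)) (sets (vimage_algebra (space M) (\<lambda>\<omega>. X t \<omega> - X s \<omega>) borel))"
    and stationary_increments: "\<And>s t. 0 \<le> s \<Longrightarrow> s \<le> t \<Longrightarrow>
      distr M borel (\<lambda>\<omega>. X t \<omega> - X s \<omega>) = distr M borel (\<lambda>\<omega>. X (t - s) \<omega> - X 0 \<omega>)"

text \<open>
  The last clause says that the law of the path \<open>X\<close> under \<open>P x\<close> is the law of \<open>x + X\<close> under
  \<open>P 0\<close>, so that all \<open>P x\<close> describe the same Levy process, started at \<open>x\<close>.
\<close>

definition levy_family ::
  "(real \<Rightarrow> 'a measure) \<Rightarrow> (real \<Rightarrow> 'a measure) \<Rightarrow> (real \<Rightarrow> 'a \<Rightarrow> real) \<Rightarrow> bool" where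
  "levy_family P F X \<longleftrightarrow>
     (\<forall>x. sets (P x) = sets (P 0)) \<and>
     (\<forall>x. levy_process (P x) F X) \<and>
     (\<forall>x. AE \<omega> in P x. X 0 \<omega> = x) \<and>
     (\<forall>x. distr (P x) (Pi\<^sub>M {0..} (\<lambda>_. borel)) (\<lambda>\<omega>. \<lambda>t\<in>{0..}. X t \<omega>) =
           distr (P 0) (Pi\<^sub>M {0..} (\<lambda>_. borel)) (\<lambda>\<omega>. \<lambda>t\<in>{0..}. x + X t \<omega>))"

text \<open>
  The Levy measure assigns to \<open>B\<close> the expected number of nonzero jumps with size in \<open>B\<close>
  during one unit of time.
\<close>

definition has_levy_measure ::
  "'a measure \<Rightarrow> (real \<Rightarrow> 'a \<Rightarrow> real) \<Rightarrow> real measure \<Rightarrow> bool" where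
  "has_levy_measure M X \<nu> \<longleftrightarrow>
     sets \<nu> = sets borel \<and>
     (\<forall>B\<in>sets borel. emeasure \<nu> B =
        (\<integral>\<^sup>+\<omega>. emeasure (count_space UNIV)
            {t\<in>{0<..1}. jump (\<lambda>s. X s \<omega>) t \<noteq> 0 \<and> jump (\<lambda>s. X s \<omega>) t \<in> B} \<partial>M))"


text \<open>
  Integral with values in the extended reals. The Bochner integral is not suitable, since it
  is \<open>0\<close> for nonintegrable functions. The value is meaningful unless both parts are infinite.
\<close>

definition ext_integral :: "'a measure \<Rightarrow> ('a \<Rightarrow> ereal) \<Rightarrow> ereal" where
  "ext_integral M f =
     enn2ereal (\<integral>\<^sup>+x. e2ennreal (f x) \<partial>M) - enn2ereal (\<integral>\<^sup>+x. e2ennreal (- f x) \<partial>M)"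

text \<open>
  The measure \<open>df\<close> on \<open>[0,\<infinity>)\<close> under the convention \<open>f(0-) = 0\<close>: extending \<open>f\<close> by \<open>0\<close>
  to negative times gives \<open>{0}\<close> the mass \<open>f 0\<close> and the negative half-line the mass \<open>0\<close>.
\<close>

definition stieltjes_measure :: "(real \<Rightarrow> real) \<Rightarrow> real measure" where
  "stieltjes_measure f = interval_measure (\<lambda>t. if t < 0 then 0 else f t)"

text \<open>
  For a nondecreasing control, \<open>\<theta>(0-) = 0\<close> amounts to \<open>\<theta> 0 \<ge> 0\<close>, where \<open>\<theta> 0\<close> is the jump at
  time \<open>0\<close>.
\<close>

definition singular_controls ::
  "'a measure \<Rightarrow> (real \<Rightarrow> 'a measure) \<Rightarrow> real \<Rightarrow> (real \<Rightarrow> 'a \<Rightarrow> real) set" where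
  "singular_controls M F r =
     {\<theta>. adapted F \<theta> \<and>
        (\<forall>\<omega>\<in>space M. cadlag (\<lambda>t. \<theta> t \<omega>) \<and> mono_on {0..} (\<lambda>t. \<theta> t \<omega>) \<and> 0 \<le> \<theta> 0 \<omega>) \<and>
        (\<integral>\<^sup>+\<omega>. (\<integral>\<^sup>+t. ennreal (exp (- r * t)) \<partial>stieltjes_measure (\<lambda>t. \<theta> t \<omega>))\<^sup>2 \<partial>M) < \<infinity>}"

definition running_cost :: "(real \<Rightarrow> real) \<Rightarrow> real \<Rightarrow> (real \<Rightarrow> real) \<Rightarrow> ereal" where
  "running_cost c r f =
     ext_integral (restrict_space lborel {0..}) (\<lambda>t. ereal (c (f t) * exp (- r * t)))"

definition control_cost :: "real \<Rightarrow> real \<Rightarrow> (real \<Rightarrow> real) \<Rightarrow> ereal" where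
  "control_cost K r f = ext_integral (stieltjes_measure f) (\<lambda>t. ereal (K * exp (- r * t)))"

definition expected_cost ::
  "'a measure \<Rightarrow> (real \<Rightarrow> 'a \<Rightarrow> real) \<Rightarrow> (real \<Rightarrow> real) \<Rightarrow> real \<Rightarrow> real \<Rightarrow>
     (real \<Rightarrow> 'a \<Rightarrow> real) \<Rightarrow> ereal" where
  "expected_cost M X c K r \<theta> =
     ext_integral M (\<lambda>\<omega>. running_cost c r (\<lambda>t. X t \<omega> - \<theta> t \<omega>)
                         + control_cost K r (\<lambda>t. \<theta> t \<omega>))"

definition value_function ::
  "(real \<Rightarrow> 'a measure) \<Rightarrow> (real \<Rightarrow> 'a measure) \<Rightarrow> (real \<Rightarrow> 'a \<Rightarrow> real) \<Rightarrow>
     (real \<Rightarrow> real) \<Rightarrow> real \<Rightarrow> real \<Rightarrow> real \<Rightarrow> ereal" where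
  "value_function P F X c K r x =
     (INF \<theta>\<in>singular_controls (P x) F r. expected_cost (P x) X c K r \<theta>)"

definition running_inf :: "(real \<Rightarrow> 'a \<Rightarrow> real) \<Rightarrow> real \<Rightarrow> 'a \<Rightarrow> real" where
  "running_inf X t \<omega> = (INF s\<in>{0..t}. X s \<omega>)"

text \<open>
  The independent exponential time is the second coordinate of the product extension of the
  probability space by an exponential distribution, so the given space need not carry such a
  random variable.
\<close>

definition kappa ::
  "'a measure \<Rightarrow> (real \<Rightarrow> 'a \<Rightarrow> real) \<Rightarrow> (real \<Rightarrow> real) \<Rightarrow> real \<Rightarrow> real \<Rightarrow> real \<Rightarrow> ereal" where
  "kappa M X c' K r x =
     ereal (1 / r) *
       ext_integral (M \<Otimes>\<^sub>M density lborel (exponential_density r))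
         (\<lambda>(\<omega>, T). ereal (c' (x + running_inf X T \<omega>)))
     - ereal K"

end

theory Submission
  imports Defs
begin

text \<open>
  Write \<open>C = c' x_star\<close> and let \<open>\<rho>\<close> be the barrier control, which keeps \<open>X - \<rho>\<close> at or below
  \<open>x_star\<close>. Convexity of \<open>c\<close> gives, for any control \<open>\<theta>\<close>,
  \<open>c (X - \<theta>) \<ge> c (X - \<rho>) + c' (X - \<rho>) (\<rho> - \<theta>)\<close>, and \<open>c' (X - \<rho>) = C - q\<close> with a gap \<open>q \<ge> 0\<close>.
  Everything therefore rests on the discounted integrals of \<open>q \<theta>\<close> and \<open>q \<rho>\<close>. By Tonelli, the
  first one is the integral against \<open>d\<theta> s\<close> of the discounted gap accumulated after time \<open>s\<close>.

  Reflecting \<open>X\<close> only from time \<open>s\<close> on, starting at \<open>x_star\<close>, leaves a path that lies at or above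
  \<open>X - \<rho>\<close>, so the gap \<open>q t\<close> is at least the gap produced by the drawdown
  \<open>sup {X u | s \<le> u \<le> t} - X t\<close>. For \<open>d\<rho>\<close>-almost every \<open>s\<close> the two agree, because \<open>\<rho>\<close> increases only
  while \<open>X\<close> is at its running maximum (\<open>AE_reflection_increase\<close>). The future drawdown is independent
  of the information at time \<open>s\<close>, and by time reversal it has the law of the depth of the running
  minimum; hence its discounted mean is \<open>exp (- r s) L\<close> with a constant \<open>L\<close>, and \<open>\<kappa> x_star = 0\<close>
  says exactly that \<open>L = C / r - K\<close> (\<open>kappa_zero\<close>). So against the
  reflected path no control saves more at the margin than it costs, and along \<open>\<rho>\<close> the marginal
  saving equals the marginal cost
  (\<open>nn_integral_future_drawdown_control\<close>, \<open>reflection_optimal\<close>).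

  Two devices keep the probability elementary. First, the accumulated future drawdown is
  nonincreasing and right-continuous in \<open>s\<close>; evaluating it at the next dyadic time approximates
  its integral against an adapted control by monotone convergence, and in the approximating
  sums each increment of the control is known when the drawdown begins. This replaces optional
  projections. Secondly, on a dyadic grid the drawdown and the depth arise by composing the same
  independent random maps in opposite orders, and the two compositions have the same law because
  in each of them the latest increment can be averaged out first
  (\<open>nn_integral_compose_outer\<close>, \<open>nn_integral_compose_inner\<close>).

  Admissibility of \<open>\<rho>\<close> needs a second moment of \<open>M = sup {X u - X 0 | 0 \<le> u \<le> 1}\<close>. On a grid, a
  first-passage argument bounds \<open>P (M > 2 a + b)\<close> by the probability of an increment above \<open>b\<close>
  plus \<open>P (M > a)\<^sup>2\<close>. As the grid gets finer, large increments force large jumps, so the first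
  term turns into \<open>\<nu> {b..}\<close> (\<open>prob_height\<close>). With \<open>a = b = 3 ^ k\<close> this recursion makes
  \<open>9 ^ k P (M > 3 ^ k)\<close> summable as soon as \<open>\<nu>\<close> has a second moment at infinity. Over longer times
  the maximum is dominated by a sum of variables with the law of \<open>M\<close>, and discounting takes care of
  the quadratic growth.
\<close>

section \<open>Paths with left limits and right-continuity\<close>

definition path_sup :: "(real \<Rightarrow> real) \<Rightarrow> real \<Rightarrow> real \<Rightarrow> real" where
  "path_sup f s t = (SUP u\<in>{s..t}. f u)"

text \<open>
  The argument \<open>n\<close> comes last so that \<open>grid_max f s t\<close> is a sequence. The grid contains both end
  points of the interval and is refined from \<open>n\<close> to \<open>Suc n\<close>.
\<close>

definition grid_max :: "(real \<Rightarrow> real) \<Rightarrow> real \<Rightarrow> real \<Rightarrow> nat \<Rightarrow> real" where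
  "grid_max f s t n = Max ((\<lambda>k. f (s + real k * ((t - s) / 2 ^ n))) ` {..2 ^ n})"

text \<open>
  Near \<open>x\<close> the path is close to its value on the right and close to its left limit on the left;
  bounds and jumps are read off from this by compactness. Points are restricted to nonnegative
  times, so that at \<open>x = 0\<close> the second part is vacuous.
\<close>

lemma cadlag_local:
  assumes "cadlag f" "0 \<le> x" "0 < e"
  obtains d where "0 < d"
    "\<And>u. x \<le> u \<Longrightarrow> u < x + d \<Longrightarrow> \<bar>f u - f x\<bar> < e"
    "\<And>u. 0 \<le> u \<Longrightarrow> x - d < u \<Longrightarrow> u < x \<Longrightarrow> \<bar>f u - (f x - jump f x)\<bar> < e"
proof -
  have "(f \<longlongrightarrow> f x) (at_right x)"
    using assms by (auto simp: cadlag_def continuous_within)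
  then have "eventually (\<lambda>u. dist (f u) (f x) < e) (at_right x)"
    using assms(3) by (rule tendstoD)
  then obtain d1 where d1: "x < d1" "\<And>u. x < u \<Longrightarrow> u < d1 \<Longrightarrow> \<bar>f u - f x\<bar> < e"
    unfolding eventually_at_right[of x "x + 1", simplified] by (auto simp: dist_real_def)
  have "\<exists>d2<x. \<forall>u. 0 \<le> u \<longrightarrow> d2 < u \<longrightarrow> u < x \<longrightarrow> \<bar>f u - (f x - jump f x)\<bar> < e"
  proof (cases "x = 0")
    case True then show ?thesis by (auto intro!: exI[of _ "-1"])
  next
    case False
    then obtain l where l: "(f \<longlongrightarrow> l) (at_left x)"
      using assms by (auto simp: cadlag_def less_le)
    then have "f x - jump f x = l"
      by (simp add: jump_def tendsto_Lim)
    moreover have "eventually (\<lambda>u. dist (f u) l < e) (at_left x)"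
      using l assms(3) by (rule tendstoD)
    then obtain d2 where "d2 < x" "\<And>u. d2 < u \<Longrightarrow> u < x \<Longrightarrow> \<bar>f u - l\<bar> < e"
      unfolding eventually_at_left[of "x - 1" x, simplified] by (auto simp: dist_real_def)
    ultimately show ?thesis by (intro exI[of _ d2]) auto
  qed
  then obtain d2 where d2: "d2 < x"
    "\<And>u. 0 \<le> u \<Longrightarrow> d2 < u \<Longrightarrow> u < x \<Longrightarrow> \<bar>f u - (f x - jump f x)\<bar> < e"
    by blast
  show ?thesis
  proof (rule that[of "min (d1 - x) (x - d2)"])
    show "\<bar>f u - f x\<bar> < e" if "x \<le> u" "u < x + min (d1 - x) (x - d2)" for u
      using d1(2)[of u] that assms(3) by (cases "u = x") auto
    show "\<bar>f u - (f x - jump f x)\<bar> < e"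
      if "0 \<le> u" "x - min (d1 - x) (x - d2) < u" "u < x" for u
      using d2(2)[of u] that by auto
  qed (use d1 d2 in auto)
qed

lemma cadlag_bounded:
  assumes f: "cadlag f" and s: "0 \<le> s"
  shows "bounded (f ` {s..t})"
proof -
  have "\<exists>d>0. bounded (f ` ({s..t} \<inter> ball x d))" if x: "x \<in> {s..t}" for x
  proof -
    obtain d where d: "0 < d"
      "\<And>u. x \<le> u \<Longrightarrow> u < x + d \<Longrightarrow> \<bar>f u - f x\<bar> < 1"
      "\<And>u. 0 \<le> u \<Longrightarrow> x - d < u \<Longrightarrow> u < x \<Longrightarrow> \<bar>f u - (f x - jump f x)\<bar> < 1"
      using cadlag_local[OF f, of x 1] x s by auto
    have "\<bar>f u\<bar> \<le> 1 + \<bar>f x\<bar> + \<bar>f x - jump f x\<bar>" if "u \<in> {s..t} \<inter> ball x d" for u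
      using d(2)[of u] d(3)[of u] that s by (cases "x \<le> u") (auto simp: dist_real_def)
    then have "bounded (f ` ({s..t} \<inter> ball x d))"
      unfolding bounded_iff by (intro exI[of _ "1 + \<bar>f x\<bar> + \<bar>f x - jump f x\<bar>"]) auto
    then show ?thesis
      using d(1) by blast
  qed
  then obtain d where d: "\<And>x. x \<in> {s..t} \<Longrightarrow> 0 < d x"
    "\<And>x. x \<in> {s..t} \<Longrightarrow> bounded (f ` ({s..t} \<inter> ball x (d x)))"
    by metis
  obtain C where C: "C \<subseteq> {s..t}" "finite C" "{s..t} \<subseteq> (\<Union>x\<in>C. ball x (d x))"
    by (rule compactE_image[of "{s..t}" "{s..t}" "\<lambda>x. ball x (d x)"]) (use d in auto)
  have "bounded (\<Union>x\<in>C. f ` ({s..t} \<inter> ball x (d x)))"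
    using C d by (intro bounded_UN) auto
  moreover have "f ` {s..t} \<subseteq> (\<Union>x\<in>C. f ` ({s..t} \<inter> ball x (d x)))"
    using C(3) by blast
  ultimately show ?thesis by (rule bounded_subset)
qed

text \<open>
  Only jumps prevent increments over short intervals from being small, so an upper bound on
  the jumps is inherited by all increments over intervals of some positive length.
\<close>

lemma cadlag_small_increments:
  assumes f: "cadlag f" and b: "0 < b" and jumps: "\<And>s. s \<in> {0<..1} \<Longrightarrow> jump f s < b"
  shows "\<exists>d>0. \<forall>u v. 0 \<le> u \<longrightarrow> u \<le> v \<longrightarrow> v \<le> 1 \<longrightarrow> v - u < d \<longrightarrow> f v - f u < b"
proof -
  have "\<exists>d>0. \<forall>u v. 0 \<le> u \<longrightarrow> u \<le> v \<longrightarrow> u \<in> ball x d \<longrightarrow> v \<in> ball x d \<longrightarrow> f v - f u < b"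
    if x: "x \<in> {0..1}" for x
  proof -
    \<comment> \<open>On one side of \<open>x\<close> two values differ by less than \<open>2 e\<close>, across
      \<open>x\<close> by less than \<open>jump f x + 2 e\<close>.\<close>
    define e where "e = min (b / 2) (if jump f x < b then (b - jump f x) / 2 else 1)"
    have e: "0 < e" "2 * e \<le> b" "jump f x < b \<Longrightarrow> jump f x + 2 * e \<le> b"
      using b by (auto simp: e_def min_def field_simps)
    obtain d where d: "0 < d"
      "\<And>u. x \<le> u \<Longrightarrow> u < x + d \<Longrightarrow> \<bar>f u - f x\<bar> < e"
      "\<And>u. 0 \<le> u \<Longrightarrow> x - d < u \<Longrightarrow> u < x \<Longrightarrow> \<bar>f u - (f x - jump f x)\<bar> < e"
      using cadlag_local[OF f, of x e] x e by auto
    have "f v - f u < b" if uv: "0 \<le> u" "u \<le> v" "u \<in> ball x d" "v \<in> ball x d" for u v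
    proof -
      have uv': "x - d < u" "u < x + d" "x - d < v" "v < x + d"
        using uv by (auto simp: dist_real_def)
      consider "x \<le> u" | "v < x" | "u < x" "x \<le> v" by linarith
      then show ?thesis
      proof cases
        case 1 then show ?thesis using d(2)[of u] d(2)[of v] uv uv' e by auto
      next
        case 2 then show ?thesis using d(3)[of u] d(3)[of v] uv uv' e by auto
      next
        case 3
        then have "jump f x < b" using uv x by (intro jumps) auto
        with 3 show ?thesis using d(3)[of u] d(2)[of v] uv uv' e by auto
      qed
    qed
    with d(1) show ?thesis by blast
  qed
  then obtain d where d: "\<And>x. x \<in> {0..1} \<Longrightarrow> 0 < d x"
    "\<And>x u v. x \<in> {0..1} \<Longrightarrow> 0 \<le> u \<Longrightarrow> u \<le> v \<Longrightarrow> u \<in> ball x (d x) \<Longrightarrow> v \<in> ball x (d x) \<Longrightarrow> f v - f u < b"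
    by metis
  obtain e where e: "0 < e"
    "\<And>x. x \<in> {0..1} \<Longrightarrow> \<exists>T\<in>(\<lambda>x. ball x (d x)) ` {0..1::real}. ball x e \<subseteq> T"
    by (rule Heine_Borel_lemma[of "{0..1::real}" "(\<lambda>x. ball x (d x)) ` {0..1::real}"]) (use d in auto)
  show ?thesis
  proof (intro exI[of _ e] conjI allI impI e(1))
    fix u v :: real assume uv: "0 \<le> u" "u \<le> v" "v \<le> 1" "v - u < e"
    then obtain x where "x \<in> {0..1}" "ball u e \<subseteq> ball x (d x)" using e(2)[of u] by auto
    moreover have "u \<in> ball u e" "v \<in> ball u e" using uv e(1) by (auto simp: dist_real_def)
    ultimately show "f v - f u < b" using uv d(2)[of x u v] by blast
  qed
qed

lemma cadlag_jump_of_increments: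
  assumes f: "cadlag f" and b: "0 < b"
    and incr: "\<And>m. \<exists>n\<ge>m. \<exists>k<2 ^ n. b < f (real (Suc k) / 2 ^ n) - f (real k / 2 ^ n)"
  shows "\<exists>s\<in>{0<..1}. b \<le> jump f s"
proof (rule ccontr)
  assume "\<not> ?thesis"
  then obtain d where d: "0 < d"
    "\<And>u v. 0 \<le> u \<Longrightarrow> u \<le> v \<Longrightarrow> v \<le> 1 \<Longrightarrow> v - u < d \<Longrightarrow> f v - f u < b"
    using cadlag_small_increments[OF f b] by (auto simp: not_le)
  obtain m where m: "(1/2) ^ m < d"
    using real_arch_pow_inv[of d "1/2"] d(1) by auto
  obtain n k where n: "m \<le> n" "k < 2 ^ n" and *: "b < f (real (Suc k) / 2 ^ n) - f (real k / 2 ^ n)"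
    using incr by blast
  have "(1/2::real) ^ n \<le> (1/2) ^ m" using n by (intro power_decreasing) auto
  then have "real (Suc k) / 2 ^ n - real k / 2 ^ n < d"
    using m by (simp add: diff_divide_distrib[symmetric] power_one_over)
  moreover have "real (Suc k) \<le> 2 ^ n"
    using n(2) by (metis Suc_leI of_nat_le_iff of_nat_numeral of_nat_power)
  ultimately have "f (real (Suc k) / 2 ^ n) - f (real k / 2 ^ n) < b"
    by (intro d(2)) (auto simp: divide_simps)
  with * show False by simp
qed

lemma incseq_grid_max: "incseq (grid_max f s t)"
proof (rule incseq_SucI)
  fix n
  show "grid_max f s t n \<le> grid_max f s t (Suc n)"
    unfolding grid_max_def
  proof (rule Max_mono)
    show "(\<lambda>k. f (s + real k * ((t - s) / 2 ^ n))) ` {..2 ^ n}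
        \<subseteq> (\<lambda>k. f (s + real k * ((t - s) / 2 ^ Suc n))) ` {..2 ^ Suc n}"
    proof safe
      fix k :: nat assume "k \<le> 2 ^ n"
      then show "f (s + real k * ((t - s) / 2 ^ n))
          \<in> (\<lambda>k. f (s + real k * ((t - s) / 2 ^ Suc n))) ` {..2 ^ Suc n}"
        by (intro image_eqI[of _ _ "2 * k"]) auto
    qed
  qed auto
qed

lemma grid_point_in:
  assumes "s \<le> t" "k \<le> 2 ^ n"
  shows "s + real k * ((t - s) / 2 ^ n) \<in> {s..t}"
proof -
  have "real k / 2 ^ n \<le> 1"
    using assms(2) by (metis divide_le_eq_1 of_nat_le_iff of_nat_numeral of_nat_power zero_less_numeral zero_less_power)
  then have "real k / 2 ^ n * (t - s) \<le> 1 * (t - s)" using assms by (intro mult_right_mono) auto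
  moreover have "0 \<le> real k / 2 ^ n * (t - s)" using assms by auto
  ultimately show ?thesis by (auto simp: algebra_simps)
qed

text \<open>
  By right-continuity, a value at \<open>u\<close> is nearly attained at the first grid point to the right of
  \<open>u\<close>, and such a grid point exists up to and including the end of the interval.
\<close>

lemma grid_max_tendsto:
  assumes st: "s \<le> t" and bdd: "bdd_above (f ` {s..t})"
    and rc: "\<And>u. s \<le> u \<Longrightarrow> u \<le> t \<Longrightarrow> continuous (at_right u) f"
  shows "grid_max f s t \<longlonglongrightarrow> path_sup f s t"
proof (rule order_tendstoI)
  fix a assume "path_sup f s t < a"
  moreover have "grid_max f s t n \<le> path_sup f s t" for n
    unfolding grid_max_def path_sup_def using grid_point_in[OF st]
    by (intro Max.boundedI) (auto intro!: cSUP_upper bdd)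
  ultimately show "\<forall>\<^sub>F n in sequentially. grid_max f s t n < a"
    by (auto intro: always_eventually le_less_trans)
next
  fix a assume "a < path_sup f s t"
  then obtain u where u: "u \<in> {s..t}" "a < f u"
    unfolding path_sup_def using less_cSUP_iff[OF _ bdd, of a] st by auto
  have "(f \<longlongrightarrow> f u) (at_right u)" using rc[of u] u by (auto simp: continuous_within)
  then have "eventually (\<lambda>v. a < f v) (at_right u)" using u by (auto dest: order_tendstoD)
  then obtain d where d: "u < d" "\<And>v. u < v \<Longrightarrow> v < d \<Longrightarrow> a < f v"
    unfolding eventually_at_right[of u "u + 1", simplified] by auto
  have "(\<lambda>n. (t - s) / 2 ^ n) \<longlonglongrightarrow> 0"
    by (intro LIMSEQ_divide_realpow_zero) auto
  then have "\<forall>\<^sub>F n in sequentially. (t - s) / 2 ^ n < d - u"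
    using d(1) by (intro order_tendstoD(2)[of _ 0]) auto
  then show "\<forall>\<^sub>F n in sequentially. a < grid_max f s t n"
  proof eventually_elim
    case (elim n)
    have "\<exists>k\<le>2 ^ n. a < f (s + real k * ((t - s) / 2 ^ n))"
    proof (cases "s = t")
      case True then show ?thesis using u by auto
    next
      case False
      then have st': "s < t" using st by simp
      define w where "w = (u - s) / (t - s) * 2 ^ n"
      define k where "k = nat \<lceil>w\<rceil>"
      have w: "0 \<le> w" "w \<le> 2 ^ n"
        using u st' by (auto simp: w_def divide_simps)
      have k: "w \<le> real k" "real k < w + 1" "k \<le> 2 ^ n"
        using w unfolding k_def
        by (auto simp: nat_le_iff ceiling_le_iff intro: less_imp_le) linarith+
      have "w * ((t - s) / 2 ^ n) = u - s" using st' by (auto simp: w_def)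
      moreover have "w * ((t - s) / 2 ^ n) \<le> real k * ((t - s) / 2 ^ n)"
        using k st' by (intro mult_right_mono) auto
      moreover have "real k * ((t - s) / 2 ^ n) < (w + 1) * ((t - s) / 2 ^ n)"
        using k st' by (intro mult_strict_right_mono) auto
      moreover have "(w + 1) * ((t - s) / 2 ^ n) = w * ((t - s) / 2 ^ n) + (t - s) / 2 ^ n"
        by (simp only: distrib_right mult_1)
      ultimately have "u \<le> s + real k * ((t - s) / 2 ^ n)" "s + real k * ((t - s) / 2 ^ n) < d"
        using elim by linarith+
      then show ?thesis using d(2) u(2) k(3) by (metis order_le_less)
    qed
    then show ?case
      unfolding grid_max_def by (subst Max_gr_iff) auto
  qed
qed

lemma cadlag_bdd:
  assumes "cadlag f" "0 \<le> s"
  shows "bdd_above (f ` {s..t})" "bdd_below (f ` {s..t})"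
  using cadlag_bounded[OF assms] by (auto intro: bounded_imp_bdd_above bounded_imp_bdd_below)

lemma cadlag_grid_max_tendsto:
  assumes "cadlag f" "0 \<le> s" "s \<le> t"
  shows "grid_max f s t \<longlonglongrightarrow> path_sup f s t"
  using assms by (intro grid_max_tendsto cadlag_bdd) (auto simp: cadlag_def)

lemma path_sup_upper:
  assumes "cadlag f" "0 \<le> s" "s \<le> u" "u \<le> t"
  shows "f u \<le> path_sup f s t"
  unfolding path_sup_def by (intro cSUP_upper cadlag_bdd) (use assms in auto)

lemma path_sup_least:
  assumes "s \<le> t" "\<And>u. s \<le> u \<Longrightarrow> u \<le> t \<Longrightarrow> f u \<le> c"
  shows "path_sup f s t \<le> c"
  unfolding path_sup_def by (intro cSUP_least) (use assms in auto)

lemma path_sup_antimono: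
  assumes "cadlag f" "0 \<le> s" "s \<le> s'" "s' \<le> t"
  shows "path_sup f s' t \<le> path_sup f s t"
  using assms by (intro path_sup_least path_sup_upper) auto

text \<open>
  Shortening the interval at its left end loses at most the value at \<open>s\<close> in the limit, and
  right-continuity recovers it just after \<open>s\<close>.
\<close>

lemma path_sup_tendsto:
  assumes f: "cadlag f" and s: "0 \<le> s" "s < t"
    and \<sigma>: "\<And>n. s \<le> \<sigma> n" "\<sigma> \<longlonglongrightarrow> s"
  shows "(\<lambda>n. path_sup f (\<sigma> n) t) \<longlonglongrightarrow> path_sup f s t"
proof (rule order_tendstoI)
  have ev: "\<forall>\<^sub>F n in sequentially. \<sigma> n < t" using \<sigma> s by (auto dest: order_tendstoD)
  {
    fix a assume a: "path_sup f s t < a"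
    show "\<forall>\<^sub>F n in sequentially. path_sup f (\<sigma> n) t < a"
      using ev
    proof eventually_elim
      case (elim n)
      then have "path_sup f (\<sigma> n) t \<le> path_sup f s t"
        using \<sigma>(1)[of n] s by (intro path_sup_antimono f) auto
      with a show ?case by simp
    qed
  next
    fix a assume "a < path_sup f s t"
    then obtain u where u: "u \<in> {s..t}" "a < f u"
      unfolding path_sup_def using less_cSUP_iff[OF _ cadlag_bdd(1)[OF f s(1)], of t a] s by auto
    have "\<exists>v. s < v \<and> v \<le> t \<and> a < f v"
    proof (cases "u = s")
      case True
      have "(f \<longlongrightarrow> f s) (at_right s)" using f s by (auto simp: cadlag_def continuous_within)
      then have "eventually (\<lambda>v. a < f v) (at_right s)" using u True by (auto dest: order_tendstoD)
      then obtain d where d: "s < d" "\<And>v. s < v \<Longrightarrow> v < d \<Longrightarrow> a < f v"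
        unfolding eventually_at_right[of s "s + 1", simplified] by auto
      then show ?thesis using dense[of s "min d t"] s by (auto intro: less_imp_le)
    next
      case False then show ?thesis using u by (intro exI[of _ u]) auto
    qed
    then obtain v where v: "s < v" "v \<le> t" "a < f v" by blast
    have "\<forall>\<^sub>F n in sequentially. \<sigma> n < v" using \<sigma> v by (auto dest: order_tendstoD)
    then show "\<forall>\<^sub>F n in sequentially. a < path_sup f (\<sigma> n) t"
    proof eventually_elim
      case (elim n)
      then have "f v \<le> path_sup f (\<sigma> n) t"
        using \<sigma>(1)[of n] s v by (intro path_sup_upper f) auto
      with v show ?case by simp
    qed
  }
qed

lemma mono_continuous_SUP:
  fixes \<phi> :: "real \<Rightarrow> ennreal"
  assumes "mono \<phi>" "continuous_on UNIV \<phi>" "incseq y" "y \<longlonglongrightarrow> l"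
  shows "(SUP n. \<phi> (y n)) = \<phi> l"
proof -
  have "(\<lambda>n. \<phi> (y n)) \<longlonglongrightarrow> \<phi> l"
    using assms by (intro continuous_on_tendsto_compose[of UNIV \<phi>]) auto
  moreover have "incseq (\<lambda>n. \<phi> (y n))"
    using assms by (auto simp: incseq_def mono_def)
  ultimately show ?thesis
    using LIMSEQ_SUP LIMSEQ_unique by blast
qed

section \<open>Joint measurability of paths and running suprema\<close>

text \<open>
  The process is the limit of its values at the next dyadic time, a function of countably many
  random variables. Negative times are mapped to \<open>0\<close> so that time can range over all reals.
\<close>

lemma right_continuous_joint_measurable:
  fixes X :: "real \<Rightarrow> 'a \<Rightarrow> real"
  assumes X[measurable]: "\<And>t. 0 \<le> t \<Longrightarrow> X t \<in> borel_measurable M"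
    and rc: "\<And>\<omega> t. \<omega> \<in> space M \<Longrightarrow> 0 \<le> t \<Longrightarrow> continuous (at_right t) (\<lambda>t. X t \<omega>)"
  shows "(\<lambda>p. X (max 0 (fst p)) (snd p)) \<in> borel_measurable (borel \<Otimes>\<^sub>M M)"
proof (rule borel_measurable_LIMSEQ_metric)
  define up where "up n t = (real (nat \<lfloor>max 0 t * (2::real) ^ n\<rfloor>) + 1) / 2 ^ n" for n :: nat and t :: real
  show "(\<lambda>p. X (up n (fst p)) (snd p)) \<in> borel_measurable (borel \<Otimes>\<^sub>M M)" for n
    unfolding up_def
  proof (rule measurable_compose_countable[where f="\<lambda>k p. X ((real k + 1) / 2 ^ n) (snd p)"
        and g="\<lambda>p. nat \<lfloor>max 0 (fst p :: real) * 2 ^ n\<rfloor>"])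
    show "(\<lambda>p. X ((real k + 1) / 2 ^ n) (snd p)) \<in> borel_measurable (borel \<Otimes>\<^sub>M M)" for k :: nat
      by (intro measurable_compose[OF measurable_snd] X) auto
    show "(\<lambda>p. nat \<lfloor>max 0 (fst p :: real) * 2 ^ n\<rfloor>) \<in> (borel \<Otimes>\<^sub>M M) \<rightarrow>\<^sub>M count_space UNIV"
      by measurable
  qed
  fix p :: "real \<times> 'a" assume "p \<in> space (borel \<Otimes>\<^sub>M M)"
  then have \<omega>: "snd p \<in> space M" by (auto simp: space_pair_measure)
  define t where "t = max 0 (fst p)"
  have t: "0 \<le> t" by (simp add: t_def)
  have up: "t < up n (fst p)" "up n (fst p) \<le> t + 1 / 2 ^ n" for n
  proof -
    have "t * 2 ^ n < real (nat \<lfloor>t * 2 ^ n\<rfloor>) + 1" "real (nat \<lfloor>t * 2 ^ n\<rfloor>) \<le> t * 2 ^ n"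
      using t by (auto simp: floor_less_iff)
    then show "t < up n (fst p)" "up n (fst p) \<le> t + 1 / 2 ^ n"
      by (auto simp: up_def t_def[symmetric] field_simps)
  qed
  have "(\<lambda>n. t + 1 / 2 ^ n) \<longlonglongrightarrow> t + 0"
    by (intro tendsto_add tendsto_const LIMSEQ_divide_realpow_zero) auto
  then have "(\<lambda>n. up n (fst p)) \<longlonglongrightarrow> t"
    using up by (intro tendsto_sandwich[OF _ _ tendsto_const, of t "\<lambda>n. up n (fst p)"])
      (auto intro!: always_eventually less_imp_le)
  then have "filterlim (\<lambda>n. up n (fst p)) (at_right t) sequentially"
    using up by (intro tendsto_imp_filterlim_at_right) (auto intro!: always_eventually)
  moreover have "((\<lambda>t. X t (snd p)) \<longlongrightarrow> X t (snd p)) (at_right t)"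
    using rc[OF \<omega> t] by (simp add: continuous_within)
  ultimately show "(\<lambda>n. X (up n (fst p)) (snd p)) \<longlonglongrightarrow> X (max 0 (fst p)) (snd p)"
    unfolding t_def[symmetric] by (rule filterlim_compose[rotated])
qed

lemma path_sup_measurable:
  fixes X :: "real \<Rightarrow> 'a \<Rightarrow> real"
  assumes X: "\<And>t. 0 \<le> t \<Longrightarrow> X t \<in> borel_measurable M"
    and cadlag: "\<And>\<omega>. \<omega> \<in> space M \<Longrightarrow> cadlag (\<lambda>t. X t \<omega>)"
  shows "(\<lambda>(s, t, \<omega>). if 0 \<le> s \<and> s \<le> t then path_sup (\<lambda>u. X u \<omega>) s t else 0)
    \<in> borel_measurable (borel \<Otimes>\<^sub>M borel \<Otimes>\<^sub>M M)"
proof (rule borel_measurable_LIMSEQ_metric)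
  have J: "(\<lambda>p. X (max 0 (fst p)) (snd p)) \<in> borel_measurable (borel \<Otimes>\<^sub>M M)"
    using assms by (intro right_continuous_joint_measurable) (auto simp: cadlag_def)
  define G where "G n = (\<lambda>(s, t, \<omega>). if 0 \<le> s \<and> s \<le> t
      then Max ((\<lambda>k. X (max 0 (s + real k * ((t - s) / 2 ^ n))) \<omega>) ` {..2 ^ n}) else 0)" for n :: nat
  have J': "(\<lambda>p. X (max 0 (fst p + real k * ((fst (snd p) - fst p) / 2 ^ n))) (snd (snd p)))
      \<in> borel_measurable (borel \<Otimes>\<^sub>M borel \<Otimes>\<^sub>M M)" for k n :: nat
    using measurable_compose[OF _ J, where f="\<lambda>p. (fst p + real k * ((fst (snd p) - fst p) / 2 ^ n), snd (snd p))"
        and M="borel \<Otimes>\<^sub>M borel \<Otimes>\<^sub>M M"] by simp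
  show "G n \<in> borel_measurable (borel \<Otimes>\<^sub>M borel \<Otimes>\<^sub>M M)" for n
    unfolding G_def case_prod_beta using J' by measurable
  fix p :: "real \<times> real \<times> 'a" assume "p \<in> space (borel \<Otimes>\<^sub>M borel \<Otimes>\<^sub>M M)"
  then obtain s t \<omega> where p: "p = (s, t, \<omega>)" and \<omega>: "\<omega> \<in> space M"
    by (auto simp: space_pair_measure)
  have "G n p = (if 0 \<le> s \<and> s \<le> t then grid_max (\<lambda>u. X u \<omega>) s t n else 0)" for n
  proof -
    have "max 0 (s + real k * ((t - s) / 2 ^ n)) = s + real k * ((t - s) / 2 ^ n)" if "0 \<le> s" "s \<le> t" for k :: nat
      using that by (intro max_absorb2) auto
    then show ?thesis unfolding p G_def grid_max_def by auto
  qed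
  then show "(\<lambda>n. G n p) \<longlonglongrightarrow> (case p of (s, t, \<omega>) \<Rightarrow> if 0 \<le> s \<and> s \<le> t then path_sup (\<lambda>u. X u \<omega>) s t else 0)"
    using cadlag_grid_max_tendsto[OF cadlag[OF \<omega>], of s t] by (auto simp: p)
qed

lemma cadlag_minus:
  assumes "cadlag f" "cadlag g"
  shows "cadlag (\<lambda>t. f t - g t)"
  unfolding cadlag_def
proof safe
  fix t :: real assume t: "0 < t"
  obtain l where "(f \<longlongrightarrow> l) (at_left t)"
    using assms t by (auto simp: cadlag_def)
  moreover obtain m where "(g \<longlongrightarrow> m) (at_left t)"
    using assms t by (auto simp: cadlag_def)
  ultimately show "\<exists>l. ((\<lambda>t. f t - g t) \<longlongrightarrow> l) (at_left t)"
    by (blast intro: tendsto_diff)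
qed (use assms in \<open>auto simp: cadlag_def intro!: continuous_diff\<close>)

lemma cadlag_const: "cadlag (\<lambda>t. c)"
  by (auto simp: cadlag_def intro: tendsto_const)

section \<open>Integration against nondecreasing paths\<close>

definition control_path :: "(real \<Rightarrow> real) \<Rightarrow> bool" where
  "control_path f \<longleftrightarrow> cadlag f \<and> mono_on {0..} f \<and> 0 \<le> f 0"

lemma control_path_nonneg: "control_path f \<Longrightarrow> 0 \<le> t \<Longrightarrow> 0 \<le> f t"
  unfolding control_path_def using mono_onD[of "{0..}" f 0 t] by force

lemma control_path_extension:
  assumes "control_path f"
  shows "\<And>s t. s \<le> t \<Longrightarrow> (if s < 0 then 0 else f s) \<le> (if t < 0 then 0 else f t)"
    and "\<And>a. continuous (at_right a) (\<lambda>t. if t < 0 then 0 else f t)"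
proof -
  show "(if s < 0 then 0 else f s) \<le> (if t < 0 then 0 else f t)" if "s \<le> t" for s t
    using that assms control_path_nonneg[OF assms, of t]
    by (auto simp: control_path_def mono_on_def)
  show "continuous (at_right a) (\<lambda>t. if t < 0 then 0 else f t)" for a
  proof (cases "a < 0")
    case True
    have "eventually (\<lambda>t. t < 0) (at_right a)"
      using True by (auto simp: eventually_at_right[of a 0])
    then have "eventually (\<lambda>t. (if t < 0 then 0 else f t) = 0) (at_right a)"
      by eventually_elim auto
    then show ?thesis
      using True by (auto simp: continuous_within intro: tendsto_eventually)
  next
    case False
    then have "(f \<longlongrightarrow> f a) (at_right a)"
      using assms by (auto simp: control_path_def cadlag_def continuous_within)
    moreover have "eventually (\<lambda>t. f t = (if t < 0 then 0 else f t)) (at_right a)"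
      using False by (auto simp: eventually_at_right[of a "a + 1"] intro!: exI[of _ "a + 1"])
    ultimately have "((\<lambda>t. if t < 0 then 0 else f t) \<longlongrightarrow> f a) (at_right a)"
      by (rule Lim_transform_eventually)
    then show ?thesis using False by (simp add: continuous_within)
  qed
qed

lemma sets_stieltjes_measure[simp, measurable_cong]: "sets (stieltjes_measure f) = sets borel"
  and space_stieltjes_measure[simp]: "space (stieltjes_measure f) = UNIV"
  by (simp_all add: stieltjes_measure_def)

lemma sigma_finite_stieltjes_measure:
  "control_path f \<Longrightarrow> sigma_finite_measure (stieltjes_measure f)"
  unfolding stieltjes_measure_def
  by (intro sigma_finite_interval_measure control_path_extension)

lemma emeasure_stieltjes_Ioc:
  assumes f: "control_path f" and ab: "a \<le> b" "0 \<le> b"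
  shows "emeasure (stieltjes_measure f) {a<..b} = ennreal (f b - (if a < 0 then 0 else f a))"
  unfolding stieltjes_measure_def
  using emeasure_interval_measure_Ioc[OF ab(1) control_path_extension[OF f]] ab by simp

lemma AE_stieltjes_nonneg:
  assumes f: "control_path f"
  shows "AE s in stieltjes_measure f. 0 \<le> s"
proof (rule AE_I)
  have *: "emeasure (stieltjes_measure f) {-real n - 1<..-1 / (real n + 1)} = 0" for n
    unfolding stieltjes_measure_def
    using emeasure_interval_measure_Ioc[of "-real n - 1" "-1 / (real n + 1)", OF _ control_path_extension[OF f]]
    by (auto simp: field_simps)
  have "(\<Union>n. {-real n - 1<..-1 / (real n + 1)}) \<in> null_sets (stieltjes_measure f)"
    using * by (intro null_sets_UN) auto
  then show "emeasure (stieltjes_measure f) (\<Union>n. {-real n - 1<..-1 / (real n + 1)}) = 0"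
    by auto
  show "{s \<in> space (stieltjes_measure f). \<not> 0 \<le> s} \<subseteq> (\<Union>n. {-real n - 1<..-1 / (real n + 1)})"
  proof safe
    fix s :: real assume "\<not> 0 \<le> s"
    then have s: "s < 0" by simp
    obtain n where n: "max (-s) (1 / -s) < real n" using reals_Archimedean2 by blast
    then have "-real n - 1 < s" by simp
    moreover have "s \<le> -1 / (real n + 1)"
    proof -
      have "1 / -s < real n + 1" using n by simp
      then show ?thesis using s by (simp add: field_simps)
    qed
    ultimately show "s \<in> (\<Union>n. {-real n - 1<..-1 / (real n + 1)})" by auto
  qed
qed auto

lemma emeasure_stieltjes_Iic:
  assumes f: "control_path f" and t: "0 \<le> t"
  shows "emeasure (stieltjes_measure f) {..t} = ennreal (f t)"
proof -
  have "emeasure (stieltjes_measure f) {..t} = emeasure (stieltjes_measure f) {-1<..t}"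
    using AE_stieltjes_nonneg[OF f] by (intro emeasure_eq_AE) auto
  then show ?thesis using emeasure_stieltjes_Ioc[OF f, of "-1" t] t by simp
qed

lemma stieltjes_Tonelli:
  assumes f: "control_path f" and [measurable]: "case_prod h \<in> borel_measurable (borel \<Otimes>\<^sub>M borel)"
  shows "(\<integral>\<^sup>+s. (\<integral>\<^sup>+t. h s t \<partial>lborel) \<partial>stieltjes_measure f) =
    (\<integral>\<^sup>+t. (\<integral>\<^sup>+s. h s t \<partial>stieltjes_measure f) \<partial>lborel)"
proof -
  interpret S: sigma_finite_measure "stieltjes_measure f" by (rule sigma_finite_stieltjes_measure[OF f])
  interpret pair_sigma_finite lborel "stieltjes_measure f" ..
  have "case_prod h \<in> borel_measurable (stieltjes_measure f \<Otimes>\<^sub>M lborel)"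
    by (subst measurable_cong_sets[OF sets_pair_measure_cong[of _ borel _ borel] refl]) auto
  then have "(\<lambda>(t, s). h s t) \<in> borel_measurable (lborel \<Otimes>\<^sub>M stieltjes_measure f)"
    using measurable_pair_swap by force
  then show ?thesis using Fubini'[of "\<lambda>t s. h s t"] by simp
qed

lemma stieltjes_integration_by_parts:
  assumes f: "control_path f" and [measurable]: "g \<in> borel_measurable borel"
  shows "(\<integral>\<^sup>+s. (\<integral>\<^sup>+t. g t * indicator {0..} t * indicator {s..} t \<partial>lborel) \<partial>stieltjes_measure f) =
    (\<integral>\<^sup>+t. g t * ennreal (f t) * indicator {0..} t \<partial>lborel)"
proof -
  have "(\<integral>\<^sup>+s. (\<integral>\<^sup>+t. g t * indicator {0..} t * indicator {s..} t \<partial>lborel) \<partial>stieltjes_measure f) =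
      (\<integral>\<^sup>+t. (\<integral>\<^sup>+s. g t * indicator {0..} t * indicator {..t} s \<partial>stieltjes_measure f) \<partial>lborel)"
  proof (subst stieltjes_Tonelli[OF f])
    have "(\<lambda>(s, t). g t * indicator {0..} t * indicator {p. fst p \<le> snd p} (s, t))
        \<in> borel_measurable (borel \<Otimes>\<^sub>M (borel :: real measure))"
      by measurable
    moreover have "indicator {p. fst p \<le> snd p} (s, t) = (indicator {s..} t :: ennreal)" for s t :: real
      by (auto simp: indicator_def)
    ultimately show "(\<lambda>(s, t). g t * indicator {0..} t * indicator {s..} t) \<in> borel_measurable (borel \<Otimes>\<^sub>M borel)"
      by simp
  qed (auto intro!: nn_integral_cong simp: indicator_def)
  also have "\<dots> = (\<integral>\<^sup>+t. g t * indicator {0..} t * emeasure (stieltjes_measure f) {..t} \<partial>lborel)"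
    by (intro nn_integral_cong nn_integral_cmult_indicator) auto
  also have "\<dots> = (\<integral>\<^sup>+t. g t * ennreal (f t) * indicator {0..} t \<partial>lborel)"
    by (intro nn_integral_cong) (auto simp: emeasure_stieltjes_Iic[OF f] indicator_def)
  finally show ?thesis .
qed

lemma nn_integral_discount:
  assumes r: "0 < r"
  shows "(\<integral>\<^sup>+t. ennreal (r * exp (- r * t)) * indicator {s..} t \<partial>lborel) = ennreal (exp (- r * s))"
proof -
  have "(\<integral>\<^sup>+t. ennreal (r * exp (- r * t)) * indicator {s..} t \<partial>lborel) = ennreal (0 - (- exp (- r * s)))"
  proof (rule nn_integral_FTC_atLeast)
    show "((\<lambda>t. - exp (- r * t)) has_real_derivative r * exp (- r * t)) (at t)" for t
      by (auto intro!: derivative_eq_intros)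
    have "((\<lambda>t. - exp (- r * t)) \<longlongrightarrow> - 0) at_top"
      using r by (intro tendsto_minus filterlim_compose[OF exp_at_bot]
          filterlim_tendsto_neg_mult_at_bot[OF tendsto_const] filterlim_ident) auto
    then show "((\<lambda>t. - exp (- r * t)) \<longlongrightarrow> 0) at_top" by simp
  qed (use r in auto)
  then show ?thesis by simp
qed

text \<open>
  Integration by parts turns the Lebesgue-Stieltjes integral into a Lebesgue integral of the
  control itself, in which measurability in further parameters is immediate.
\<close>

lemma discounted_control_eq:
  assumes f: "control_path f" and r: "0 < r"
  shows "(\<integral>\<^sup>+s. ennreal (exp (- r * s)) \<partial>stieltjes_measure f) =
    (\<integral>\<^sup>+t. ennreal (r * exp (- r * t)) * ennreal (f t) * indicator {0..} t \<partial>lborel)"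
proof -
  have "(\<integral>\<^sup>+s. ennreal (exp (- r * s)) \<partial>stieltjes_measure f) =
      (\<integral>\<^sup>+s. (\<integral>\<^sup>+t. ennreal (r * exp (- r * t)) * indicator {0..} t * indicator {s..} t \<partial>lborel) \<partial>stieltjes_measure f)"
  proof (rule nn_integral_cong_AE, use AE_stieltjes_nonneg[OF f] in eventually_elim)
    case (elim s)
    then have "(\<integral>\<^sup>+t. ennreal (r * exp (- r * t)) * indicator {0..} t * indicator {s..} t \<partial>lborel)
        = (\<integral>\<^sup>+t. ennreal (r * exp (- r * t)) * indicator {s..} t \<partial>lborel)"
      by (intro nn_integral_cong) (auto simp: indicator_def)
    then show ?case using nn_integral_discount[OF r, of s] by simp
  qed
  also have "\<dots> = (\<integral>\<^sup>+t. ennreal (r * exp (- r * t)) * ennreal (f t) * indicator {0..} t \<partial>lborel)"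
    by (rule stieltjes_integration_by_parts[OF f]) measurable
  finally show ?thesis .
qed

text \<open>
  The increment with index \<open>0\<close> is the mass at time \<open>0\<close>, that is, the jump from \<open>\<theta>(0-) = 0\<close>.
\<close>

definition grid_increment :: "(real \<Rightarrow> real) \<Rightarrow> nat \<Rightarrow> nat \<Rightarrow> real" where
  "grid_increment f n k = (if k = 0 then f 0 else f (real k / 2 ^ n) - f (real (k - 1) / 2 ^ n))"

text \<open>
  Negative times, which carry no mass, are sent to \<open>0\<close> by \<^const>\<open>nat\<close>.
\<close>

definition next_grid_point :: "nat \<Rightarrow> real \<Rightarrow> real" where
  "next_grid_point n s = real (nat \<lceil>s * 2 ^ n\<rceil>) / 2 ^ n"

lemma next_grid_point:
  assumes "0 \<le> s"
  shows "s \<le> next_grid_point n s" "decseq (\<lambda>n. next_grid_point n s)"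
    "(\<lambda>n. next_grid_point n s) \<longlonglongrightarrow> s"
proof -
  have eq: "next_grid_point n s = of_int \<lceil>s * 2 ^ n\<rceil> / 2 ^ n" for n
    using assms by (simp add: next_grid_point_def)
  show le: "s \<le> next_grid_point n s" for n
    unfolding eq by (simp add: field_simps)
  have up: "next_grid_point n s \<le> s + 1 / 2 ^ n" for n
  proof -
    have "of_int \<lceil>s * 2 ^ n\<rceil> \<le> s * 2 ^ n + 1" by linarith
    then have "of_int \<lceil>s * 2 ^ n\<rceil> / 2 ^ n \<le> (s * 2 ^ n + 1) / 2 ^ n" by (intro divide_right_mono) auto
    then show ?thesis unfolding eq by (simp add: add_divide_distrib)
  qed
  show "decseq (\<lambda>n. next_grid_point n s)"
  proof (rule decseq_SucI)
    fix n
    have "\<lceil>s * 2 ^ Suc n\<rceil> \<le> 2 * \<lceil>s * 2 ^ n\<rceil>"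
      by (simp add: ceiling_le_iff)
    then have "of_int \<lceil>s * 2 ^ Suc n\<rceil> \<le> (2 * of_int \<lceil>s * 2 ^ n\<rceil> :: real)"
      by (metis of_int_le_iff of_int_mult of_int_numeral)
    then show "next_grid_point (Suc n) s \<le> next_grid_point n s"
      unfolding eq by (simp add: field_simps)
  qed
  have "(\<lambda>n. s + 1 / 2 ^ n) \<longlonglongrightarrow> s + 0"
    by (intro tendsto_add tendsto_const LIMSEQ_divide_realpow_zero) auto
  then show "(\<lambda>n. next_grid_point n s) \<longlonglongrightarrow> s"
    using le up by (intro tendsto_sandwich[OF _ _ tendsto_const, of s "\<lambda>n. next_grid_point n s"])
      (auto intro!: always_eventually)
qed

lemma nn_integral_next_grid_point:
  assumes f: "control_path f"
  shows "(\<integral>\<^sup>+s. \<Gamma> (next_grid_point n s) \<partial>stieltjes_measure f) =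
    (\<Sum>k. \<Gamma> (real k / 2 ^ n) * ennreal (grid_increment f n k))"
proof -
  define N where "N s = nat \<lceil>s * 2 ^ n\<rceil>" for s :: real
  have N0: "{s. N s = 0} = {..0}"
    using not_le[of "2 ^ n" "0::real"] by (auto simp: N_def mult_le_0_iff)
  have NS: "{s. N s = Suc k} = {real k / 2 ^ n<..real (Suc k) / 2 ^ n}" for k
  proof -
    have "N s = Suc k \<longleftrightarrow> \<lceil>s * 2 ^ n\<rceil> = int (Suc k)" for s
      unfolding N_def by linarith
    also have "\<dots> s \<longleftrightarrow> real k < s * 2 ^ n \<and> s * 2 ^ n \<le> real (Suc k)" for s
      by (auto simp: ceiling_eq_iff)
    also have "\<dots> s \<longleftrightarrow> s \<in> {real k / 2 ^ n<..real (Suc k) / 2 ^ n}" for s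
      by (auto simp: field_simps)
    finally show ?thesis by blast
  qed
  have meas: "emeasure (stieltjes_measure f) {s. N s = k} = ennreal (grid_increment f n k)" for k
  proof (cases k)
    case 0
    then show ?thesis using N0 emeasure_stieltjes_Iic[OF f, of 0] by (simp add: grid_increment_def)
  next
    case (Suc j)
    then show ?thesis unfolding Suc NS
      by (subst emeasure_stieltjes_Ioc[OF f])
        (auto simp: grid_increment_def divide_right_mono divide_less_0_iff)
  qed
  have sets: "{s. N s = k} \<in> sets borel" for k
    by (cases k) (auto simp: N0 NS)
  have "(\<integral>\<^sup>+s. \<Gamma> (next_grid_point n s) \<partial>stieltjes_measure f) =
      (\<integral>\<^sup>+s. (\<Sum>k. \<Gamma> (real k / 2 ^ n) * indicator {s. N s = k} s) \<partial>stieltjes_measure f)"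
  proof (intro nn_integral_cong)
    fix s
    have "(\<Sum>k. \<Gamma> (real k / 2 ^ n) * indicator {s. N s = k} s) =
        (\<Sum>k\<in>{N s}. \<Gamma> (real k / 2 ^ n) * indicator {s. N s = k} s)"
      by (intro suminf_finite) (auto simp: indicator_def)
    then show "\<Gamma> (next_grid_point n s) = (\<Sum>k. \<Gamma> (real k / 2 ^ n) * indicator {s. N s = k} s)"
      by (simp add: next_grid_point_def N_def)
  qed
  also have "\<dots> = (\<Sum>k. \<integral>\<^sup>+s. \<Gamma> (real k / 2 ^ n) * indicator {s. N s = k} s \<partial>stieltjes_measure f)"
    using sets by (intro nn_integral_suminf) auto
  also have "\<dots> = (\<Sum>k. \<Gamma> (real k / 2 ^ n) * ennreal (grid_increment f n k))"
    using sets by (simp add: nn_integral_cmult_indicator meas)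
  finally show ?thesis .
qed

text \<open>
  Because the integrand is nonincreasing, evaluating it at the next grid point approximates it
  from below, so that monotone convergence applies without any bound on the integrand.
\<close>

lemma stieltjes_integral_SUP:
  assumes f: "control_path f"
    and anti: "\<And>s t. 0 \<le> s \<Longrightarrow> s \<le> t \<Longrightarrow> \<Gamma> t \<le> \<Gamma> s"
    and rc: "\<And>s \<sigma>. 0 \<le> s \<Longrightarrow> (\<And>n. s \<le> \<sigma> n) \<Longrightarrow> decseq \<sigma> \<Longrightarrow> \<sigma> \<longlonglongrightarrow> s \<Longrightarrow> (SUP n. \<Gamma> (\<sigma> n)) = \<Gamma> s"
  shows "incseq (\<lambda>n. \<Sum>k. \<Gamma> (real k / 2 ^ n) * ennreal (grid_increment f n k))" (is "incseq ?S")
    and "(\<integral>\<^sup>+s. \<Gamma> s \<partial>stieltjes_measure f) = (SUP n. \<Sum>k. \<Gamma> (real k / 2 ^ n) * ennreal (grid_increment f n k))"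
proof -
  have mono: "AE s in stieltjes_measure f. \<Gamma> (next_grid_point n s) \<le> \<Gamma> (next_grid_point (Suc n) s)" for n
    using AE_stieltjes_nonneg[OF f]
  proof eventually_elim
    case (elim s)
    have "s \<le> next_grid_point (Suc n) s" "next_grid_point (Suc n) s \<le> next_grid_point n s"
      using next_grid_point[OF elim] by (auto simp: decseq_Suc_iff)
    then show ?case using elim by (intro anti) auto
  qed
  have S: "?S n = (\<integral>\<^sup>+s. \<Gamma> (next_grid_point n s) \<partial>stieltjes_measure f)" for n
    by (rule nn_integral_next_grid_point[OF f, symmetric])
  show "incseq ?S"
    unfolding S by (intro incseq_SucI nn_integral_mono_AE mono)
  have meas: "(\<lambda>s. \<Gamma> (next_grid_point n s)) \<in> borel_measurable borel" for n
    unfolding next_grid_point_def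
    by (rule measurable_compose_countable[where f="\<lambda>k s. \<Gamma> (real k / 2 ^ n)" and g="\<lambda>s. nat \<lceil>s * 2 ^ n\<rceil>"])
      measurable
  have "(\<integral>\<^sup>+s. \<Gamma> s \<partial>stieltjes_measure f) = (\<integral>\<^sup>+s. (SUP n. \<Gamma> (next_grid_point n s)) \<partial>stieltjes_measure f)"
  proof (rule nn_integral_cong_AE, use AE_stieltjes_nonneg[OF f] in eventually_elim)
    case (elim s)
    then show ?case using rc[of s "\<lambda>n. next_grid_point n s"] next_grid_point[OF elim] by simp
  qed
  also have "\<dots> = (SUP n. ?S n)"
    unfolding S using mono meas by (intro nn_integral_monotone_convergence_SUP_AE) auto
  finally show "(\<integral>\<^sup>+s. \<Gamma> s \<partial>stieltjes_measure f) = (SUP n. ?S n)" .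
qed

section \<open>Compositions of independent random maps\<close>

text \<open>
  The two orders of composition of the maps \<open>u (\<xi> 0), \<dots>, u (\<xi> (n - 1))\<close>: the latest map is applied
  first in \<open>compose_inner\<close> and last in \<open>compose_outer\<close>.
\<close>

primrec compose_inner :: "(real \<Rightarrow> real \<Rightarrow> real) \<Rightarrow> (nat \<Rightarrow> real) \<Rightarrow> nat \<Rightarrow> real \<Rightarrow> real" where
  "compose_inner u \<xi> 0 y = y"
| "compose_inner u \<xi> (Suc n) y = compose_inner u \<xi> n (u (\<xi> n) y)"

primrec compose_outer :: "(real \<Rightarrow> real \<Rightarrow> real) \<Rightarrow> (nat \<Rightarrow> real) \<Rightarrow> nat \<Rightarrow> real \<Rightarrow> real" where
  "compose_outer u \<xi> 0 y = y"
| "compose_outer u \<xi> (Suc n) y = u (\<xi> n) (compose_outer u \<xi> n y)"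

text \<open>
  The transition operator of the Markov chain whose steps apply \<open>u z\<close> with \<open>z\<close> distributed
  according to \<open>\<mu>\<close>.
\<close>

definition average :: "(real \<Rightarrow> real \<Rightarrow> real) \<Rightarrow> real measure \<Rightarrow> (real \<Rightarrow> ennreal) \<Rightarrow> real \<Rightarrow> ennreal" where
  "average u \<mu> f y = (\<integral>\<^sup>+z. f (u z y) \<partial>\<mu>)"

text \<open>
  The steps of the Lindley recursions for the distance of a walk below its running maximum
  (\<open>fall\<close>) and above its running minimum (\<open>rise\<close>).
\<close>

definition fall :: "real \<Rightarrow> real \<Rightarrow> real" where "fall z y = max 0 (y - z)"
definition rise :: "real \<Rightarrow> real \<Rightarrow> real" where "rise z y = max 0 (y + z)"

lemma fall_measurable[measurable]: "case_prod fall \<in> borel_measurable (borel \<Otimes>\<^sub>M borel)"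
  and rise_measurable[measurable]: "case_prod rise \<in> borel_measurable (borel \<Otimes>\<^sub>M borel)"
  unfolding fall_def rise_def by measurable

lemma average_measurable:
  assumes \<mu>: "prob_space \<mu>" "sets \<mu> = sets borel"
    and u[measurable]: "case_prod u \<in> borel_measurable (borel \<Otimes>\<^sub>M borel)"
    and f[measurable]: "f \<in> borel_measurable borel"
  shows "(average u \<mu> ^^ n) f \<in> borel_measurable borel"
proof (induction n)
  case (Suc n)
  interpret prob_space \<mu> by fact
  note [measurable_cong] = \<mu>(2)
  define g where "g = (average u \<mu> ^^ n) f"
  have [measurable]: "g \<in> borel_measurable borel" unfolding g_def by (rule Suc)
  have "average u \<mu> g \<in> borel_measurable borel" unfolding average_def[abs_def] by measurable
  then show ?case by (simp add: g_def)
qed simp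

lemma Max_atMost_Suc:
  fixes g :: "nat \<Rightarrow> real"
  shows "Max (g ` {..Suc n}) = max (Max (g ` {..n})) (g (Suc n))"
  by (simp add: atMost_Suc max.commute)

lemma compose_outer_fall:
  "compose_outer fall (\<lambda>k. g (Suc k) - g k) n 0 = Max (g ` {..n}) - g n"
proof (induction n)
  case (Suc n)
  have "max 0 (a - b - (c - b)) = max a c - c" for a b c :: real by auto
  then show ?case unfolding compose_outer.simps Suc Max_atMost_Suc unfolding fall_def .
qed simp

text \<open>
  The statement with a general starting point \<open>y\<close> is what the induction carries: the latest map
  changes the starting point of the remaining composition.
\<close>

lemma compose_inner_fall:
  "0 \<le> y \<Longrightarrow> compose_inner fall (\<lambda>k. g (Suc k) - g k) n y =
    max (Max ((\<lambda>k. g 0 - g k) ` {..n})) (g 0 - g n + y)"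
proof (induction n arbitrary: y)
  case (Suc n)
  have le: "g 0 - g n \<le> Max ((\<lambda>k. g 0 - g k) ` {..n})" by (intro Max_ge) auto
  have "0 \<le> fall (g (Suc n) - g n) y" by (simp add: fall_def)
  note IH = Suc.IH[OF this]
  have "max a (b - c + max 0 (y - (d - c))) = max (max a (b - d)) (b - d + y)"
    if "b - c \<le> a" for a b c d :: real
    using that Suc.prems by auto
  from this[OF le] show ?case
    unfolding Max_atMost_Suc compose_inner.simps IH unfolding fall_def .
qed simp

lemma compose_inner_rise:
  "compose_inner rise (\<lambda>k. g (Suc k) - g k) n 0 = Max ((\<lambda>k. g k - g 0) ` {..n})"
proof -
  have "compose_inner rise \<xi> n y = compose_inner fall (\<lambda>k. - \<xi> k) n y" for \<xi> y
    by (induction n arbitrary: y) (auto simp: rise_def fall_def)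
  from this[of "\<lambda>k. g (Suc k) - g k" 0] show ?thesis
    using compose_inner_fall[of 0 "\<lambda>k. - g k" n]
    by (simp add: max_def) (auto intro!: antisym Max_ge)
qed

text \<open>
  Independence of \<open>Z\<close> and the \<open>\<sigma>\<close>-algebra \<open>G\<close> makes the law of \<open>(\<omega>, Z \<omega>)\<close> on \<open>G \<Otimes>\<^sub>M borel\<close> a product
  measure. Keeping \<open>\<omega>\<close> itself as the first component allows integrands that depend on the whole
  past at once.
\<close>

lemma (in prob_space) nn_integral_indep:
  assumes G: "subalgebra M G" and Z[measurable]: "Z \<in> borel_measurable M"
    and indep: "indep_set (sets G) (sets (vimage_algebra (space M) Z borel))"
    and h[measurable]: "h \<in> borel_measurable (G \<Otimes>\<^sub>M borel)"
  shows "(\<integral>\<^sup>+\<omega>. h (\<omega>, Z \<omega>) \<partial>M) = (\<integral>\<^sup>+\<omega>. (\<integral>\<^sup>+z. h (\<omega>, z) \<partial>distr M borel Z) \<partial>M)"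
proof -
  have id[measurable]: "(\<lambda>\<omega>. \<omega>) \<in> measurable M G"
    using G by (auto simp: subalgebra_def measurable_def sets.Int_space_eq2)
  interpret Z: prob_space "distr M borel Z" by (rule prob_space_distr) simp
  interpret G: prob_space "distr M G (\<lambda>\<omega>. \<omega>)" by (rule prob_space_distr) simp
  have prod: "distr M G (\<lambda>\<omega>. \<omega>) \<Otimes>\<^sub>M distr M borel Z = distr M (G \<Otimes>\<^sub>M borel) (\<lambda>\<omega>. (\<omega>, Z \<omega>))"
  proof (rule pair_measure_eqI)
    fix A B assume "A \<in> sets (distr M G (\<lambda>\<omega>. \<omega>))" "B \<in> sets (distr M borel Z)"
    then have [measurable]: "A \<in> sets G" "B \<in> sets borel" by auto
    have "Z -` B \<inter> space M \<in> sets (vimage_algebra (space M) Z borel)"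
      by (intro in_vimage_algebra) auto
    then have "prob (A \<inter> (Z -` B \<inter> space M)) = prob A * prob (Z -` B \<inter> space M)"
      using indep_setD[OF indep \<open>A \<in> sets G\<close>] by simp
    moreover have "A \<subseteq> space M"
      using sets.sets_into_space[OF \<open>A \<in> sets G\<close>] G by (simp add: subalgebra_def)
    then have "(\<lambda>\<omega>. (\<omega>, Z \<omega>)) -` (A \<times> B) \<inter> space M = A \<inter> (Z -` B \<inter> space M)"
      "(\<lambda>\<omega>. \<omega>) -` A \<inter> space M = A" by auto
    ultimately show "emeasure (distr M G (\<lambda>\<omega>. \<omega>)) A * emeasure (distr M borel Z) B =
        emeasure (distr M (G \<Otimes>\<^sub>M borel) (\<lambda>\<omega>. (\<omega>, Z \<omega>))) (A \<times> B)"
      by (simp add: emeasure_distr emeasure_eq_measure ennreal_mult)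
  qed (auto intro: G.sigma_finite_measure_axioms Z.sigma_finite_measure_axioms)
  have "(\<integral>\<^sup>+\<omega>. h (\<omega>, Z \<omega>) \<partial>M) = (\<integral>\<^sup>+p. h p \<partial>distr M (G \<Otimes>\<^sub>M borel) (\<lambda>\<omega>. (\<omega>, Z \<omega>)))"
    by (subst nn_integral_distr) auto
  also have "\<dots> = (\<integral>\<^sup>+\<omega>. (\<integral>\<^sup>+z. h (\<omega>, z) \<partial>distr M borel Z) \<partial>distr M G (\<lambda>\<omega>. \<omega>))"
    unfolding prod[symmetric] by (subst Z.nn_integral_fst[symmetric]) auto
  also have "\<dots> = (\<integral>\<^sup>+\<omega>. (\<integral>\<^sup>+z. h (\<omega>, z) \<partial>distr M borel Z) \<partial>M)"
    by (subst nn_integral_distr) auto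
  finally show ?thesis .
qed

context levy_process
begin

abbreviation increment_law :: "real \<Rightarrow> real measure" where
  "increment_law h \<equiv> distr M borel (\<lambda>\<omega>. X h \<omega> - X 0 \<omega>)"

abbreviation dyadic_limit :: "(real \<Rightarrow> real \<Rightarrow> real) \<Rightarrow> (real \<Rightarrow> ennreal) \<Rightarrow> real \<Rightarrow> ennreal" where
  "dyadic_limit u \<phi> t \<equiv> (SUP n. (average u (increment_law (t / 2 ^ n)) ^^ (2 ^ n)) \<phi> 0)"

abbreviation increments :: "real \<Rightarrow> real \<Rightarrow> 'a \<Rightarrow> nat \<Rightarrow> real" where
  "increments s h \<omega> k \<equiv> X (s + real (Suc k) * h) \<omega> - X (s + real k * h) \<omega>"

lemma subalgebra_F_mono: "s \<le> t \<Longrightarrow> subalgebra (F t) (F s)"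
  using sets_F_mono[of s t] by (simp add: subalgebra_def space_F)

lemma X_measurable_F: "0 \<le> s \<Longrightarrow> s \<le> t \<Longrightarrow> X s \<in> borel_measurable (F t)"
  using adapted_X measurable_from_subalg[OF subalgebra_F_mono[of s t]] by (auto simp: adapted_def)

lemma X_measurable: "0 \<le> t \<Longrightarrow> X t \<in> borel_measurable M"
  using adapted_X measurable_from_subalg[OF subalgebra_F[of t]] by (auto simp: adapted_def)

lemma F_measurable_M: "0 \<le> t \<Longrightarrow> f \<in> measurable (F t) N \<Longrightarrow> f \<in> measurable M N"
  using measurable_from_subalg[OF subalgebra_F[of t]] by blast

lemma prob_space_increment_law: "0 \<le> h \<Longrightarrow> prob_space (increment_law h)"
  by (intro prob_space_distr borel_measurable_diff X_measurable) auto

lemma nn_integral_increment: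
  assumes s: "0 \<le> s" "0 \<le> h" and g: "g \<in> borel_measurable (F s \<Otimes>\<^sub>M borel)"
  shows "(\<integral>\<^sup>+\<omega>. g (\<omega>, X (s + h) \<omega> - X s \<omega>) \<partial>M) = (\<integral>\<^sup>+\<omega>. (\<integral>\<^sup>+z. g (\<omega>, z) \<partial>increment_law h) \<partial>M)"
proof -
  have "(\<integral>\<^sup>+\<omega>. g (\<omega>, X (s + h) \<omega> - X s \<omega>) \<partial>M) =
      (\<integral>\<^sup>+\<omega>. (\<integral>\<^sup>+z. g (\<omega>, z) \<partial>distr M borel (\<lambda>\<omega>. X (s + h) \<omega> - X s \<omega>)) \<partial>M)"
    using s by (intro nn_integral_indep[OF subalgebra_F _ _ g] borel_measurable_diff X_measurable
        independent_increments) auto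
  then show ?thesis using stationary_increments[of s "s + h"] s by simp
qed

lemma
  assumes s: "0 \<le> s" "0 \<le> h" and u[measurable]: "case_prod u \<in> borel_measurable (borel \<Otimes>\<^sub>M borel)"
  shows compose_inner_measurable:
      "(\<lambda>p. compose_inner u (increments s h (fst p)) n (snd p)) \<in> borel_measurable (F (s + real n * h) \<Otimes>\<^sub>M borel)"
    and compose_outer_measurable:
      "(\<lambda>\<omega>. compose_outer u (increments s h \<omega>) n y) \<in> borel_measurable (F (s + real n * h))"
proof -
  have incr: "(\<lambda>\<omega>. increments s h \<omega> k) \<in> borel_measurable (F (s + real n * h))" if "k < n" for k n
  proof -
    have "real (Suc k) * h \<le> real n * h" "real k * h \<le> real n * h" "0 \<le> real (Suc k) * h" "0 \<le> real k * h"
      using that s by (auto intro!: mult_right_mono simp del: of_nat_Suc)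
    then show ?thesis using s by (intro borel_measurable_diff X_measurable_F) linarith+
  qed
  have "(\<lambda>p. compose_inner u (increments s h (fst p)) m (snd p)) \<in> borel_measurable (F (s + real n * h) \<Otimes>\<^sub>M borel)"
    if "m \<le> n" for m
    using that
  proof (induction m)
    case (Suc m)
    have [measurable]: "(\<lambda>\<omega>. increments s h \<omega> m) \<in> borel_measurable (F (s + real n * h))"
      using Suc.prems by (intro incr) auto
    have "(\<lambda>p. (fst p, u (increments s h (fst p) m) (snd p)))
        \<in> measurable (F (s + real n * h) \<Otimes>\<^sub>M borel) (F (s + real n * h) \<Otimes>\<^sub>M borel)"
      by measurable
    from measurable_compose[OF this Suc.IH] show ?case using Suc.prems by simp
  qed simp
  then show "(\<lambda>p. compose_inner u (increments s h (fst p)) n (snd p)) \<in> borel_measurable (F (s + real n * h) \<Otimes>\<^sub>M borel)"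
    by simp
  have "(\<lambda>\<omega>. compose_outer u (increments s h \<omega>) m y) \<in> borel_measurable (F (s + real n * h))" if "m \<le> n" for m
    using that
  proof (induction m)
    case (Suc m)
    have [measurable]: "(\<lambda>\<omega>. increments s h \<omega> m) \<in> borel_measurable (F (s + real n * h))"
      using Suc.prems by (intro incr) auto
    have [measurable]: "(\<lambda>\<omega>. compose_outer u (increments s h \<omega>) m y) \<in> borel_measurable (F (s + real n * h))"
      using Suc by simp
    then show ?case
      using measurable_compose[OF measurable_Pair[OF \<open>(\<lambda>\<omega>. increments s h \<omega> m) \<in> _\<close>] u] by simp
  qed simp
  then show "(\<lambda>\<omega>. compose_outer u (increments s h \<omega>) n y) \<in> borel_measurable (F (s + real n * h))"
    by simp
qed

text \<open>
  The latest increment is independent of all that precedes it, so it can be averaged out first.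
  In the outer composition this replaces \<open>f\<close> by its average, in the inner one it averages over the
  starting point. In both cases \<open>n\<close> steps produce the same power of the averaging operator: the
  discrete form of time reversal.
\<close>

lemma nn_integral_compose_outer:
  assumes s: "0 \<le> s" "0 \<le> h" and u[measurable]: "case_prod u \<in> borel_measurable (borel \<Otimes>\<^sub>M borel)"
    and D[measurable]: "D \<in> borel_measurable (F s)" and f: "f \<in> borel_measurable borel"
  shows "(\<integral>\<^sup>+\<omega>. D \<omega> * f (compose_outer u (increments s h \<omega>) n y) \<partial>M) =
    (\<integral>\<^sup>+\<omega>. D \<omega> \<partial>M) * (average u (increment_law h) ^^ n) f y"
  using f
proof (induction n arbitrary: f)
  case 0
  then show ?case using F_measurable_M[OF s(1) D] by (simp add: nn_integral_multc)
next
  case (Suc n)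
  note [measurable] = Suc.prems
  let ?t = "s + real n * h"
  interpret \<mu>: prob_space "increment_law h" by (rule prob_space_increment_law[OF s(2)])
  have D'[measurable]: "D \<in> borel_measurable (F ?t)"
    using s by (intro measurable_from_subalg[OF subalgebra_F_mono D]) auto
  have [measurable]: "(\<lambda>\<omega>. compose_outer u (increments s h \<omega>) n y) \<in> borel_measurable (F ?t)"
    by (rule compose_outer_measurable[OF s u])
  let ?g = "\<lambda>p. D (fst p) * f (u (snd p) (compose_outer u (increments s h (fst p)) n y))"
  have g: "?g \<in> borel_measurable (F ?t \<Otimes>\<^sub>M borel)" by measurable
  have t: "0 \<le> ?t" using s by auto
  have eq: "s + real (Suc n) * h = ?t + h" by (simp add: algebra_simps)
  have "(\<integral>\<^sup>+\<omega>. D \<omega> * f (compose_outer u (increments s h \<omega>) (Suc n) y) \<partial>M) =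
      (\<integral>\<^sup>+\<omega>. (\<integral>\<^sup>+z. D \<omega> * f (u z (compose_outer u (increments s h \<omega>) n y)) \<partial>increment_law h) \<partial>M)"
    unfolding compose_outer.simps eq
    using nn_integral_increment[OF t s(2) g] by simp
  also have "\<dots> = (\<integral>\<^sup>+\<omega>. D \<omega> * average u (increment_law h) f (compose_outer u (increments s h \<omega>) n y) \<partial>M)"
    by (simp add: nn_integral_cmult average_def)
  also have "\<dots> = (\<integral>\<^sup>+\<omega>. D \<omega> \<partial>M) * (average u (increment_law h) ^^ n) (average u (increment_law h) f) y"
    using average_measurable[OF \<mu>.prob_space_axioms _ u Suc.prems, of 1] by (intro Suc.IH) simp
  finally show ?case by (simp only: funpow_Suc_right o_apply)
qed

lemma nn_integral_compose_inner:
  assumes s: "0 \<le> s" "0 \<le> h" and u[measurable]: "case_prod u \<in> borel_measurable (borel \<Otimes>\<^sub>M borel)"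
    and D[measurable]: "D \<in> borel_measurable (F s)" and f[measurable]: "f \<in> borel_measurable borel"
  shows "(\<integral>\<^sup>+\<omega>. D \<omega> * f (compose_inner u (increments s h \<omega>) n y) \<partial>M) =
    (\<integral>\<^sup>+\<omega>. D \<omega> \<partial>M) * (average u (increment_law h) ^^ n) f y"
proof (induction n arbitrary: y)
  case 0
  then show ?case using F_measurable_M[OF s(1) D] by (simp add: nn_integral_multc)
next
  case (Suc n)
  let ?t = "s + real n * h"
  interpret \<mu>: prob_space "increment_law h" by (rule prob_space_increment_law[OF s(2)])
  interpret pair_sigma_finite M "increment_law h" ..
  have t: "0 \<le> ?t" using s by auto
  have D'[measurable]: "D \<in> borel_measurable (F ?t)"
    using s by (intro measurable_from_subalg[OF subalgebra_F_mono D]) auto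
  have "(\<lambda>p. (fst p, u (snd p) y)) \<in> measurable (F ?t \<Otimes>\<^sub>M borel) (F ?t \<Otimes>\<^sub>M borel)" by measurable
  from measurable_compose[OF this compose_inner_measurable[OF s u]]
  have C[measurable]: "(\<lambda>p. compose_inner u (increments s h (fst p)) n (u (snd p) y)) \<in> borel_measurable (F ?t \<Otimes>\<^sub>M borel)"
    by simp
  let ?g = "\<lambda>p. D (fst p) * f (compose_inner u (increments s h (fst p)) n (u (snd p) y))"
  have g: "?g \<in> borel_measurable (F ?t \<Otimes>\<^sub>M borel)" by measurable
  have "(\<lambda>p. p) \<in> measurable (M \<Otimes>\<^sub>M borel) (F ?t \<Otimes>\<^sub>M borel)"
    using measurable_from_subalg[OF subalgebra_F[OF t] measurable_ident]
    by (intro measurable_pair) (auto simp: o_def id_def intro: measurable_compose[OF measurable_fst])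
  from measurable_compose[OF this g]
  have g': "?g \<in> borel_measurable (M \<Otimes>\<^sub>M increment_law h)" by simp
  have eq: "s + real (Suc n) * h = ?t + h" by (simp add: algebra_simps)
  have "(\<integral>\<^sup>+\<omega>. D \<omega> * f (compose_inner u (increments s h \<omega>) (Suc n) y) \<partial>M) =
      (\<integral>\<^sup>+\<omega>. (\<integral>\<^sup>+z. D \<omega> * f (compose_inner u (increments s h \<omega>) n (u z y)) \<partial>increment_law h) \<partial>M)"
    unfolding compose_inner.simps eq
    using nn_integral_increment[OF t s(2) g] by simp
  also have "\<dots> = (\<integral>\<^sup>+z. (\<integral>\<^sup>+\<omega>. D \<omega> * f (compose_inner u (increments s h \<omega>) n (u z y)) \<partial>M) \<partial>increment_law h)"
    using Fubini'[of "\<lambda>\<omega> z. D \<omega> * f (compose_inner u (increments s h \<omega>) n (u z y))"] g'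
    by (simp add: case_prod_beta')
  also have "\<dots> = (\<integral>\<^sup>+z. (\<integral>\<^sup>+\<omega>. D \<omega> \<partial>M) * (average u (increment_law h) ^^ n) f (u z y) \<partial>increment_law h)"
    by (simp only: Suc.IH)
  also have "\<dots> = (\<integral>\<^sup>+\<omega>. D \<omega> \<partial>M) * average u (increment_law h) ((average u (increment_law h) ^^ n) f) y"
    using average_measurable[OF \<mu>.prob_space_axioms _ u f, of n]
    unfolding average_def[of u _ "(average u (increment_law h) ^^ n) f"]
    by (intro nn_integral_cmult) simp
  finally show ?case by simp
qed

section \<open>Running extrema of Levy processes\<close>

text \<open>
  Monotone functionals of grid approximations converge monotonically, so a product formula on
  every grid passes to the limit.
\<close>

lemma nn_integral_grid_limit:
  fixes \<phi> :: "real \<Rightarrow> ennreal"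
  assumes s: "0 \<le> s" "0 \<le> t" and \<phi>: "mono \<phi>" "continuous_on UNIV \<phi>"
    and D[measurable]: "D \<in> borel_measurable (F s)"
    and Z: "\<And>n. Z n \<in> borel_measurable M"
      "\<And>\<omega>. \<omega> \<in> space M \<Longrightarrow> incseq (\<lambda>n. Z n \<omega>)" "\<And>\<omega>. \<omega> \<in> space M \<Longrightarrow> (\<lambda>n. Z n \<omega>) \<longlonglongrightarrow> W \<omega>"
    and law: "\<And>n. (\<integral>\<^sup>+\<omega>. D \<omega> * \<phi> (Z n \<omega>) \<partial>M) = (\<integral>\<^sup>+\<omega>. D \<omega> \<partial>M) * e n"
  shows "(\<integral>\<^sup>+\<omega>. D \<omega> * \<phi> (W \<omega>) \<partial>M) = (\<integral>\<^sup>+\<omega>. D \<omega> \<partial>M) * (SUP n. e n)"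
proof -
  have [measurable]: "\<phi> \<in> borel_measurable borel" using \<phi> by (intro borel_measurable_continuous_onI)
  note [measurable] = Z(1) F_measurable_M[OF s(1) D]
  have "(\<integral>\<^sup>+\<omega>. D \<omega> * \<phi> (W \<omega>) \<partial>M) = (\<integral>\<^sup>+\<omega>. (SUP n. D \<omega> * \<phi> (Z n \<omega>)) \<partial>M)"
  proof (intro nn_integral_cong)
    fix \<omega> assume \<omega>: "\<omega> \<in> space M"
    show "D \<omega> * \<phi> (W \<omega>) = (SUP n. D \<omega> * \<phi> (Z n \<omega>))"
      by (simp add: mono_continuous_SUP[OF \<phi> Z(2)[OF \<omega>] Z(3)[OF \<omega>], symmetric] SUP_mult_left_ennreal)
  qed
  also have "\<dots> = (SUP n. \<integral>\<^sup>+\<omega>. D \<omega> * \<phi> (Z n \<omega>) \<partial>M)"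
    using Z(2) \<phi>(1) by (intro nn_integral_monotone_convergence_SUP_AE)
      (auto intro!: mult_left_mono simp: incseq_Suc_iff mono_def)
  finally show ?thesis by (simp add: law SUP_mult_left_ennreal)
qed

lemma grid_max_measurable:
  assumes "0 \<le> s" "0 \<le> t" "\<And>u. 0 \<le> u \<Longrightarrow> Y u \<in> borel_measurable M"
  shows "(\<lambda>\<omega>. grid_max (\<lambda>u. Y u \<omega>) s (s + t) n) \<in> borel_measurable M"
  unfolding grid_max_def using assms by (intro borel_measurable_Max) auto

text \<open>
  On a dyadic grid, the distance below the running maximum and the depth of the running minimum
  are the outer and the inner composition of the same maps \<open>fall\<close>; the first two right-hand sides
  agree for this reason. The factor \<open>D\<close> expresses independence of the past.
\<close>

lemma
  assumes s: "0 \<le> s" "0 \<le> t" and \<phi>: "mono \<phi>" "continuous_on UNIV \<phi>"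
    and D: "D \<in> borel_measurable (F s)"
  shows nn_integral_drawdown: "(\<integral>\<^sup>+\<omega>. D \<omega> * \<phi> (path_sup (\<lambda>u. X u \<omega>) s (s + t) - X (s + t) \<omega>) \<partial>M) =
      (\<integral>\<^sup>+\<omega>. D \<omega> \<partial>M) * dyadic_limit fall \<phi> t"
    and nn_integral_depth: "(\<integral>\<^sup>+\<omega>. D \<omega> * \<phi> (path_sup (\<lambda>u. X s \<omega> - X u \<omega>) s (s + t)) \<partial>M) =
      (\<integral>\<^sup>+\<omega>. D \<omega> \<partial>M) * dyadic_limit fall \<phi> t"
    and nn_integral_height: "(\<integral>\<^sup>+\<omega>. D \<omega> * \<phi> (path_sup (\<lambda>u. X u \<omega> - X s \<omega>) s (s + t)) \<partial>M) =
      (\<integral>\<^sup>+\<omega>. D \<omega> \<partial>M) * dyadic_limit rise \<phi> t"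
proof -
  have \<phi>m: "\<phi> \<in> borel_measurable borel" using \<phi> by (intro borel_measurable_continuous_onI)
  have h: "0 \<le> t / 2 ^ n" for n using s by simp
  have end_point: "s + real (2 ^ n) * (t / 2 ^ n) = s + t" for n by simp
  show "(\<integral>\<^sup>+\<omega>. D \<omega> * \<phi> (path_sup (\<lambda>u. X u \<omega>) s (s + t) - X (s + t) \<omega>) \<partial>M) =
      (\<integral>\<^sup>+\<omega>. D \<omega> \<partial>M) * dyadic_limit fall \<phi> t"
  proof (rule nn_integral_grid_limit[OF s \<phi> D, where Z="\<lambda>n \<omega>. grid_max (\<lambda>u. X u \<omega>) s (s + t) n - X (s + t) \<omega>"])
    show "(\<integral>\<^sup>+\<omega>. D \<omega> * \<phi> (grid_max (\<lambda>u. X u \<omega>) s (s + t) n - X (s + t) \<omega>) \<partial>M) =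
        (\<integral>\<^sup>+\<omega>. D \<omega> \<partial>M) * (average fall (increment_law (t / 2 ^ n)) ^^ 2 ^ n) \<phi> 0" for n
      using nn_integral_compose_outer[OF s(1) h fall_measurable D \<phi>m, of n "2 ^ n" 0]
      unfolding compose_outer_fall[of "\<lambda>k. X (s + real k * (t / 2 ^ n)) _"] end_point
      by (simp add: grid_max_def)
    show "incseq (\<lambda>n. grid_max (\<lambda>u. X u \<omega>) s (s + t) n - X (s + t) \<omega>)" for \<omega>
      using incseq_grid_max by (simp add: incseq_def)
    show "(\<lambda>n. grid_max (\<lambda>u. X u \<omega>) s (s + t) n - X (s + t) \<omega>)
        \<longlonglongrightarrow> path_sup (\<lambda>u. X u \<omega>) s (s + t) - X (s + t) \<omega>" if "\<omega> \<in> space M" for \<omega>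
      using s that by (intro tendsto_diff tendsto_const cadlag_grid_max_tendsto cadlag_paths) auto
    show "(\<lambda>\<omega>. grid_max (\<lambda>u. X u \<omega>) s (s + t) n - X (s + t) \<omega>) \<in> borel_measurable M" for n
      using s by (intro borel_measurable_diff grid_max_measurable X_measurable) auto
  qed
  show "(\<integral>\<^sup>+\<omega>. D \<omega> * \<phi> (path_sup (\<lambda>u. X s \<omega> - X u \<omega>) s (s + t)) \<partial>M) =
      (\<integral>\<^sup>+\<omega>. D \<omega> \<partial>M) * dyadic_limit fall \<phi> t"
  proof (rule nn_integral_grid_limit[OF s \<phi> D, where Z="\<lambda>n \<omega>. grid_max (\<lambda>u. X s \<omega> - X u \<omega>) s (s + t) n"])
    show "(\<integral>\<^sup>+\<omega>. D \<omega> * \<phi> (grid_max (\<lambda>u. X s \<omega> - X u \<omega>) s (s + t) n) \<partial>M) =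
        (\<integral>\<^sup>+\<omega>. D \<omega> \<partial>M) * (average fall (increment_law (t / 2 ^ n)) ^^ 2 ^ n) \<phi> 0" for n
    proof -
      have "grid_max (\<lambda>u. X s \<omega> - X u \<omega>) s (s + t) n =
          compose_inner fall (increments s (t / 2 ^ n) \<omega>) (2 ^ n) 0" for \<omega>
      proof -
        have "X s \<omega> - X (s + real (2 ^ n) * (t / 2 ^ n)) \<omega>
            \<le> Max ((\<lambda>k. X s \<omega> - X (s + real k * (t / 2 ^ n)) \<omega>) ` {..2 ^ n})"
          by (intro Max_ge image_eqI[of _ _ "2 ^ n"]) auto
        then show ?thesis
          using compose_inner_fall[of 0 "\<lambda>k. X (s + real k * (t / 2 ^ n)) \<omega>" "2 ^ n"]
          by (simp add: grid_max_def max_absorb1)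
      qed
      then show ?thesis
        using nn_integral_compose_inner[OF s(1) h fall_measurable D \<phi>m, of n "2 ^ n" 0] by simp
    qed
    show "(\<lambda>n. grid_max (\<lambda>u. X s \<omega> - X u \<omega>) s (s + t) n)
        \<longlonglongrightarrow> path_sup (\<lambda>u. X s \<omega> - X u \<omega>) s (s + t)" if "\<omega> \<in> space M" for \<omega>
      using s that by (intro cadlag_grid_max_tendsto cadlag_minus cadlag_const cadlag_paths) auto
    show "(\<lambda>\<omega>. grid_max (\<lambda>u. X s \<omega> - X u \<omega>) s (s + t) n) \<in> borel_measurable M" for n
      using s by (intro grid_max_measurable borel_measurable_diff X_measurable) auto
  qed (rule incseq_grid_max)
  show "(\<integral>\<^sup>+\<omega>. D \<omega> * \<phi> (path_sup (\<lambda>u. X u \<omega> - X s \<omega>) s (s + t)) \<partial>M) =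
      (\<integral>\<^sup>+\<omega>. D \<omega> \<partial>M) * dyadic_limit rise \<phi> t"
  proof (rule nn_integral_grid_limit[OF s \<phi> D, where Z="\<lambda>n \<omega>. grid_max (\<lambda>u. X u \<omega> - X s \<omega>) s (s + t) n"])
    show "(\<integral>\<^sup>+\<omega>. D \<omega> * \<phi> (grid_max (\<lambda>u. X u \<omega> - X s \<omega>) s (s + t) n) \<partial>M) =
        (\<integral>\<^sup>+\<omega>. D \<omega> \<partial>M) * (average rise (increment_law (t / 2 ^ n)) ^^ 2 ^ n) \<phi> 0" for n
      using nn_integral_compose_inner[OF s(1) h rise_measurable D \<phi>m, of n "2 ^ n" 0]
      unfolding compose_inner_rise[of "\<lambda>k. X (s + real k * (t / 2 ^ n)) _"]
      by (simp add: grid_max_def)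
    show "(\<lambda>n. grid_max (\<lambda>u. X u \<omega> - X s \<omega>) s (s + t) n)
        \<longlonglongrightarrow> path_sup (\<lambda>u. X u \<omega> - X s \<omega>) s (s + t)" if "\<omega> \<in> space M" for \<omega>
      using s that by (intro cadlag_grid_max_tendsto cadlag_minus cadlag_const cadlag_paths) auto
    show "(\<lambda>\<omega>. grid_max (\<lambda>u. X u \<omega> - X s \<omega>) s (s + t) n) \<in> borel_measurable M" for n
      using s by (intro grid_max_measurable borel_measurable_diff X_measurable) auto
  qed (rule incseq_grid_max)
qed

end

section \<open>Second moment of the running maximum\<close>

text \<open>
  Summing the recursion bounds every partial sum by a constant plus half of itself.
\<close>

lemma summable_of_contraction:
  fixes a w :: "nat \<Rightarrow> real"
  assumes a: "\<And>k. 0 \<le> a k" and w: "\<And>k. 0 \<le> w k" "summable w"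
    and step: "\<And>k. m \<le> k \<Longrightarrow> a (Suc k) \<le> w k + a k / 2"
  shows "summable a"
proof -
  have "summable (\<lambda>k. a (k + m))"
  proof (rule summableI_nonneg_bounded)
    fix n
    have "(\<Sum>k<n. a (k + m)) \<le> (\<Sum>k<Suc n. a (k + m))" using a by simp
    also have "\<dots> = a m + (\<Sum>k<n. a (Suc (k + m)))"
      by (subst sum.lessThan_Suc_shift) simp
    also have "\<dots> \<le> a m + (\<Sum>k<n. w (k + m) + a (k + m) / 2)"
      using step by (intro add_left_mono sum_mono) auto
    also have "\<dots> = a m + (\<Sum>k<n. w (k + m)) + (\<Sum>k<n. a (k + m)) / 2"
      by (simp add: sum.distrib sum_divide_distrib)
    also have "(\<Sum>k<n. w (k + m)) \<le> (\<Sum>k. w (k + m))"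
      using w by (intro sum_le_suminf) (auto simp: summable_iff_shift)
    finally show "(\<Sum>k<n. a (k + m)) \<le> 2 * (a m + (\<Sum>k. w (k + m)))" by (simp add: field_simps)
  qed (rule a)
  then show ?thesis by (simp add: summable_iff_shift)
qed

text \<open>
  The geometric sum is dominated by its last term, whose square root is at most \<open>y\<close>. The bound
  by \<open>9 ^ n\<close> carries the induction.
\<close>

lemma geometric_layers:
  assumes "y > 1"
  shows "(\<Sum>k<n. if 3 ^ Suc k \<le> y then 9 ^ Suc k else 0) \<le> 9 / 8 * min (9 ^ n) (y\<^sup>2 :: real)"
proof (induction n)
  case (Suc n)
  show ?case
  proof (cases "3 ^ Suc n \<le> y")
    case True
    then have "(3 ^ Suc n)\<^sup>2 \<le> y\<^sup>2" by (intro power_mono) auto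
    moreover have "(3 ^ Suc n :: real)\<^sup>2 = 9 ^ Suc n"
      by (simp add: power2_eq_square power_mult_distrib[symmetric])
    ultimately have "9 ^ Suc n \<le> y\<^sup>2" by simp
    then show ?thesis using Suc True by simp
  next
    case False
    have "(9::real) ^ n \<le> 9 ^ Suc n" by (intro power_increasing) auto
    then have "min (9 ^ n) (y\<^sup>2) \<le> min (9 ^ Suc n) (y\<^sup>2)" by (intro min.mono order_refl)
    then show ?thesis using Suc False by simp
  qed
qed simp

lemma nn_integral_geometric_layers:
  assumes sets: "sets \<nu> = sets borel" and moment: "(\<integral>\<^sup>+y\<in>{1<..}. ennreal (y\<^sup>2) \<partial>\<nu>) < \<infinity>"
  shows "(\<Sum>k. 9 ^ Suc k * emeasure \<nu> {3 ^ Suc k..}) < \<infinity>"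
proof -
  note [measurable_cong] = sets
  have "(\<Sum>k. 9 ^ Suc k * emeasure \<nu> {3 ^ Suc k..}) =
      (\<Sum>k. \<integral>\<^sup>+y. 9 ^ Suc k * indicator {3 ^ Suc k..} y \<partial>\<nu>)"
    by (intro suminf_cong nn_integral_cmult_indicator[symmetric]) (auto simp: sets)
  also have "\<dots> = (\<integral>\<^sup>+y. (\<Sum>k. 9 ^ Suc k * indicator {3 ^ Suc k..} y) \<partial>\<nu>)"
    by (intro nn_integral_suminf[symmetric]) measurable
  also have "\<dots> \<le> (\<integral>\<^sup>+y. ennreal (9 / 8) * (ennreal (y\<^sup>2) * indicator {1<..} y) \<partial>\<nu>)"
  proof (intro nn_integral_mono suminf_le_const)
    fix y :: real and n
    show "(\<Sum>k<n. 9 ^ Suc k * indicator {3 ^ Suc k..} y) \<le> ennreal (9 / 8) * (ennreal (y\<^sup>2) * indicator {1<..} y)"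
    proof (cases "y > 1")
      case True
      have "(\<Sum>k<n. 9 ^ Suc k * indicator {3 ^ Suc k..} y :: ennreal) =
          (\<Sum>k<n. ennreal (if 3 ^ Suc k \<le> y then 9 ^ Suc k else 0))"
        by (intro sum.cong refl) (auto simp: indicator_def ennreal_power[symmetric] ennreal_mult simp del: power_Suc)
      also have "\<dots> = ennreal (\<Sum>k<n. if 3 ^ Suc k \<le> y then 9 ^ Suc k else 0)"
        by (intro sum_ennreal) auto
      also have "\<dots> \<le> ennreal (9 / 8 * y\<^sup>2)"
        using geometric_layers[OF True, of n] by (intro ennreal_leI) auto
      finally show ?thesis using True by (simp add: ennreal_mult[symmetric])
    next
      case False
      have "\<not> 3 ^ Suc k \<le> y" for k
      proof -
        have "(1::real) \<le> 3 ^ k" by (rule one_le_power) simp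
        then show ?thesis using False unfolding power_Suc by linarith
      qed
      then show ?thesis by (simp add: indicator_def)
    qed
  qed auto
  also have "\<dots> = ennreal (9 / 8) * (\<integral>\<^sup>+y\<in>{1<..}. ennreal (y\<^sup>2) \<partial>\<nu>)"
    by (intro nn_integral_cmult) measurable
  also have "\<dots> < \<infinity>" using moment by (simp add: ennreal_mult_less_top)
  finally show ?thesis .
qed

lemma square_le_layers:
  assumes "0 \<le> (y :: real)"
  shows "ennreal (y\<^sup>2) \<le> 9 + (\<Sum>k. ennreal (9 ^ (k + 2)) * indicator {3 ^ Suc k<..} y)"
proof (cases "y \<le> 3")
  case True
  then have "y\<^sup>2 \<le> 3\<^sup>2" using assms by (intro power_mono) auto
  then have "ennreal (y\<^sup>2) \<le> ennreal 9" by (intro ennreal_leI) simp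
  then show ?thesis by (simp add: add_increasing2)
next
  case False
  define m where "m = (LEAST m. y \<le> 3 ^ m)"
  have "\<exists>m. y \<le> 3 ^ m" using real_arch_pow[of 3 y] by (auto intro: less_imp_le)
  then have m: "y \<le> 3 ^ m" unfolding m_def by (rule LeastI_ex)
  have "m \<noteq> 0" "m \<noteq> 1" using m False by (auto intro!: gr0I)
  then obtain k where k: "m = Suc (Suc k)" by (metis One_nat_def not0_implies_Suc)
  then have less: "3 ^ Suc k < y" using not_less_Least[of "Suc k" "\<lambda>m. y \<le> 3 ^ m"] by (auto simp: m_def)
  have "y\<^sup>2 \<le> (3 ^ m)\<^sup>2" using m assms by (intro power_mono) auto
  also have "(3 ^ m)\<^sup>2 = (9::real) ^ (k + 2)"
    by (simp add: k power2_eq_square power_mult_distrib[symmetric])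
  finally have "ennreal (y\<^sup>2) \<le> ennreal (9 ^ (k + 2)) * indicator {3 ^ Suc k<..} y"
    using less by (simp add: ennreal_leI)
  moreover define f where "f i = ennreal (9 ^ (i + 2)) * indicator {3 ^ Suc i<..} y" for i
  have "(\<Sum>i\<in>{k}. f i) \<le> (\<Sum>i. f i)" by (intro sum_le_suminf) auto
  then have "f k \<le> (\<Sum>i. f i)" by simp
  ultimately have "ennreal (y\<^sup>2) \<le> (\<Sum>i. f i)" unfolding f_def by (rule order.trans)
  then show ?thesis unfolding f_def by (rule add_increasing[rotated]) simp
qed

context levy_process
begin

definition height :: "'a \<Rightarrow> real" where
  "height \<omega> = path_sup (\<lambda>u. X u \<omega> - X 0 \<omega>) 0 1"

abbreviation grid_height :: "nat \<Rightarrow> 'a \<Rightarrow> real" where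
  "grid_height n \<omega> \<equiv> grid_max (\<lambda>u. X u \<omega> - X 0 \<omega>) 0 1 n"

lemma grid_height_measurable[measurable]: "grid_height n \<in> borel_measurable M"
proof -
  have "(\<lambda>\<omega>. grid_max (\<lambda>u. X u \<omega> - X 0 \<omega>) 0 (0 + 1) n) \<in> borel_measurable M"
    by (intro grid_max_measurable borel_measurable_diff X_measurable) auto
  then show ?thesis by simp
qed

lemma grid_height_tendsto: "\<omega> \<in> space M \<Longrightarrow> (\<lambda>n. grid_height n \<omega>) \<longlonglongrightarrow> height \<omega>"
  unfolding height_def by (intro cadlag_grid_max_tendsto cadlag_minus cadlag_const cadlag_paths) auto

lemma height_measurable[measurable]: "height \<in> borel_measurable M"
  by (rule borel_measurable_LIMSEQ_metric[OF grid_height_measurable grid_height_tendsto])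

lemma grid_height_le: "\<omega> \<in> space M \<Longrightarrow> grid_height n \<omega> \<le> height \<omega>"
  by (rule incseq_le[OF incseq_grid_max grid_height_tendsto])

text \<open>
  The walk restarted at time \<open>s\<close> is independent of \<open>F s\<close> and has the law of the walk started at
  time \<open>0\<close>; both follow from the formula for inner compositions, applied to an indicator.
\<close>

lemma prob_later_grid_height:
  assumes s: "0 \<le> s" "0 \<le> h" and A: "A \<in> sets (F s)"
  shows "prob (A \<inter> {\<omega>\<in>space M. a < Max ((\<lambda>k. X (s + real k * h) \<omega> - X s \<omega>) ` {..N})}) =
    prob A * prob {\<omega>\<in>space M. a < Max ((\<lambda>k. X (real k * h) \<omega> - X 0 \<omega>) ` {..N})}"
proof -
  let ?m = "\<lambda>s \<omega>. Max ((\<lambda>k. X (s + real k * h) \<omega> - X s \<omega>) ` {..N})"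
  define e where "e = (average rise (increment_law h) ^^ N) (indicator {a<..}) 0"
  have meas: "?m s \<in> borel_measurable M" if "0 \<le> s" for s
    using that s(2) by (intro borel_measurable_Max borel_measurable_diff X_measurable) auto
  have law: "emeasure M (A \<inter> {\<omega>\<in>space M. a < ?m s \<omega>}) = emeasure M A * e"
    if s: "0 \<le> s" and A: "A \<in> sets (F s)" for s A
  proof -
    have A': "A \<in> sets M" using A subalgebra_F[OF s] by (auto simp: subalgebra_def)
    note [measurable] = meas[OF s] A'
    have "emeasure M (A \<inter> {\<omega>\<in>space M. a < ?m s \<omega>}) = (\<integral>\<^sup>+\<omega>. indicator (A \<inter> {\<omega>\<in>space M. a < ?m s \<omega>}) \<omega> \<partial>M)"
      by (intro nn_integral_indicator[symmetric]) measurable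
    also have "\<dots> = (\<integral>\<^sup>+\<omega>. indicator A \<omega> * indicator {a<..} (?m s \<omega>) \<partial>M)"
      by (intro nn_integral_cong) (auto split: split_indicator)
    also have "\<dots> = (\<integral>\<^sup>+\<omega>. indicator A \<omega> * indicator {a<..} (compose_inner rise (increments s h \<omega>) N 0) \<partial>M)"
      using compose_inner_rise[of "\<lambda>k. X (s + real k * h) _" N] by simp
    also have "\<dots> = (\<integral>\<^sup>+\<omega>. indicator A \<omega> \<partial>M) * e"
      unfolding e_def using s \<open>0 \<le> h\<close> A by (intro nn_integral_compose_inner) auto
    finally show ?thesis by simp
  qed
  have "space M \<in> sets (F 0)" using sets.top[of "F 0"] by (simp add: space_F)
  from law[OF order_refl this] have "emeasure M {\<omega>\<in>space M. a < ?m 0 \<omega>} = e"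
    by (simp add: emeasure_space_1 Int_def)
  then have "e = ennreal (prob {\<omega>\<in>space M. a < ?m 0 \<omega>})" by (simp add: emeasure_eq_measure)
  with law[OF s(1) A] show ?thesis
    by (simp add: emeasure_eq_measure ennreal_mult'[symmetric])
qed

text \<open>
  If the maximum exceeds \<open>2 a + b\<close> and no single step exceeds \<open>b\<close>, then the walk is at most at
  \<open>a + b\<close> when it first exceeds \<open>a\<close>, and has to climb by more than \<open>a\<close> once more, independently
  of its past. This is the inequality of Hoffmann-Jorgensen in a one-sided form.
\<close>

lemma prob_grid_height:
  assumes a: "0 \<le> a" and b: "0 \<le> b"
  shows "prob {\<omega>\<in>space M. 2 * a + b < grid_height n \<omega>} \<le>
    prob {\<omega>\<in>space M. \<exists>k<2 ^ n. b < X (real (Suc k) / 2 ^ n) \<omega> - X (real k / 2 ^ n) \<omega>} +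
    (prob {\<omega>\<in>space M. a < grid_height n \<omega>})\<^sup>2"
proof -
  define h where "h = 1 / (2::real) ^ n"
  define N where "N = (2::nat) ^ n"
  define g where "g k \<omega> = X (real k * h) \<omega> - X 0 \<omega>" for k \<omega>
  have h: "0 \<le> h" by (simp add: h_def)
  have gh: "grid_height n \<omega> = Max ((\<lambda>k. g k \<omega>) ` {..N})" for \<omega>
    by (simp add: grid_max_def g_def h_def N_def)
  define J where "J = {\<omega>\<in>space M. \<exists>k<N. b < g (Suc k) \<omega> - g k \<omega>}"
  \<comment> \<open>\<open>B j\<close>: the walk first exceeds \<open>a\<close> at step \<open>j\<close>;
    \<open>C j\<close>: it then climbs by more than \<open>a\<close> within \<open>N\<close>
    further steps, which may end after time \<open>1\<close>.\<close>
  define B where "B j = {\<omega>\<in>space M. a < g j \<omega> \<and> (\<forall>i\<in>{..<j}. g i \<omega> \<le> a)}" for j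
  define C where "C j = {\<omega>\<in>space M. a < Max ((\<lambda>k. X (real j * h + real k * h) \<omega> - X (real j * h) \<omega>) ` {..N})}" for j
  have [measurable]: "g k \<in> borel_measurable M" for k
    unfolding g_def using h by (intro borel_measurable_diff X_measurable) auto
  have gF: "g i \<in> borel_measurable (F (real j * h))" if "i \<le> j" for i j
    unfolding g_def using h that by (intro borel_measurable_diff X_measurable_F) (auto intro: mult_right_mono)
  have BF: "B j \<in> sets (F (real j * h))" for j
  proof -
    have eq: "B j = {\<omega>\<in>space (F (real j * h)). a < g j \<omega>} \<inter>
        (\<Inter>i\<in>{..j}. {\<omega>\<in>space (F (real j * h)). i < j \<longrightarrow> g i \<omega> \<le> a})"
      by (auto simp: B_def space_F)
    have 1: "{\<omega>\<in>space (F (real j * h)). i < j \<longrightarrow> g i \<omega> \<le> a} \<in> sets (F (real j * h))" if "i \<le> j" for i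
    proof (cases "i < j")
      case True then show ?thesis using borel_measurable_le[OF gF[OF that] measurable_const] by simp
    qed simp
    have 2: "{\<omega>\<in>space (F (real j * h)). a < g j \<omega>} \<in> sets (F (real j * h))"
      by (intro borel_measurable_less measurable_const gF order_refl) simp
    show ?thesis unfolding eq
    proof (rule sets.Int[OF 2 sets.finite_INT])
      show "{\<omega>\<in>space (F (real j * h)). i < j \<longrightarrow> g i \<omega> \<le> a} \<in> sets (F (real j * h))" if "i \<in> {..j}" for i
        using that by (intro 1) simp
    qed simp_all
  qed
  have [measurable]: "B j \<in> sets M" for j
    using BF[of j] subalgebra_F[of "real j * h"] h by (auto simp: subalgebra_def)
  have [measurable]: "C j \<in> sets M" for j
  proof -
    have [measurable]: "(\<lambda>\<omega>. Max ((\<lambda>k. X (real j * h + real k * h) \<omega> - X (real j * h) \<omega>) ` {..N})) \<in> borel_measurable M"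
      using h by (intro borel_measurable_Max borel_measurable_diff X_measurable) auto
    show ?thesis unfolding C_def by measurable
  qed
  have [measurable]: "J \<in> sets M" unfolding J_def by measurable
  have BC: "prob (B j \<inter> C j) = prob (B j) * prob {\<omega>\<in>space M. a < grid_height n \<omega>}" for j
    unfolding C_def gh g_def using h by (intro prob_later_grid_height BF) auto
  have cover: "{\<omega>\<in>space M. 2 * a + b < grid_height n \<omega>} \<subseteq> J \<union> (\<Union>j\<le>N. B j \<inter> C j)"
  proof
    fix \<omega> assume "\<omega> \<in> {\<omega>\<in>space M. 2 * a + b < grid_height n \<omega>}"
    then have \<omega>: "\<omega> \<in> space M" and big: "2 * a + b < Max ((\<lambda>k. g k \<omega>) ` {..N})" by (auto simp: gh)
    show "\<omega> \<in> J \<union> (\<Union>j\<le>N. B j \<inter> C j)"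
    proof (cases "\<omega> \<in> J")
      case False
      obtain k where k: "k \<le> N" "2 * a + b < g k \<omega>" using big by (subst (asm) Max_gr_iff) auto
      define j where "j = (LEAST j. a < g j \<omega>)"
      have ak: "a < g k \<omega>" using k a b by simp
      then have j: "a < g j \<omega>" "j \<le> k" unfolding j_def by (auto intro: LeastI Least_le)
      have before: "g i \<omega> \<le> a" if "i < j" for i
        using not_less_Least[of i "\<lambda>j. a < g j \<omega>"] that by (auto simp: j_def)
      have "g 0 \<omega> = 0" by (simp add: g_def)
      then obtain i where i: "j = Suc i" using j(1) a by (cases j) auto
      then have "i < N" using j(2) k(1) by simp
      moreover have "\<forall>k<N. \<not> b < g (Suc k) \<omega> - g k \<omega>" using False \<omega> by (simp add: J_def)
      ultimately have "\<not> b < g (Suc i) \<omega> - g i \<omega>" by (elim allE[of _ i] impE) assumption+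
      then have "g j \<omega> - g i \<omega> \<le> b" by (simp add: i)
      then have "g j \<omega> \<le> a + b" using before[of i] i by simp
      then have climb: "a < g k \<omega> - g j \<omega>" using k by simp
      have "g k \<omega> - g j \<omega> = X (real j * h + real (k - j) * h) \<omega> - X (real j * h) \<omega>"
        using j(2) by (simp add: g_def of_nat_diff algebra_simps)
      also have "\<dots> \<le> Max ((\<lambda>k. X (real j * h + real k * h) \<omega> - X (real j * h) \<omega>) ` {..N})"
        using k by (intro Max_ge) auto
      finally have "\<omega> \<in> C j" using climb \<omega> by (simp add: C_def)
      moreover have "\<omega> \<in> B j" using \<omega> j before by (auto simp: B_def)
      ultimately show ?thesis using j k by auto
    qed simp
  qed
  let ?p = "prob {\<omega>\<in>space M. a < grid_height n \<omega>}"
  have disjoint: "disjoint_family_on B {..N}"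
    unfolding disjoint_family_on_def
  proof safe
    fix i j \<omega> assume "\<omega> \<in> B i" "\<omega> \<in> B j" "i \<noteq> j"
    then show "\<omega> \<in> {}" using linorder_less_linear[of i j] by (auto simp: B_def not_less[symmetric])
  qed
  have "(\<Sum>j\<le>N. prob (B j)) = prob (\<Union>j\<le>N. B j)"
    by (rule finite_measure_finite_Union[symmetric, OF _ _ disjoint]) auto
  also have "\<dots> \<le> ?p"
  proof (rule finite_measure_mono)
    show "(\<Union>j\<le>N. B j) \<subseteq> {\<omega>\<in>space M. a < grid_height n \<omega>}"
      unfolding gh by (auto simp: B_def Max_gr_iff)
  qed measurable
  finally have sum_B: "(\<Sum>j\<le>N. prob (B j)) \<le> ?p" .
  have "prob {\<omega>\<in>space M. 2 * a + b < grid_height n \<omega>} \<le> prob (J \<union> (\<Union>j\<le>N. B j \<inter> C j))"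
    by (intro finite_measure_mono cover) measurable
  also have "\<dots> \<le> prob J + prob (\<Union>j\<le>N. B j \<inter> C j)"
    by (intro measure_Un_le) measurable
  also have "prob (\<Union>j\<le>N. B j \<inter> C j) \<le> (\<Sum>j\<le>N. prob (B j \<inter> C j))"
    by (intro measure_UNION_le) auto
  also have "(\<Sum>j\<le>N. prob (B j \<inter> C j)) = (\<Sum>j\<le>N. prob (B j)) * ?p"
    by (simp add: BC sum_distrib_right)
  also have "(\<Sum>j\<le>N. prob (B j)) * ?p \<le> ?p\<^sup>2"
    unfolding power2_eq_square by (intro mult_right_mono sum_B) simp
  finally have "prob {\<omega>\<in>space M. 2 * a + b < grid_height n \<omega>} \<le> prob J + ?p\<^sup>2" by simp
  moreover have "J = {\<omega>\<in>space M. \<exists>k<2 ^ n. b < X (real (Suc k) / 2 ^ n) \<omega> - X (real k / 2 ^ n) \<omega>}"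
    unfolding J_def g_def h_def N_def
    by (simp only: diff_diff_eq2 diff_add_cancel times_divide_eq_right mult_1_right)
  ultimately show ?thesis by simp
qed

text \<open>
  A point that lies in the exceptional events of infinitely many grids has a jump of size at
  least \<open>b\<close>, and the probability of having one is at most the expected number of such jumps,
  which is what the Levy measure counts.
\<close>

lemma prob_height:
  assumes \<nu>: "has_levy_measure M X \<nu>" and a: "0 \<le> a" and b: "0 < b"
  shows "ennreal (prob {\<omega>\<in>space M. 2 * a + b < height \<omega>}) \<le>
    emeasure \<nu> {b..} + ennreal ((prob {\<omega>\<in>space M. a < height \<omega>})\<^sup>2)"
proof -
  define J where "J n = {\<omega>\<in>space M. \<exists>k<2 ^ n. b < X (real (Suc k) / 2 ^ n) \<omega> - X (real k / 2 ^ n) \<omega>}" for n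
  define L where "L = (\<Inter>m. \<Union>n\<in>{m..}. J n)"
  let ?p = "prob {\<omega>\<in>space M. a < height \<omega>}"
  have J[measurable]: "J n \<in> sets M" for n
  proof -
    have [measurable]: "X (real k / 2 ^ n) \<in> borel_measurable M" for k by (intro X_measurable) auto
    show ?thesis unfolding J_def by measurable
  qed
  have bound: "prob {\<omega>\<in>space M. 2 * a + b < height \<omega>} \<le> prob (\<Union>n\<in>{m..}. J n) + ?p\<^sup>2" for m
  proof (rule LIMSEQ_le_const2)
    have "(\<lambda>n. prob {\<omega>\<in>space M. 2 * a + b < grid_height n \<omega>}) \<longlonglongrightarrow> prob (\<Union>n. {\<omega>\<in>space M. 2 * a + b < grid_height n \<omega>})"
    proof (rule finite_Lim_measure_incseq)
      show "incseq (\<lambda>n. {\<omega>\<in>space M. 2 * a + b < grid_height n \<omega>})"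
        using incseq_grid_max[THEN incseqD] by (auto simp: incseq_def intro: less_le_trans)
    qed auto
    also have "(\<Union>n. {\<omega>\<in>space M. 2 * a + b < grid_height n \<omega>}) = {\<omega>\<in>space M. 2 * a + b < height \<omega>}"
    proof safe
      fix \<omega> assume \<omega>: "\<omega> \<in> space M" and "2 * a + b < height \<omega>"
      then have "\<forall>\<^sub>F n in sequentially. 2 * a + b < grid_height n \<omega>"
        using grid_height_tendsto[OF \<omega>] by (auto dest: order_tendstoD)
      then show "\<omega> \<in> (\<Union>n. {\<omega>\<in>space M. 2 * a + b < grid_height n \<omega>})"
        using \<omega> by (auto simp: eventually_sequentially)
    qed (use grid_height_le in \<open>auto intro: less_le_trans\<close>)
    finally show "(\<lambda>n. prob {\<omega>\<in>space M. 2 * a + b < grid_height n \<omega>}) \<longlonglongrightarrow> prob {\<omega>\<in>space M. 2 * a + b < height \<omega>}" .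
    have "prob {\<omega>\<in>space M. 2 * a + b < grid_height n \<omega>} \<le> prob (\<Union>n\<in>{m..}. J n) + ?p\<^sup>2" if "m \<le> n" for n
    proof -
      have "prob (J n) \<le> prob (\<Union>n\<in>{m..}. J n)" using that by (intro finite_measure_mono) auto
      moreover have "prob {\<omega>\<in>space M. a < grid_height n \<omega>} \<le> ?p"
        using grid_height_le by (intro finite_measure_mono) (auto intro: less_le_trans)
      then have "(prob {\<omega>\<in>space M. a < grid_height n \<omega>})\<^sup>2 \<le> ?p\<^sup>2" by (intro power_mono) auto
      ultimately show ?thesis
        using prob_grid_height[OF a less_imp_le[OF b], of n] unfolding J_def by linarith
    qed
    then show "\<exists>N. \<forall>n\<ge>N. prob {\<omega>\<in>space M. 2 * a + b < grid_height n \<omega>} \<le> prob (\<Union>n\<in>{m..}. J n) + ?p\<^sup>2"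
      by blast
  qed
  have "(\<lambda>m. prob (\<Union>n\<in>{m..}. J n)) \<longlonglongrightarrow> prob L"
    unfolding L_def by (intro finite_Lim_measure_decseq; (unfold decseq_def, intro allI impI UN_mono)?) auto
  then have "(\<lambda>m. prob (\<Union>n\<in>{m..}. J n) + ?p\<^sup>2) \<longlonglongrightarrow> prob L + ?p\<^sup>2" by (intro tendsto_add tendsto_const)
  then have "prob {\<omega>\<in>space M. 2 * a + b < height \<omega>} \<le> prob L + ?p\<^sup>2"
    using bound by (intro LIMSEQ_le_const) auto
  then have "ennreal (prob {\<omega>\<in>space M. 2 * a + b < height \<omega>}) \<le> ennreal (prob L) + ennreal (?p\<^sup>2)"
    by (simp add: ennreal_plus[symmetric] del: ennreal_plus)
  also have "ennreal (prob L) = (\<integral>\<^sup>+\<omega>. indicator L \<omega> \<partial>M)"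
    unfolding L_def by (subst nn_integral_indicator) (auto simp: emeasure_eq_measure)
  also have "\<dots> \<le> (\<integral>\<^sup>+\<omega>. emeasure (count_space UNIV)
      {t\<in>{0<..1}. jump (\<lambda>s. X s \<omega>) t \<noteq> 0 \<and> jump (\<lambda>s. X s \<omega>) t \<in> {b..}} \<partial>M)"
  proof (intro nn_integral_mono)
    fix \<omega> assume \<omega>: "\<omega> \<in> space M"
    let ?T = "{t\<in>{0<..1}. jump (\<lambda>s. X s \<omega>) t \<noteq> 0 \<and> jump (\<lambda>s. X s \<omega>) t \<in> {b..}}"
    show "indicator L \<omega> \<le> emeasure (count_space UNIV) ?T"
    proof (cases "\<omega> \<in> L")
      case True
      then have "\<exists>s\<in>{0<..1}. b \<le> jump (\<lambda>s. X s \<omega>) s"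
      proof (intro cadlag_jump_of_increments cadlag_paths \<omega> b)
        fix m
        obtain n where "m \<le> n" "\<omega> \<in> J n" using True by (auto simp: L_def)
        then show "\<exists>n\<ge>m. \<exists>k<2 ^ n. b < X (real (Suc k) / 2 ^ n) \<omega> - X (real k / 2 ^ n) \<omega>"
          unfolding J_def by blast
      qed
      then obtain s where "s \<in> ?T" using b by fastforce
      then have "emeasure (count_space UNIV) {s} \<le> emeasure (count_space UNIV) ?T"
        by (intro emeasure_mono) auto
      then show ?thesis using True by simp
    qed simp
  qed
  also have "\<dots> = emeasure \<nu> {b..}" using \<nu> by (auto simp: has_levy_measure_def)
  finally show ?thesis by (simp add: add_right_mono)
qed

text \<open>
  With \<open>a = b = 3 ^ k\<close> the tail inequality relates the levels \<open>3 ^ k\<close> and \<open>3 ^ Suc k\<close>. Its quadratic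
  term becomes a contraction once the tail probability is small.
\<close>

lemma height_square_integrable:
  assumes \<nu>: "has_levy_measure M X \<nu>" and moment: "(\<integral>\<^sup>+y\<in>{1<..}. ennreal (y\<^sup>2) \<partial>\<nu>) < \<infinity>"
  shows "(\<integral>\<^sup>+\<omega>. ennreal ((max 0 (height \<omega>))\<^sup>2) \<partial>M) < \<infinity>"
proof -
  define p where "p k = prob {\<omega>\<in>space M. 3 ^ k < height \<omega>}" for k
  define w where "w k = enn2real (9 ^ Suc k * emeasure \<nu> {3 ^ Suc k..})" for k
  define a where "a k = 9 ^ Suc k * p (Suc k)" for k
  have fin: "(\<Sum>k. 9 ^ Suc k * emeasure \<nu> {3 ^ Suc k..}) < \<infinity>"
    using \<nu> moment by (intro nn_integral_geometric_layers) (auto simp: has_levy_measure_def)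
  have fin1: "9 ^ Suc k * emeasure \<nu> {3 ^ Suc k..} < \<infinity>" for k
    using ennreal_suminf_lessD[of "\<lambda>k. 9 ^ Suc k * emeasure \<nu> {3 ^ Suc k..}" top k] fin by simp
  have w: "ennreal (w k) = 9 ^ Suc k * emeasure \<nu> {3 ^ Suc k..}" "0 \<le> w k" for k
    using fin1[of k] by (auto simp: w_def)
  have "summable w"
    using fin by (intro summable_suminf_not_top) (auto simp: w simp del: power_Suc)
  have "(\<lambda>k. p k) \<longlonglongrightarrow> measure M (\<Inter>k. {\<omega>\<in>space M. 3 ^ k < height \<omega>})"
    unfolding p_def
  proof (intro finite_Lim_measure_decseq)
    show "decseq (\<lambda>k. {\<omega>\<in>space M. 3 ^ k < height \<omega>})"
    proof (unfold decseq_def, safe)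
      fix k l :: nat and \<omega> assume "k \<le> l" "3 ^ l < height \<omega>"
      moreover have "(3::real) ^ k \<le> 3 ^ l" using \<open>k \<le> l\<close> by (intro power_increasing) auto
      ultimately show "3 ^ k < height \<omega>" by linarith
    qed
  qed auto
  also have "(\<Inter>k. {\<omega>\<in>space M. 3 ^ k < height \<omega>}) = {}"
  proof safe
    fix \<omega> assume *: "\<omega> \<in> (\<Inter>k. {\<omega>\<in>space M. 3 ^ k < height \<omega>})"
    obtain k where "height \<omega> < 3 ^ k" using real_arch_pow[of 3 "height \<omega>"] by auto
    with * show "\<omega> \<in> {}" by (auto dest: spec[of _ k])
  qed
  finally have "p \<longlonglongrightarrow> 0" by simp
  \<comment> \<open>The bound \<open>1 / 18\<close> absorbs the growth factor \<open>9\<close> of the weights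
    and leaves the factor \<open>1 / 2\<close> of the contraction.\<close>
  then have "\<forall>\<^sub>F k in sequentially. p k < 1 / 18" by (intro order_tendstoD(2)[of p 0]) auto
  then obtain m where m: "\<And>k. m \<le> k \<Longrightarrow> p k < 1 / 18" by (auto simp: eventually_sequentially)
  have p0: "0 \<le> p k" for k by (simp add: p_def)
  have "summable a"
  proof (rule summable_of_contraction[where w="\<lambda>k. 9 * w k" and m=m])
    show "0 \<le> a k" for k by (simp add: a_def p0)
    show "0 \<le> 9 * w k" for k using w by simp
    show "summable (\<lambda>k. 9 * w k)" using \<open>summable w\<close> by (rule summable_mult)
    fix k assume k: "m \<le> k"
    have "ennreal (p (Suc (Suc k))) \<le> emeasure \<nu> {3 ^ Suc k..} + ennreal ((p (Suc k))\<^sup>2)"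
      using prob_height[OF \<nu>, of "3 ^ Suc k" "3 ^ Suc k"] by (simp add: p_def)
    then have "9 ^ Suc k * ennreal (p (Suc (Suc k))) \<le> 9 ^ Suc k * (emeasure \<nu> {3 ^ Suc k..} + ennreal ((p (Suc k))\<^sup>2))"
      by (intro mult_left_mono) auto
    also have "\<dots> = ennreal (w k) + 9 ^ Suc k * ennreal ((p (Suc k))\<^sup>2)"
      by (simp only: distrib_left w)
    finally have "ennreal (9 ^ Suc k * p (Suc (Suc k))) \<le> ennreal (w k + 9 ^ Suc k * (p (Suc k))\<^sup>2)"
      using w(2)[of k] p0 by (simp add: ennreal_mult ennreal_power[symmetric] del: power_Suc)
    then have le: "9 ^ Suc k * p (Suc (Suc k)) \<le> w k + 9 ^ Suc k * (p (Suc k))\<^sup>2"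
      using w(2)[of k] by (subst (asm) ennreal_le_iff) auto
    have "18 * p (Suc k) \<le> 1" using m[of "Suc k"] k by simp
    then have "a k * (18 * p (Suc k)) \<le> a k * 1" using p0 by (intro mult_left_mono) (auto simp: a_def)
    then have "9 * (9 ^ Suc k * (p (Suc k))\<^sup>2) \<le> a k / 2" by (simp add: a_def power2_eq_square)
    moreover have "a (Suc k) = 9 * (9 ^ Suc k * p (Suc (Suc k)))" by (simp add: a_def)
    ultimately show "a (Suc k) \<le> 9 * w k + a k / 2" using le by linarith
  qed
  then have sum: "summable (\<lambda>k. 9 * a k)" by (rule summable_mult)
  have "(\<integral>\<^sup>+\<omega>. ennreal ((max 0 (height \<omega>))\<^sup>2) \<partial>M) \<le>
      (\<integral>\<^sup>+\<omega>. 9 + (\<Sum>k. ennreal (9 ^ (k + 2)) * indicator {3 ^ Suc k<..} (max 0 (height \<omega>))) \<partial>M)"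
    by (intro nn_integral_mono square_le_layers) auto
  also have "\<dots> = 9 + (\<Sum>k. \<integral>\<^sup>+\<omega>. ennreal (9 ^ (k + 2)) * indicator {3 ^ Suc k<..} (max 0 (height \<omega>)) \<partial>M)"
    by (subst nn_integral_add) (auto simp: emeasure_space_1 nn_integral_suminf)
  also have "\<dots> = 9 + (\<Sum>k. ennreal (9 * a k))"
  proof (intro arg_cong2[where f="(+)"] refl suminf_cong)
    fix k
    have "(\<integral>\<^sup>+\<omega>. ennreal (9 ^ (k + 2)) * indicator {3 ^ Suc k<..} (max 0 (height \<omega>)) \<partial>M) =
        (\<integral>\<^sup>+\<omega>. ennreal (9 ^ (k + 2)) * indicator {\<omega>\<in>space M. 3 ^ Suc k < height \<omega>} \<omega> \<partial>M)"
      using zero_le_power[of "3::real" "Suc k"] by (intro nn_integral_cong) (auto simp: indicator_def max_def simp del: power_Suc zero_le_power)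
    also have "\<dots> = ennreal (9 ^ (k + 2)) * emeasure M {\<omega>\<in>space M. 3 ^ Suc k < height \<omega>}"
      by (intro nn_integral_cmult_indicator) measurable
    also have "\<dots> = ennreal (9 * a k)"
      by (simp add: a_def p_def emeasure_eq_measure ennreal_mult'[symmetric] mult.assoc)
    finally show "(\<integral>\<^sup>+\<omega>. ennreal (9 ^ (k + 2)) * indicator {3 ^ Suc k<..} (max 0 (height \<omega>)) \<partial>M) = ennreal (9 * a k)" .
  qed
  also have "\<dots> < \<infinity>"
  proof -
    have "(\<Sum>k. ennreal (9 * a k)) \<noteq> top"
      by (intro ennreal_suminf_neq_top sum) (simp add: a_def p0)
    then show ?thesis by (simp add: less_top)
  qed
  finally show ?thesis .
qed

end

section \<open>Reflection at an upper barrier\<close>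

definition reflection :: "(real \<Rightarrow> real) \<Rightarrow> real \<Rightarrow> real \<Rightarrow> real" where
  "reflection f b t = (SUP u\<in>{0..t}. max (f u - b) 0)"

lemma reflection_eq:
  assumes f: "cadlag f" and t: "0 \<le> t"
  shows "reflection f b t = max (path_sup f 0 t - b) 0"
proof (rule antisym)
  show "reflection f b t \<le> max (path_sup f 0 t - b) 0"
    unfolding reflection_def
  proof (rule cSUP_least)
    fix u assume "u \<in> {0..t}"
    then have "f u \<le> path_sup f 0 t" by (intro path_sup_upper[OF f]) auto
    then show "max (f u - b) 0 \<le> max (path_sup f 0 t - b) 0" by auto
  qed (use t in auto)
  have bdd: "bdd_above ((\<lambda>u. max (f u - b) 0) ` {0..t})"
  proof -
    obtain C where C: "\<forall>y\<in>f ` {0..t}. y \<le> C"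
      using cadlag_bdd(1)[OF f order_refl, of t] unfolding bdd_above_def by blast
    have "max (f u - b) 0 \<le> max (C - b) 0" if "u \<in> {0..t}" for u
      using bspec[OF C imageI[OF that]] by auto
    then show ?thesis unfolding bdd_above_def by blast
  qed
  have up: "max (f u - b) 0 \<le> reflection f b t" if "u \<in> {0..t}" for u
    unfolding reflection_def using that by (intro cSUP_upper bdd) auto
  have "path_sup f 0 t \<le> reflection f b t + b"
  proof (rule path_sup_least[OF t])
    show "f u \<le> reflection f b t + b" if "0 \<le> u" "u \<le> t" for u
      using up[of u] that by auto
  qed
  moreover have "0 \<le> reflection f b t" using up[of 0] t by auto
  ultimately show "max (path_sup f 0 t - b) 0 \<le> reflection f b t" by auto
qed

lemma path_sup_split:
  assumes f: "cadlag f" and s: "0 \<le> s" "s \<le> t"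
  shows "path_sup f 0 t = max (path_sup f 0 s) (path_sup f s t)"
proof (rule antisym)
  have "f u \<le> max (path_sup f 0 s) (path_sup f s t)" if "0 \<le> u" "u \<le> t" for u
    using that path_sup_upper[OF f, of 0 u s] path_sup_upper[OF f, of s u t] s
    by (cases "u \<le> s") auto
  then show "path_sup f 0 t \<le> max (path_sup f 0 s) (path_sup f s t)"
    using s by (intro path_sup_least) auto
  have "path_sup f 0 s \<le> path_sup f 0 t"
    using s by (intro path_sup_least path_sup_upper[OF f]) auto
  then show "max (path_sup f 0 s) (path_sup f s t) \<le> path_sup f 0 t"
    using path_sup_antimono[OF f, of 0 s t] s by auto
qed

text \<open>
  The reflection inherits right-continuity because the maximum over a short interval
  exceeds the value at its left end only slightly. Left limits exist by monotonicity.
\<close>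

lemma control_path_reflection:
  assumes f: "cadlag f"
  shows "control_path (reflection f b)"
proof -
  note eq = reflection_eq[OF f]
  have mono: "reflection f b s \<le> reflection f b t" if "0 \<le> s" "s \<le> t" for s t
    using that path_sup_split[OF f that] by (auto simp: eq)
  have rc: "(reflection f b \<longlongrightarrow> reflection f b t) (at_right t)" if t: "0 \<le> t" for t
  proof (rule order_tendstoI)
    fix a assume "a < reflection f b t"
    then have "a < reflection f b u" if "t < u" for u using mono[of t u] t that by linarith
    then show "\<forall>\<^sub>F u in at_right t. a < reflection f b u"
      unfolding eventually_at_right[of t "t + 1", simplified] by (intro exI[of _ "t + 1"]) simp
  next
    fix a assume a: "reflection f b t < a"
    define e where "e = (a - reflection f b t) / 2"
    have e: "0 < e" "reflection f b t + e < a" using a by (auto simp: e_def field_simps)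
    obtain d where d: "0 < d" "\<And>u. t \<le> u \<Longrightarrow> u < t + d \<Longrightarrow> \<bar>f u - f t\<bar> < e"
      using cadlag_local[OF f t e(1)] by metis
    have "reflection f b u < a" if u: "t < u" "u < t + d" for u
    proof -
      have "path_sup f t u \<le> f t + e"
      proof (rule path_sup_least)
        show "f v \<le> f t + e" if "t \<le> v" "v \<le> u" for v
          using d(2)[of v] that u by linarith
      qed (use u in simp)
      moreover have "f t \<le> path_sup f 0 t" using t by (intro path_sup_upper[OF f]) auto
      ultimately have "path_sup f 0 u \<le> path_sup f 0 t + e"
        using path_sup_split[OF f, of t u] t u e by auto
      then have "reflection f b u \<le> reflection f b t + e"
        using t u e by (auto simp: eq)
      then show ?thesis using e by simp
    qed
    then show "\<forall>\<^sub>F u in at_right t. reflection f b u < a"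
      unfolding eventually_at_right[of t "t + 1", simplified] using d(1) by (intro exI[of _ "t + d"]) simp
  qed
  have ll: "\<exists>l. (reflection f b \<longlongrightarrow> l) (at_left t)" if t: "0 < t" for t
  proof -
    define l where "l = (SUP u\<in>{0..<t}. reflection f b u)"
    have bdd: "bdd_above (reflection f b ` {0..<t})"
    proof (rule bdd_aboveI2)
      show "reflection f b u \<le> reflection f b t" if "u \<in> {0..<t}" for u
        using mono[of u t] that by simp
    qed
    have "(reflection f b \<longlongrightarrow> l) (at_left t)"
    proof (rule order_tendstoI)
      fix a assume a: "l < a"
      have "reflection f b u < a" if "0 < u" "u < t" for u
      proof -
        have "reflection f b u \<le> l" unfolding l_def using that by (intro cSUP_upper bdd) auto
        with a show ?thesis by simp
      qed
      then show "\<forall>\<^sub>F u in at_left t. reflection f b u < a"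
        unfolding eventually_at_left[OF t] using t by (intro exI[of _ 0]) simp
    next
      fix a assume "a < l"
      then obtain u where u: "0 \<le> u" "u < t" "a < reflection f b u"
        unfolding l_def using less_cSUP_iff[OF _ bdd, of a] t by auto
      have "a < reflection f b v" if "u < v" for v using mono[of u v] that u by linarith
      then show "\<forall>\<^sub>F v in at_left t. a < reflection f b v"
        unfolding eventually_at_left[OF u(2)] using u(2) by (intro exI[of _ u]) simp
    qed
    then show ?thesis by blast
  qed
  show ?thesis
    unfolding control_path_def cadlag_def mono_on_def
    using mono rc ll by (auto simp: continuous_within eq)
qed

text \<open>
  The barrier control increases only while the path is at its running maximum: once the maximum
  over \<open>[s, t]\<close> stays below the maximum over \<open>[0, t]\<close>, no increase occurs on \<open>[s, t]\<close>.
\<close>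

lemma AE_reflection_increase:
  assumes f: "cadlag f" and t: "0 \<le> t"
  shows "AE s in stieltjes_measure (reflection f b). s \<le> t \<longrightarrow> path_sup f s t = b + reflection f b t"
proof -
  let ?\<theta> = "reflection f b"
  let ?\<mu> = "stieltjes_measure ?\<theta>"
  have \<theta>: "control_path ?\<theta>" by (rule control_path_reflection[OF f])
  note eq = reflection_eq[OF f]
  define B where "B = {s\<in>{0..t}. path_sup f s t < b + ?\<theta> t}"
  have null: "emeasure ?\<mu> {s..t} = 0" if s: "s \<in> B" for s
  proof (rule antisym)
    have s': "0 \<le> s" "s \<le> t" "path_sup f s t < b + ?\<theta> t" using s by (auto simp: B_def)
    show "emeasure ?\<mu> {s..t} \<le> 0"
    proof (cases "?\<theta> t = 0")
      case True
      have "emeasure ?\<mu> {s..t} \<le> emeasure ?\<mu> {..t}" by (intro emeasure_mono) auto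
      then show ?thesis using emeasure_stieltjes_Iic[OF \<theta> t] True by simp
    next
      case False
      then have pos: "0 < ?\<theta> t" using control_path_nonneg[OF \<theta> t] by simp
      then have sup: "path_sup f 0 t = b + ?\<theta> t" using t by (auto simp: eq max_def split: if_splits)
      show ?thesis
      proof (rule ennreal_le_epsilon)
        fix e :: real assume e: "0 < e"
        \<comment> \<open>A level below the maximum over \<open>[0, t]\<close> but at or above the barrier and the
          maximum over \<open>[s, t]\<close>: it can be exceeded only before \<open>s\<close>.\<close>
        define c where "c = max (b + ?\<theta> t - e) (max (path_sup f s t) b)"
        have "c < path_sup f 0 t" using sup s' e pos by (auto simp: c_def)
        then obtain v where v: "0 \<le> v" "v \<le> t" "c < f v"
          unfolding path_sup_def using less_cSUP_iff[OF _ cadlag_bdd(1)[OF f order_refl], of t c] t by auto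
        have "v < s"
        proof (rule ccontr)
          assume "\<not> v < s"
          then have "f v \<le> path_sup f s t" using v s' by (intro path_sup_upper[OF f]) auto
          then show False using v by (auto simp: c_def)
        qed
        have "f v \<le> path_sup f 0 v" using v by (intro path_sup_upper[OF f]) auto
        then have "?\<theta> t - e \<le> ?\<theta> v" using v by (auto simp: eq[OF v(1)] c_def)
        have "emeasure ?\<mu> {s..t} \<le> emeasure ?\<mu> {v<..t}"
          using \<open>v < s\<close> by (intro emeasure_mono) auto
        also have "\<dots> = ennreal (?\<theta> t - ?\<theta> v)"
          using emeasure_stieltjes_Ioc[OF \<theta>, of v t] v t by simp
        also have "\<dots> \<le> 0 + ennreal e"
          using \<open>?\<theta> t - e \<le> ?\<theta> v\<close> by (auto intro: ennreal_leI)
        finally show "emeasure ?\<mu> {s..t} \<le> 0 + ennreal e" .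
      qed
    qed
  qed simp
  have up: "s' \<in> B" if "s \<in> B" "s \<le> s'" "s' \<le> t" for s s'
    using that path_sup_antimono[OF f, of s s' t] by (auto simp: B_def)
  \<comment> \<open>\<open>B\<close> is closed upwards in \<open>[0, t]\<close>, so it is covered by the
    intervals that start at its rational elements and at its minimum, if there is one.\<close>
  define Q where "Q = B \<inter> (\<rat> \<union> {Inf B})"
  have cover: "B \<subseteq> (\<Union>s\<in>Q. {s..t})"
  proof
    fix s assume s: "s \<in> B"
    have bdd: "bdd_below B" by (auto simp: B_def bdd_below_def)
    show "s \<in> (\<Union>s\<in>Q. {s..t})"
    proof (cases "s = Inf B")
      case True then show ?thesis using s by (auto simp: Q_def B_def)
    next
      case False
      then have "Inf B < s" using cInf_lower[OF s bdd] by simp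
      then obtain s' where s': "s' \<in> B" "s' < s" using cInf_less_iff[OF _ bdd] s by blast
      obtain q where q: "q \<in> \<rat>" "s' < q" "q < s" using Rats_dense_in_real[OF s'(2)] by auto
      then have "q \<in> Q" using up[OF s'(1), of q] s by (auto simp: Q_def B_def)
      then show ?thesis using q s by (auto simp: B_def intro!: bexI[of _ q])
    qed
  qed
  have "countable Q" unfolding Q_def by (intro countable_Int2 countable_Un countable_rat) auto
  then have "(\<Union>s\<in>Q. {s..t}) \<in> null_sets ?\<mu>"
    by (rule null_sets_UN') (auto simp: Q_def null)
  then have "AE s in ?\<mu>. s \<notin> (\<Union>s\<in>Q. {s..t})" by (rule AE_not_in)
  then show ?thesis
    using AE_stieltjes_nonneg[OF \<theta>]
  proof eventually_elim
    case (elim s)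
    show ?case
    proof
      assume st: "s \<le> t"
      have "s \<notin> B" using elim(1) cover by blast
      then have "b + ?\<theta> t \<le> path_sup f s t" using elim st by (auto simp: B_def)
      moreover have "path_sup f s t \<le> path_sup f 0 t" using elim st by (intro path_sup_antimono[OF f]) auto
      moreover have "path_sup f 0 t \<le> b + ?\<theta> t" using t by (auto simp: eq)
      ultimately show "path_sup f s t = b + ?\<theta> t" by simp
    qed
  qed
qed

section \<open>Marginal cost of control\<close>

text \<open>
  Extended by \<open>0\<close> to all other pairs of times, so that the integral over all \<open>t\<close> collects exactly
  the future of \<open>s\<close>.
\<close>

definition discounted_drawdown :: "(real \<Rightarrow> ennreal) \<Rightarrow> real \<Rightarrow> (real \<Rightarrow> real) \<Rightarrow> real \<Rightarrow> real \<Rightarrow> ennreal" where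
  "discounted_drawdown \<phi> r f s t =
     (if 0 \<le> s \<and> s \<le> t then ennreal (exp (- r * t)) * \<phi> (path_sup f s t - f t) else 0)"

definition future_drawdown :: "(real \<Rightarrow> ennreal) \<Rightarrow> real \<Rightarrow> (real \<Rightarrow> real) \<Rightarrow> real \<Rightarrow> ennreal" where
  "future_drawdown \<phi> r f s = (\<integral>\<^sup>+t. discounted_drawdown \<phi> r f s t \<partial>lborel)"

lemma discounted_drawdown_measurable:
  fixes X :: "real \<Rightarrow> 'a \<Rightarrow> real"
  assumes X: "\<And>t. 0 \<le> t \<Longrightarrow> X t \<in> borel_measurable M"
    and cadlag: "\<And>\<omega>. \<omega> \<in> space M \<Longrightarrow> cadlag (\<lambda>t. X t \<omega>)"
    and [measurable]: "\<phi> \<in> borel_measurable borel"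
  shows "(\<lambda>(s, t, \<omega>). discounted_drawdown \<phi> r (\<lambda>u. X u \<omega>) s t) \<in> borel_measurable (borel \<Otimes>\<^sub>M borel \<Otimes>\<^sub>M M)"
proof -
  have "(\<lambda>p. X (max 0 (fst p)) (snd p)) \<in> borel_measurable (borel \<Otimes>\<^sub>M M)"
    using X cadlag by (intro right_continuous_joint_measurable) (auto simp: cadlag_def)
  from measurable_compose[OF measurable_snd this]
  have [measurable]: "(\<lambda>p. X (max 0 (fst (snd p))) (snd (snd p))) \<in> borel_measurable ((borel :: real measure) \<Otimes>\<^sub>M borel \<Otimes>\<^sub>M M)" .
  define S where "S = (\<lambda>(s, t, \<omega>). if 0 \<le> s \<and> s \<le> t then path_sup (\<lambda>u. X u \<omega>) s t else 0)"
  have [measurable]: "S \<in> borel_measurable (borel \<Otimes>\<^sub>M borel \<Otimes>\<^sub>M M)"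
    unfolding S_def by (rule path_sup_measurable[OF X cadlag])
  have "(\<lambda>p. if 0 \<le> fst p \<and> fst p \<le> fst (snd p)
      then ennreal (exp (- r * fst (snd p))) * \<phi> (S p - X (max 0 (fst (snd p))) (snd (snd p))) else 0)
      \<in> borel_measurable (borel \<Otimes>\<^sub>M borel \<Otimes>\<^sub>M M)"
    by measurable
  also have "(\<lambda>p. if 0 \<le> fst p \<and> fst p \<le> fst (snd p)
      then ennreal (exp (- r * fst (snd p))) * \<phi> (S p - X (max 0 (fst (snd p))) (snd (snd p))) else 0) =
      (\<lambda>(s, t, \<omega>). discounted_drawdown \<phi> r (\<lambda>u. X u \<omega>) s t)"
    by (auto simp: fun_eq_iff discounted_drawdown_def S_def)
  finally show ?thesis .
qed

lemma discounted_drawdown_path_measurable: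
  assumes f: "cadlag f" and \<phi>: "\<phi> \<in> borel_measurable borel"
  shows "case_prod (discounted_drawdown \<phi> r f) \<in> borel_measurable (borel \<Otimes>\<^sub>M borel)"
proof -
  let ?N = "count_space (UNIV :: unit set)"
  have 1: "(\<lambda>(s, t, _). discounted_drawdown \<phi> r f s t) \<in> borel_measurable (borel \<Otimes>\<^sub>M borel \<Otimes>\<^sub>M ?N)"
    by (rule discounted_drawdown_measurable[where X="\<lambda>t _. f t", OF _ _ \<phi>]) (simp_all add: f)
  have 2: "(\<lambda>p :: real \<times> real. (fst p, snd p, ())) \<in> measurable (borel \<Otimes>\<^sub>M borel) (borel \<Otimes>\<^sub>M borel \<Otimes>\<^sub>M ?N)"
    by measurable
  show ?thesis
    using measurable_compose[OF 2 1] by (simp only: case_prod_conv case_prod_beta' fst_conv snd_conv)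
qed

lemma discounted_drawdown_antimono:
  assumes f: "cadlag f" and \<phi>: "mono \<phi>" and s: "0 \<le> s" "s \<le> s'"
  shows "discounted_drawdown \<phi> r f s' t \<le> discounted_drawdown \<phi> r f s t"
  using s path_sup_antimono[OF f, of s s' t]
  by (auto simp: discounted_drawdown_def intro!: mult_left_mono monoD[OF \<phi>])

lemma future_drawdown_antimono:
  assumes f: "cadlag f" and \<phi>: "mono \<phi>" and s: "0 \<le> s" "s \<le> s'"
  shows "future_drawdown \<phi> r f s' \<le> future_drawdown \<phi> r f s"
  unfolding future_drawdown_def by (intro nn_integral_mono discounted_drawdown_antimono assms)

text \<open>
  As the starting time decreases to \<open>s\<close>, the running maxima increase, so the integrands increase
  to their limit at all times other than \<open>s\<close> itself.
\<close>

lemma future_drawdown_right_continuous: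
  assumes f: "cadlag f" and \<phi>: "mono \<phi>" "continuous_on UNIV \<phi>"
    and s: "0 \<le> s" "\<And>n. s \<le> \<sigma> n" "decseq \<sigma>" "\<sigma> \<longlonglongrightarrow> s"
  shows "(SUP n. future_drawdown \<phi> r f (\<sigma> n)) = future_drawdown \<phi> r f s"
proof -
  have \<phi>m: "\<phi> \<in> borel_measurable borel" using \<phi> by (intro borel_measurable_continuous_onI)
  let ?K = "discounted_drawdown \<phi> r f"
  have inc: "incseq (\<lambda>n. ?K (\<sigma> n) t)" for t
  proof (rule incseq_SucI)
    fix n show "?K (\<sigma> n) t \<le> ?K (\<sigma> (Suc n)) t"
      using s(1) s(2)[of "Suc n"] s(3) by (intro discounted_drawdown_antimono[OF f \<phi>(1)]) (auto simp: decseq_Suc_iff)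
  qed
  have meas: "?K s \<in> borel_measurable borel" for s
    using measurable_compose[OF measurable_Pair[OF measurable_const measurable_ident_sets[OF refl]]
        discounted_drawdown_path_measurable[OF f \<phi>m], of s] by simp
  have "AE t in lborel. t \<noteq> s" by (rule AE_lborel_singleton)
  then have "AE t in lborel. ?K s t = (SUP n. ?K (\<sigma> n) t)"
  proof eventually_elim
    case (elim t)
    show ?case
    proof (cases "t < s")
      case True
      then have "\<not> \<sigma> n \<le> t" for n using s(2)[of n] by auto
      then show ?thesis using True by (simp add: discounted_drawdown_def)
    next
      case False
      then have t: "s < t" using elim by simp
      have "(\<lambda>n. \<phi> (path_sup f (\<sigma> n) t - f t)) \<longlonglongrightarrow> \<phi> (path_sup f s t - f t)"
        using path_sup_tendsto[OF f s(1) t s(2,4)]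
        by (intro continuous_on_tendsto_compose[OF \<phi>(2)] tendsto_diff tendsto_const) auto
      then have "(\<lambda>n. ennreal (exp (- r * t)) * \<phi> (path_sup f (\<sigma> n) t - f t)) \<longlonglongrightarrow> ?K s t"
        using s(1) t by (auto simp: discounted_drawdown_def intro: ennreal_tendsto_cmult)
      moreover have "\<forall>\<^sub>F n in sequentially. \<sigma> n < t" using s(4) t by (rule order_tendstoD)
      then have "\<forall>\<^sub>F n in sequentially. ennreal (exp (- r * t)) * \<phi> (path_sup f (\<sigma> n) t - f t) = ?K (\<sigma> n) t"
        by (rule eventually_mono) (simp add: discounted_drawdown_def less_imp_le order.trans[OF s(1) s(2)])
      ultimately have "(\<lambda>n. ?K (\<sigma> n) t) \<longlonglongrightarrow> ?K s t" by (rule Lim_transform_eventually)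
      then show ?thesis using LIMSEQ_SUP[OF inc[of t]] LIMSEQ_unique by blast
    qed
  qed
  then have "future_drawdown \<phi> r f s = (\<integral>\<^sup>+t. (SUP n. ?K (\<sigma> n) t) \<partial>lborel)"
    unfolding future_drawdown_def by (rule nn_integral_cong_AE)
  also have "\<dots> = (SUP n. future_drawdown \<phi> r f (\<sigma> n))"
    unfolding future_drawdown_def using inc meas
    by (intro nn_integral_monotone_convergence_SUP) (auto simp: incseq_def le_fun_def)
  finally show ?thesis by simp
qed

text \<open>
  The reflected path lies at or below the path that
  is reflected only from time \<open>s\<close> on, with equality at the times at which the barrier control
  increases.
\<close>

lemma
  assumes f: "cadlag f" and \<phi>: "mono \<phi>" "\<phi> \<in> borel_measurable borel"
  shows future_drawdown_le: "control_path \<theta> \<Longrightarrow> (\<integral>\<^sup>+s. future_drawdown \<phi> r f s \<partial>stieltjes_measure \<theta>) \<le>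
      (\<integral>\<^sup>+t. ennreal (exp (- r * t)) * \<phi> (b + reflection f b t - f t) * ennreal (\<theta> t) * indicator {0..} t \<partial>lborel)"
    and future_drawdown_reflection: "(\<integral>\<^sup>+s. future_drawdown \<phi> r f s \<partial>stieltjes_measure (reflection f b)) =
      (\<integral>\<^sup>+t. ennreal (exp (- r * t)) * \<phi> (b + reflection f b t - f t) * ennreal (reflection f b t) * indicator {0..} t \<partial>lborel)"
proof -
  let ?K = "discounted_drawdown \<phi> r f"
  have swap: "(\<integral>\<^sup>+s. future_drawdown \<phi> r f s \<partial>stieltjes_measure \<theta>) =
      (\<integral>\<^sup>+t. (\<integral>\<^sup>+s. ?K s t \<partial>stieltjes_measure \<theta>) \<partial>lborel)" if "control_path \<theta>" for \<theta>
    unfolding future_drawdown_def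
    by (rule stieltjes_Tonelli[OF that discounted_drawdown_path_measurable[OF f \<phi>(2)]])
  have const: "(\<integral>\<^sup>+s. c * indicator {..t} s \<partial>stieltjes_measure \<theta>) = c * ennreal (\<theta> t)"
    if "control_path \<theta>" "0 \<le> t" for \<theta> t c
    using emeasure_stieltjes_Iic[OF that] by (subst nn_integral_cmult_indicator) auto
  have neg: "(\<integral>\<^sup>+s. ?K s t \<partial>stieltjes_measure \<theta>) = 0" if "\<not> 0 \<le> t" for \<theta> t
  proof -
    have "?K s t = 0" for s using that by (auto simp: discounted_drawdown_def)
    then show ?thesis by simp
  qed
  show "(\<integral>\<^sup>+s. future_drawdown \<phi> r f s \<partial>stieltjes_measure \<theta>) \<le>
      (\<integral>\<^sup>+t. ennreal (exp (- r * t)) * \<phi> (b + reflection f b t - f t) * ennreal (\<theta> t) * indicator {0..} t \<partial>lborel)"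
    if \<theta>: "control_path \<theta>"
    unfolding swap[OF \<theta>]
  proof (rule nn_integral_mono)
    fix t :: real
    show "(\<integral>\<^sup>+s. ?K s t \<partial>stieltjes_measure \<theta>) \<le>
        ennreal (exp (- r * t)) * \<phi> (b + reflection f b t - f t) * ennreal (\<theta> t) * indicator {0..} t"
    proof (cases "0 \<le> t")
      case True
      have "(\<integral>\<^sup>+s. ?K s t \<partial>stieltjes_measure \<theta>) \<le>
          (\<integral>\<^sup>+s. ennreal (exp (- r * t)) * \<phi> (b + reflection f b t - f t) * indicator {..t} s \<partial>stieltjes_measure \<theta>)"
      proof (rule nn_integral_mono)
        fix s
        have "path_sup f s t \<le> b + reflection f b t" if "0 \<le> s" "s \<le> t"
          using path_sup_antimono[OF f, of 0 s t] that reflection_eq[OF f True, of b] by auto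
        then show "?K s t \<le> ennreal (exp (- r * t)) * \<phi> (b + reflection f b t - f t) * indicator {..t} s"
          by (auto simp: discounted_drawdown_def intro!: mult_left_mono monoD[OF \<phi>(1)])
      qed
      then show ?thesis using const[OF \<theta> True] True by simp
    qed (use neg in simp)
  qed
  have \<theta>: "control_path (reflection f b)" by (rule control_path_reflection[OF f])
  show "(\<integral>\<^sup>+s. future_drawdown \<phi> r f s \<partial>stieltjes_measure (reflection f b)) =
      (\<integral>\<^sup>+t. ennreal (exp (- r * t)) * \<phi> (b + reflection f b t - f t) * ennreal (reflection f b t) * indicator {0..} t \<partial>lborel)"
    unfolding swap[OF \<theta>]
  proof (rule nn_integral_cong)
    fix t :: real
    show "(\<integral>\<^sup>+s. ?K s t \<partial>stieltjes_measure (reflection f b)) =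
        ennreal (exp (- r * t)) * \<phi> (b + reflection f b t - f t) * ennreal (reflection f b t) * indicator {0..} t"
    proof (cases "0 \<le> t")
      case True
      have "(\<integral>\<^sup>+s. ?K s t \<partial>stieltjes_measure (reflection f b)) =
          (\<integral>\<^sup>+s. ennreal (exp (- r * t)) * \<phi> (b + reflection f b t - f t) * indicator {..t} s \<partial>stieltjes_measure (reflection f b))"
      proof (rule nn_integral_cong_AE, use AE_reflection_increase[OF f True, of b] AE_stieltjes_nonneg[OF \<theta>] in eventually_elim)
        case (elim s)
        then show ?case by (auto simp: discounted_drawdown_def indicator_def)
      qed
      then show ?thesis using const[OF \<theta> True] True by simp
    qed (use neg in simp)
  qed
qed

context levy_process
begin

definition depth_mean :: "(real \<Rightarrow> ennreal) \<Rightarrow> real \<Rightarrow> ennreal" where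
  "depth_mean \<phi> t = (\<integral>\<^sup>+\<omega>. \<phi> (path_sup (\<lambda>u. X 0 \<omega> - X u \<omega>) 0 t) \<partial>M)"

definition discounted_depth :: "(real \<Rightarrow> ennreal) \<Rightarrow> real \<Rightarrow> ennreal" where
  "discounted_depth \<phi> r = (\<integral>\<^sup>+t. ennreal (exp (- r * t)) * depth_mean \<phi> t * indicator {0..} t \<partial>lborel)"

text \<open>
  The mean depth is a function of the increment laws alone, so it agrees for all measures under
  which the increments have the same laws.
\<close>

lemma depth_mean_eq:
  assumes "mono \<phi>" "continuous_on UNIV \<phi>" "0 \<le> t"
  shows "depth_mean \<phi> t = dyadic_limit fall \<phi> t"
  using nn_integral_depth[OF order_refl assms(3,1,2), of "\<lambda>_. 1"]
  by (simp add: depth_mean_def emeasure_space_1)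

lemma depth_mean_measurable:
  assumes \<phi>: "mono \<phi>" "continuous_on UNIV \<phi>"
  shows "(\<lambda>t. ennreal (exp (- r * t)) * depth_mean \<phi> t * indicator {0..} t) \<in> borel_measurable borel"
proof -
  have \<phi>m[measurable]: "\<phi> \<in> borel_measurable borel" using \<phi> by (intro borel_measurable_continuous_onI)
  define S where "S = (\<lambda>(s, t, \<omega>). if 0 \<le> s \<and> s \<le> t then path_sup (\<lambda>u. X 0 \<omega> - X u \<omega>) s t else 0)"
  have [measurable]: "S \<in> borel_measurable (borel \<Otimes>\<^sub>M borel \<Otimes>\<^sub>M M)"
    unfolding S_def
    by (rule path_sup_measurable[where X="\<lambda>u \<omega>. X 0 \<omega> - X u \<omega>"])
      (auto intro!: borel_measurable_diff X_measurable cadlag_minus cadlag_const cadlag_paths)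
  have "(\<lambda>t. ennreal (exp (- r * t)) * (\<integral>\<^sup>+\<omega>. \<phi> (S (0, t, \<omega>)) \<partial>M) * indicator {0..} t) \<in> borel_measurable borel"
    by measurable
  also have "(\<lambda>t. ennreal (exp (- r * t)) * (\<integral>\<^sup>+\<omega>. \<phi> (S (0, t, \<omega>)) \<partial>M) * indicator {0..} t) =
      (\<lambda>t. ennreal (exp (- r * t)) * depth_mean \<phi> t * indicator {0..} t)"
    by (auto simp: fun_eq_iff S_def depth_mean_def indicator_def)
  finally show ?thesis .
qed

lemma future_drawdown_measurable:
  assumes \<phi>: "\<phi> \<in> borel_measurable borel"
  shows "(\<lambda>\<omega>. future_drawdown \<phi> r (\<lambda>u. X u \<omega>) s) \<in> borel_measurable M"
    and "(\<lambda>(t, \<omega>). discounted_drawdown \<phi> r (\<lambda>u. X u \<omega>) s t) \<in> borel_measurable (lborel \<Otimes>\<^sub>M M)"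
proof -
  have K: "(\<lambda>(s, t, \<omega>). discounted_drawdown \<phi> r (\<lambda>u. X u \<omega>) s t) \<in> borel_measurable (borel \<Otimes>\<^sub>M borel \<Otimes>\<^sub>M M)"
    by (intro discounted_drawdown_measurable X_measurable cadlag_paths \<phi>)
  have "(\<lambda>p. (s, fst p, snd p)) \<in> measurable (lborel \<Otimes>\<^sub>M M) (borel \<Otimes>\<^sub>M borel \<Otimes>\<^sub>M M)" by measurable
  from measurable_compose[OF this K]
  show 1: "(\<lambda>(t, \<omega>). discounted_drawdown \<phi> r (\<lambda>u. X u \<omega>) s t) \<in> borel_measurable (lborel \<Otimes>\<^sub>M M)"
    by (simp add: case_prod_beta')
  have "(\<lambda>(\<omega>, t). discounted_drawdown \<phi> r (\<lambda>u. X u \<omega>) s t) \<in> borel_measurable (M \<Otimes>\<^sub>M lborel)"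
    using measurable_pair_swap[OF 1] by (simp add: case_prod_beta')
  then show "(\<lambda>\<omega>. future_drawdown \<phi> r (\<lambda>u. X u \<omega>) s) \<in> borel_measurable M"
    unfolding future_drawdown_def by (rule lborel.borel_measurable_nn_integral)
qed

text \<open>
  Only one time \<open>t\<close> after \<open>s\<close> has to be considered at once: by Tonelli the discounted integral over
  \<open>t\<close> is exchanged with the expectation, and for fixed \<open>t\<close> the drawdown is independent of \<open>D\<close> with the
  law of the depth.
\<close>

lemma nn_integral_future_drawdown:
  assumes \<phi>: "mono \<phi>" "continuous_on UNIV \<phi>" and s: "0 \<le> s"
    and D: "D \<in> borel_measurable (F s)"
  shows "(\<integral>\<^sup>+\<omega>. D \<omega> * future_drawdown \<phi> r (\<lambda>u. X u \<omega>) s \<partial>M) =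
    ennreal (exp (- r * s)) * (\<integral>\<^sup>+\<omega>. D \<omega> \<partial>M) * discounted_depth \<phi> r"
proof -
  have \<phi>m: "\<phi> \<in> borel_measurable borel" using \<phi> by (intro borel_measurable_continuous_onI)
  let ?K = "\<lambda>t \<omega>. discounted_drawdown \<phi> r (\<lambda>u. X u \<omega>) s t"
  note integral_measurable = borel_measurable_nn_integral
  interpret pair_sigma_finite lborel M ..
  note [measurable] = F_measurable_M[OF s D] future_drawdown_measurable(2)[OF \<phi>m, of r s]
  have K[measurable]: "(\<lambda>p. ?K (fst p) (snd p)) \<in> borel_measurable (lborel \<Otimes>\<^sub>M M)"
    using future_drawdown_measurable(2)[OF \<phi>m, of r s] by (simp add: case_prod_beta')
  have Kt: "?K t \<in> borel_measurable M" for t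
    using measurable_compose[OF measurable_Pair1' K, of t] by simp
  have Ks: "(\<lambda>t. ?K t \<omega>) \<in> borel_measurable borel" if "\<omega> \<in> space M" for \<omega>
    using measurable_compose[OF measurable_Pair2' K, of \<omega>] that by simp
  have DK[measurable]: "(\<lambda>p. D (snd p) * ?K (fst p) (snd p)) \<in> borel_measurable (lborel \<Otimes>\<^sub>M M)" by measurable
  then have DK'[measurable]: "(\<lambda>(t, \<omega>). D \<omega> * ?K t \<omega>) \<in> borel_measurable (lborel \<Otimes>\<^sub>M M)"
    by (simp add: case_prod_beta')
  have "(\<integral>\<^sup>+\<omega>. D \<omega> * future_drawdown \<phi> r (\<lambda>u. X u \<omega>) s \<partial>M) = (\<integral>\<^sup>+\<omega>. (\<integral>\<^sup>+t. D \<omega> * ?K t \<omega> \<partial>lborel) \<partial>M)"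
    unfolding future_drawdown_def using Ks by (intro nn_integral_cong nn_integral_cmult[symmetric]) auto
  also have "\<dots> = (\<integral>\<^sup>+t. (\<integral>\<^sup>+\<omega>. D \<omega> * ?K t \<omega> \<partial>M) \<partial>lborel)"
    by (rule Fubini'[OF DK'])
  also have "\<dots> = (\<integral>\<^sup>+t. (\<integral>\<^sup>+\<omega>. D \<omega> * ?K (s + t) \<omega> \<partial>M) \<partial>lborel)"
  proof -
    have "(\<lambda>t. \<integral>\<^sup>+\<omega>. D \<omega> * ?K t \<omega> \<partial>M) \<in> borel_measurable lborel"
      using integral_measurable[OF DK'] by simp
    then show ?thesis using nn_integral_real_affine[of "\<lambda>t. \<integral>\<^sup>+\<omega>. D \<omega> * ?K t \<omega> \<partial>M" 1 s] by simp
  qed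
  also have "\<dots> = (\<integral>\<^sup>+t. (ennreal (exp (- r * s)) * (\<integral>\<^sup>+\<omega>. D \<omega> \<partial>M)) *
      (ennreal (exp (- r * t)) * depth_mean \<phi> t * indicator {0..} t) \<partial>lborel)"
  proof (intro nn_integral_cong)
    fix t :: real
    show "(\<integral>\<^sup>+\<omega>. D \<omega> * ?K (s + t) \<omega> \<partial>M) = (ennreal (exp (- r * s)) * (\<integral>\<^sup>+\<omega>. D \<omega> \<partial>M)) *
        (ennreal (exp (- r * t)) * depth_mean \<phi> t * indicator {0..} t)"
    proof (cases "0 \<le> t")
      case True
      let ?e = "ennreal (exp (- r * (s + t)))"
      have [measurable]: "(\<lambda>\<omega>. path_sup (\<lambda>u. X u \<omega>) s (s + t)) \<in> borel_measurable M"
      proof (rule borel_measurable_LIMSEQ_metric)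
        show "(\<lambda>\<omega>. grid_max (\<lambda>u. X u \<omega>) s (s + t) n) \<in> borel_measurable M" for n
          using s True by (intro grid_max_measurable X_measurable) auto
        show "grid_max (\<lambda>u. X u \<omega>) s (s + t) \<longlonglongrightarrow> path_sup (\<lambda>u. X u \<omega>) s (s + t)" if "\<omega> \<in> space M" for \<omega>
          using s True that by (intro cadlag_grid_max_tendsto cadlag_paths) auto
      qed
      have [measurable]: "X (s + t) \<in> borel_measurable M" using s True by (intro X_measurable) auto
      note [measurable] = \<phi>m
      have "(\<integral>\<^sup>+\<omega>. D \<omega> * ?K (s + t) \<omega> \<partial>M) =
          (\<integral>\<^sup>+\<omega>. ?e * (D \<omega> * \<phi> (path_sup (\<lambda>u. X u \<omega>) s (s + t) - X (s + t) \<omega>)) \<partial>M)"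
        using s True by (intro nn_integral_cong) (simp add: discounted_drawdown_def mult_ac)
      also have "\<dots> = ?e * (\<integral>\<^sup>+\<omega>. D \<omega> * \<phi> (path_sup (\<lambda>u. X u \<omega>) s (s + t) - X (s + t) \<omega>) \<partial>M)"
        by (intro nn_integral_cmult) measurable
      also have "\<dots> = ?e * ((\<integral>\<^sup>+\<omega>. D \<omega> \<partial>M) * depth_mean \<phi> t)"
        using nn_integral_drawdown[OF s True \<phi> D] depth_mean_eq[OF \<phi> True] by simp
      also have "?e = ennreal (exp (- r * s)) * ennreal (exp (- r * t))"
        by (simp add: ennreal_mult[symmetric] exp_add[symmetric] algebra_simps)
      finally show ?thesis using True by (simp add: mult_ac)
    next
      case False
      then have "?K (s + t) \<omega> = 0" for \<omega> by (simp add: discounted_drawdown_def)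
      then show ?thesis using False by simp
    qed
  qed
  also have "\<dots> = ennreal (exp (- r * s)) * (\<integral>\<^sup>+\<omega>. D \<omega> \<partial>M) * discounted_depth \<phi> r"
    unfolding discounted_depth_def using depth_mean_measurable[OF \<phi>] by (intro nn_integral_cmult) simp
  finally show ?thesis .
qed

text \<open>
  Conditionally on the information at time \<open>s\<close>, the future drawdown has the mean
  \<open>exp (- r s) * discounted_depth \<phi> r\<close>, and its integral against an adapted control sees only this
  conditional mean.
\<close>

lemma nn_integral_future_drawdown_control:
  assumes \<phi>: "mono \<phi>" "continuous_on UNIV \<phi>" and r: "0 \<le> r"
    and \<theta>: "adapted F \<theta>" "\<And>\<omega>. \<omega> \<in> space M \<Longrightarrow> control_path (\<lambda>t. \<theta> t \<omega>)"
  shows "(\<integral>\<^sup>+\<omega>. (\<integral>\<^sup>+s. future_drawdown \<phi> r (\<lambda>u. X u \<omega>) s \<partial>stieltjes_measure (\<lambda>t. \<theta> t \<omega>)) \<partial>M) =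
    discounted_depth \<phi> r * (\<integral>\<^sup>+\<omega>. (\<integral>\<^sup>+s. ennreal (exp (- r * s)) \<partial>stieltjes_measure (\<lambda>t. \<theta> t \<omega>)) \<partial>M)"
proof -
  have \<phi>m: "\<phi> \<in> borel_measurable borel" using \<phi> by (intro borel_measurable_continuous_onI)
  have incr: "(\<lambda>\<omega>. ennreal (grid_increment (\<lambda>t. \<theta> t \<omega>) n k)) \<in> borel_measurable (F (real k / 2 ^ n))" for n k
  proof -
    have m: "\<theta> (real j / 2 ^ n) \<in> borel_measurable (F (real k / 2 ^ n))" if "j \<le> k" for j
    proof (rule measurable_from_subalg[OF subalgebra_F_mono])
      show "\<theta> (real j / 2 ^ n) \<in> borel_measurable (F (real j / 2 ^ n))"
        using \<theta>(1) by (simp add: adapted_def)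
      show "real j / 2 ^ n \<le> real k / 2 ^ n"
        using that by (intro divide_right_mono) simp_all
    qed
    have "(\<lambda>\<omega>. grid_increment (\<lambda>t. \<theta> t \<omega>) n k) \<in> borel_measurable (F (real k / 2 ^ n))"
    proof (cases "k = 0")
      case True
      then show ?thesis using m[of 0] by (simp add: grid_increment_def)
    next
      case False
      have "(\<lambda>\<omega>. \<theta> (real k / 2 ^ n) \<omega> - \<theta> (real (k - 1) / 2 ^ n) \<omega>) \<in> borel_measurable (F (real k / 2 ^ n))"
        by (intro borel_measurable_diff m) simp_all
      then show ?thesis using False unfolding grid_increment_def by simp
    qed
    then show ?thesis by (rule measurable_compose[OF _ measurable_ennreal])
  qed
  have incr_M: "(\<lambda>\<omega>. ennreal (grid_increment (\<lambda>t. \<theta> t \<omega>) n k)) \<in> borel_measurable M" for n k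
    by (rule F_measurable_M[OF _ incr]) simp
  \<comment> \<open>The same approximation applies to the future drawdown and to the discount factor, so the two
    limits can be compared term by term.\<close>
  have lim: "(\<integral>\<^sup>+\<omega>. (\<integral>\<^sup>+s. G \<omega> s \<partial>stieltjes_measure (\<lambda>t. \<theta> t \<omega>)) \<partial>M) =
      (SUP n. \<Sum>k. \<integral>\<^sup>+\<omega>. G \<omega> (real k / 2 ^ n) * ennreal (grid_increment (\<lambda>t. \<theta> t \<omega>) n k) \<partial>M)"
    if anti: "\<And>\<omega> s t. \<omega> \<in> space M \<Longrightarrow> 0 \<le> s \<Longrightarrow> s \<le> t \<Longrightarrow> G \<omega> t \<le> G \<omega> s"
      and rc: "\<And>\<omega> s \<sigma>. \<omega> \<in> space M \<Longrightarrow> 0 \<le> s \<Longrightarrow> (\<And>n. s \<le> \<sigma> n) \<Longrightarrow> decseq \<sigma> \<Longrightarrow> \<sigma> \<longlonglongrightarrow> s \<Longrightarrow>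
        (SUP n. G \<omega> (\<sigma> n)) = G \<omega> s"
      and meas: "\<And>s. (\<lambda>\<omega>. G \<omega> s) \<in> borel_measurable M" for G :: "'a \<Rightarrow> real \<Rightarrow> ennreal"
  proof -
    note [measurable] = meas incr_M
    let ?S = "\<lambda>n \<omega>. \<Sum>k. G \<omega> (real k / 2 ^ n) * ennreal (grid_increment (\<lambda>t. \<theta> t \<omega>) n k)"
    have S: "incseq (\<lambda>n. ?S n \<omega>)" "(\<integral>\<^sup>+s. G \<omega> s \<partial>stieltjes_measure (\<lambda>t. \<theta> t \<omega>)) = (SUP n. ?S n \<omega>)"
      if "\<omega> \<in> space M" for \<omega>
      using stieltjes_integral_SUP[OF \<theta>(2)[OF that], of "G \<omega>"] anti[OF that] rc[OF that] by blast+
    have "(\<integral>\<^sup>+\<omega>. (\<integral>\<^sup>+s. G \<omega> s \<partial>stieltjes_measure (\<lambda>t. \<theta> t \<omega>)) \<partial>M) = (\<integral>\<^sup>+\<omega>. (SUP n. ?S n \<omega>) \<partial>M)"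
      by (intro nn_integral_cong S(2))
    also have "\<dots> = (SUP n. \<integral>\<^sup>+\<omega>. ?S n \<omega> \<partial>M)"
      using S(1) by (intro nn_integral_monotone_convergence_SUP_AE) (auto simp: incseq_Suc_iff)
    also have "\<dots> = (SUP n. \<Sum>k. \<integral>\<^sup>+\<omega>. G \<omega> (real k / 2 ^ n) * ennreal (grid_increment (\<lambda>t. \<theta> t \<omega>) n k) \<partial>M)"
      by (intro SUP_cong refl nn_integral_suminf) measurable
    finally show ?thesis .
  qed
  have "(\<integral>\<^sup>+\<omega>. (\<integral>\<^sup>+s. future_drawdown \<phi> r (\<lambda>u. X u \<omega>) s \<partial>stieltjes_measure (\<lambda>t. \<theta> t \<omega>)) \<partial>M) =
      (SUP n. \<Sum>k. \<integral>\<^sup>+\<omega>. future_drawdown \<phi> r (\<lambda>u. X u \<omega>) (real k / 2 ^ n) * ennreal (grid_increment (\<lambda>t. \<theta> t \<omega>) n k) \<partial>M)"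
    using \<phi> \<phi>m by (intro lim future_drawdown_antimono future_drawdown_right_continuous cadlag_paths future_drawdown_measurable) auto
  also have "\<dots> = (SUP n. \<Sum>k. discounted_depth \<phi> r *
      (\<integral>\<^sup>+\<omega>. ennreal (exp (- r * (real k / 2 ^ n))) * ennreal (grid_increment (\<lambda>t. \<theta> t \<omega>) n k) \<partial>M))"
  proof (intro SUP_cong refl suminf_cong)
    fix n k
    have "(\<integral>\<^sup>+\<omega>. future_drawdown \<phi> r (\<lambda>u. X u \<omega>) (real k / 2 ^ n) * ennreal (grid_increment (\<lambda>t. \<theta> t \<omega>) n k) \<partial>M) =
        ennreal (exp (- r * (real k / 2 ^ n))) * (\<integral>\<^sup>+\<omega>. ennreal (grid_increment (\<lambda>t. \<theta> t \<omega>) n k) \<partial>M) * discounted_depth \<phi> r"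
      using nn_integral_future_drawdown[OF \<phi> _ incr[of n k]] by (simp add: mult.commute)
    also have "\<dots> = discounted_depth \<phi> r *
        (\<integral>\<^sup>+\<omega>. ennreal (exp (- r * (real k / 2 ^ n))) * ennreal (grid_increment (\<lambda>t. \<theta> t \<omega>) n k) \<partial>M)"
      by (subst nn_integral_cmult[OF incr_M]) (simp add: mult_ac)
    finally show "(\<integral>\<^sup>+\<omega>. future_drawdown \<phi> r (\<lambda>u. X u \<omega>) (real k / 2 ^ n) * ennreal (grid_increment (\<lambda>t. \<theta> t \<omega>) n k) \<partial>M) =
        discounted_depth \<phi> r * (\<integral>\<^sup>+\<omega>. ennreal (exp (- r * (real k / 2 ^ n))) * ennreal (grid_increment (\<lambda>t. \<theta> t \<omega>) n k) \<partial>M)" .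
  qed
  also have "\<dots> = discounted_depth \<phi> r * (SUP n. \<Sum>k. \<integral>\<^sup>+\<omega>. ennreal (exp (- r * (real k / 2 ^ n))) * ennreal (grid_increment (\<lambda>t. \<theta> t \<omega>) n k) \<partial>M)"
    by (simp add: SUP_mult_left_ennreal)
  also have "(SUP n. \<Sum>k. \<integral>\<^sup>+\<omega>. ennreal (exp (- r * (real k / 2 ^ n))) * ennreal (grid_increment (\<lambda>t. \<theta> t \<omega>) n k) \<partial>M) =
      (\<integral>\<^sup>+\<omega>. (\<integral>\<^sup>+s. ennreal (exp (- r * s)) \<partial>stieltjes_measure (\<lambda>t. \<theta> t \<omega>)) \<partial>M)"
  proof (rule lim[symmetric])
    show "ennreal (exp (- r * t)) \<le> ennreal (exp (- r * s))" if "s \<le> t" for s t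
      using r that by (intro ennreal_leI) (simp add: mult_left_mono)
    fix s \<sigma> assume \<sigma>: "decseq \<sigma>" "\<sigma> \<longlonglongrightarrow> (s::real)"
    have "incseq (\<lambda>n. ennreal (exp (- r * \<sigma> n)))"
      using r \<sigma>(1) by (auto simp: incseq_def decseq_def intro!: ennreal_leI mult_left_mono)
    moreover have "(\<lambda>n. ennreal (exp (- r * \<sigma> n))) \<longlonglongrightarrow> ennreal (exp (- r * s))"
      using \<sigma>(2) by (intro tendsto_ennrealI tendsto_exp tendsto_mult tendsto_const)
    ultimately show "(SUP n. ennreal (exp (- r * \<sigma> n))) = ennreal (exp (- r * s))"
      using LIMSEQ_SUP LIMSEQ_unique by blast
  qed simp
  finally show ?thesis .
qed

end

section \<open>Admissibility of the barrier control\<close>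

text \<open>
  Each unit of time adds at most the height climbed within it.
\<close>

lemma reflection_le_heights:
  assumes f: "cadlag f" and t: "0 \<le> t" "t \<le> real n"
  shows "reflection f b t \<le> max 0 (f 0 - b) + (\<Sum>k<n. max 0 (path_sup (\<lambda>u. f u - f (real k)) (real k) (real k + 1)))"
proof -
  let ?H = "\<lambda>k. max 0 (path_sup (\<lambda>u. f u - f (real k)) (real k) (real k + 1))"
  have climb: "f u \<le> f 0 + (\<Sum>k<n. ?H k)" if "0 \<le> u" "u \<le> real n" for u
    using that
  proof (induction n arbitrary: u)
    case (Suc n)
    show ?case
    proof (cases "u \<le> real n")
      case True
      have "f u \<le> f 0 + (\<Sum>k<n. ?H k)" using True Suc.prems by (intro Suc.IH)
      moreover have "0 \<le> ?H n" by simp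
      ultimately show ?thesis by simp
    next
      case False
      have "f u - f (real n) \<le> path_sup (\<lambda>u. f u - f (real n)) (real n) (real n + 1)"
        using False Suc.prems by (intro path_sup_upper[of "\<lambda>u. f u - f (real n)"] cadlag_minus cadlag_const f) auto
      moreover have "f (real n) \<le> f 0 + (\<Sum>k<n. ?H k)" by (intro Suc.IH) auto
      ultimately show ?thesis by simp
    qed
  qed simp
  have nonneg: "0 \<le> (\<Sum>k<n. ?H k)" by (intro sum_nonneg) simp
  show ?thesis
    unfolding reflection_def
  proof (rule cSUP_least)
    fix u assume "u \<in> {0..t}"
    then have "f u \<le> f 0 + (\<Sum>k<n. ?H k)" using t by (intro climb) simp_all
    then show "max (f u - b) 0 \<le> max 0 (f 0 - b) + (\<Sum>k<n. ?H k)"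
      using nonneg max.cobounded1[of 0 "f 0 - b"] max.cobounded2[of "f 0 - b" 0]
      by (intro max.boundedI) linarith+
  qed (use t in simp)
qed

text \<open>
  Jensen's inequality for the square, by integrating \<open>2 f(x) f(y) \<le> f(x)\<^sup>2 + f(y)\<^sup>2\<close> over both
  variables; infinite integrals are included.
\<close>

lemma nn_integral_power2_le:
  fixes f :: "'a \<Rightarrow> real"
  assumes "prob_space M" and [measurable]: "f \<in> borel_measurable M" and f: "\<And>x. 0 \<le> f x"
  shows "(\<integral>\<^sup>+x. ennreal (f x) \<partial>M)\<^sup>2 \<le> (\<integral>\<^sup>+x. ennreal ((f x)\<^sup>2) \<partial>M)"
proof -
  interpret prob_space M by fact
  let ?I = "\<integral>\<^sup>+x. ennreal (f x) \<partial>M" and ?J = "\<integral>\<^sup>+x. ennreal ((f x)\<^sup>2) \<partial>M"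
  have "2 * ?I\<^sup>2 = 2 * (\<integral>\<^sup>+x. (\<integral>\<^sup>+y. ennreal (f x) * ennreal (f y) \<partial>M) \<partial>M)"
    by (simp add: nn_integral_cmult nn_integral_multc power2_eq_square)
  also have "\<dots> = (\<integral>\<^sup>+x. (\<integral>\<^sup>+y. 2 * (ennreal (f x) * ennreal (f y)) \<partial>M) \<partial>M)"
    by (simp add: nn_integral_cmult)
  also have "\<dots> \<le> (\<integral>\<^sup>+x. (\<integral>\<^sup>+y. ennreal ((f x)\<^sup>2) + ennreal ((f y)\<^sup>2) \<partial>M) \<partial>M)"
  proof (intro nn_integral_mono)
    fix x y
    have "2 * (f x * f y) \<le> (f x)\<^sup>2 + (f y)\<^sup>2" using sum_squares_bound[of "f x" "f y"] by simp
    then have "ennreal (2 * (f x * f y)) \<le> ennreal ((f x)\<^sup>2 + (f y)\<^sup>2)" by (rule ennreal_leI)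
    then show "2 * (ennreal (f x) * ennreal (f y)) \<le> ennreal ((f x)\<^sup>2) + ennreal ((f y)\<^sup>2)"
      using f by (simp add: ennreal_mult)
  qed
  also have "\<dots> = 2 * ?J"
    by (simp add: nn_integral_add emeasure_space_1 mult_2)
  finally show ?thesis by (subst (asm) ennreal_mult_le_mult_iff) auto
qed

lemma nn_integral_discounted_square:
  assumes r: "0 < r"
  shows "(\<integral>\<^sup>+t. ennreal (r * exp (- r * t)) * ennreal ((t + 2)\<^sup>2) * indicator {0..} t \<partial>lborel) < \<infinity>"
proof -
  \<comment> \<open>Chosen such that \<open>t + 2 \<le> C exp (r t / 4)\<close>, which costs half of the
    discount rate after squaring.\<close>
  define C where "C = 2 + 4 / r"
  have "(\<integral>\<^sup>+t. ennreal (r * exp (- r * t)) * ennreal ((t + 2)\<^sup>2) * indicator {0..} t \<partial>lborel) \<le>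
      (\<integral>\<^sup>+t. ennreal (2 * C\<^sup>2) * (ennreal (r / 2 * exp (- (r / 2) * t)) * indicator {0..} t) \<partial>lborel)"
  proof (rule nn_integral_mono)
    fix t :: real
    show "ennreal (r * exp (- r * t)) * ennreal ((t + 2)\<^sup>2) * indicator {0..} t \<le>
        ennreal (2 * C\<^sup>2) * (ennreal (r / 2 * exp (- (r / 2) * t)) * indicator {0..} t)"
    proof (cases "0 \<le> t")
      case True
      define E where "E = exp (r * t / 4)"
      have "r * t / 4 \<le> E" unfolding E_def using exp_ge_add_one_self[of "r * t / 4"] by linarith
      then have "t \<le> 4 / r * E" using r by (simp add: field_simps)
      moreover have "1 \<le> E" unfolding E_def using r True by simp
      ultimately have "t + 2 \<le> C * E" by (simp add: C_def distrib_right)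
      then have "(t + 2)\<^sup>2 \<le> (C * E)\<^sup>2" using True by (intro power_mono) auto
      then have "r * exp (- r * t) * (t + 2)\<^sup>2 \<le> r * exp (- r * t) * (C * E)\<^sup>2"
        using r by (intro mult_left_mono) auto
      also have "\<dots> = 2 * C\<^sup>2 * (r / 2 * (exp (- r * t) * (E * E)))"
        by (simp add: power2_eq_square)
      also have "exp (- r * t) * (E * E) = exp (- (r / 2) * t)"
        unfolding E_def by (simp add: exp_add[symmetric])
      finally have "ennreal (r * exp (- r * t) * (t + 2)\<^sup>2) \<le> ennreal (2 * C\<^sup>2 * (r / 2 * exp (- (r / 2) * t)))"
        by (rule ennreal_leI)
      then show ?thesis using True r by (simp add: ennreal_mult[symmetric])
    qed simp
  qed
  also have "\<dots> = ennreal (2 * C\<^sup>2) * (\<integral>\<^sup>+t. ennreal (r / 2 * exp (- (r / 2) * t)) * indicator {0..} t \<partial>lborel)"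
    by (intro nn_integral_cmult) measurable
  also have "\<dots> = ennreal (2 * C\<^sup>2) * ennreal (exp (- (r / 2) * 0))"
    using nn_integral_discount[of "r / 2" 0] r by simp
  also have "\<dots> < \<infinity>" by (simp add: ennreal_mult_less_top)
  finally show ?thesis .
qed

definition positive_square :: "real \<Rightarrow> ennreal" where
  "positive_square y = ennreal ((max 0 y)\<^sup>2)"

lemma positive_square: "mono positive_square" "continuous_on UNIV positive_square"
  unfolding positive_square_def mono_def
  by (auto intro!: ennreal_leI power_mono continuous_on_ennreal continuous_intros)

context levy_process
begin

lemma path_sup_measurable_F:
  assumes t: "0 \<le> t"
  shows "(\<lambda>\<omega>. path_sup (\<lambda>u. X u \<omega>) 0 t) \<in> borel_measurable (F t)"
proof (rule borel_measurable_LIMSEQ_metric)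
  show "(\<lambda>\<omega>. grid_max (\<lambda>u. X u \<omega>) 0 t n) \<in> borel_measurable (F t)" for n
    unfolding grid_max_def
  proof (rule borel_measurable_Max)
    fix k :: nat assume "k \<in> {..2 ^ n}"
    then have "0 + real k * ((t - 0) / 2 ^ n) \<in> {0..t}" using t by (intro grid_point_in) auto
    then show "(\<lambda>\<omega>. X (0 + real k * ((t - 0) / 2 ^ n)) \<omega>) \<in> borel_measurable (F t)"
      by (intro X_measurable_F) auto
  qed simp
  show "grid_max (\<lambda>u. X u \<omega>) 0 t \<longlonglongrightarrow> path_sup (\<lambda>u. X u \<omega>) 0 t" if "\<omega> \<in> space (F t)" for \<omega>
    using t that by (intro cadlag_grid_max_tendsto cadlag_paths) (auto simp: space_F)
qed

lemma reflection_measurable_F: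
  assumes t: "0 \<le> t"
  shows "(\<lambda>\<omega>. reflection (\<lambda>u. X u \<omega>) b t) \<in> borel_measurable (F t)"
proof -
  have "(\<lambda>\<omega>. max (path_sup (\<lambda>u. X u \<omega>) 0 t - b) 0) \<in> borel_measurable (F t)"
    by (intro borel_measurable_max borel_measurable_diff path_sup_measurable_F t measurable_const) auto
  also have "?this \<longleftrightarrow> ?thesis"
    using t by (intro measurable_cong) (simp add: reflection_eq cadlag_paths space_F)
  finally show ?thesis .
qed

lemma control_path_reflection_X: "\<omega> \<in> space M \<Longrightarrow> control_path (reflection (\<lambda>u. X u \<omega>) b)"
  by (intro control_path_reflection cadlag_paths)

lemma nn_integral_square_height:
  assumes s: "0 \<le> s"
  shows "(\<integral>\<^sup>+\<omega>. positive_square (path_sup (\<lambda>u. X u \<omega> - X s \<omega>) s (s + 1)) \<partial>M) =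
    dyadic_limit rise positive_square 1"
  using nn_integral_height[OF s zero_le_one positive_square, of "\<lambda>_. 1"]
  by (simp add: emeasure_space_1)

lemma later_height_measurable:
  assumes s: "0 \<le> s"
  shows "(\<lambda>\<omega>. path_sup (\<lambda>u. X u \<omega> - X s \<omega>) s (s + 1)) \<in> borel_measurable M"
proof (rule borel_measurable_LIMSEQ_metric)
  show "(\<lambda>\<omega>. grid_max (\<lambda>u. X u \<omega> - X s \<omega>) s (s + 1) n) \<in> borel_measurable M" for n
    using s by (intro grid_max_measurable borel_measurable_diff X_measurable) simp_all
  show "grid_max (\<lambda>u. X u \<omega> - X s \<omega>) s (s + 1) \<longlonglongrightarrow> path_sup (\<lambda>u. X u \<omega> - X s \<omega>) s (s + 1)" if "\<omega> \<in> space M" for \<omega>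
    using s that by (intro cadlag_grid_max_tendsto cadlag_minus cadlag_const cadlag_paths) simp_all
qed

lemma nn_integral_reflection_square:
  assumes m: "dyadic_limit rise positive_square 1 = m"
    and C: "(\<integral>\<^sup>+\<omega>. positive_square (X 0 \<omega> - b) \<partial>M) = C" and t: "0 \<le> t"
  shows "(\<integral>\<^sup>+\<omega>. ennreal ((reflection (\<lambda>u. X u \<omega>) b t)\<^sup>2) \<partial>M) \<le> ennreal ((t + 2)\<^sup>2) * (C + m)"
proof -
  define n where "n = nat \<lceil>t\<rceil>"
  have n: "t \<le> real n" "real n \<le> t + 1" using t by (auto simp: n_def)
  let ?H = "\<lambda>k \<omega>. path_sup (\<lambda>u. X u \<omega> - X (real k) \<omega>) (real k) (real k + 1)"
  have [measurable]: "positive_square \<in> borel_measurable borel"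
    using positive_square by (intro borel_measurable_continuous_onI)
  have [measurable]: "?H k \<in> borel_measurable M" for k by (intro later_height_measurable) simp
  have [measurable]: "X 0 \<in> borel_measurable M" by (intro X_measurable) simp
  have pointwise: "ennreal ((reflection (\<lambda>u. X u \<omega>) b t)\<^sup>2) \<le>
      ennreal (real (Suc n)) * (positive_square (X 0 \<omega> - b) + (\<Sum>k<n. positive_square (?H k \<omega>)))"
    if \<omega>: "\<omega> \<in> space M" for \<omega>
  proof -
    define g where "g k = (case k of 0 \<Rightarrow> max 0 (X 0 \<omega> - b) | Suc k \<Rightarrow> max 0 (?H k \<omega>))" for k
    have shift: "(\<Sum>k\<le>n. h (g k)) = h (max 0 (X 0 \<omega> - b)) + (\<Sum>k<n. h (max 0 (?H k \<omega>)))" for h :: "real \<Rightarrow> real"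
      by (subst sum.atMost_shift) (simp add: g_def)
    have "reflection (\<lambda>u. X u \<omega>) b t \<le> (\<Sum>k\<le>n. g k)"
      using reflection_le_heights[OF cadlag_paths[OF \<omega>] t n(1), of b] shift[of "\<lambda>x. x"] by simp
    then have "(reflection (\<lambda>u. X u \<omega>) b t)\<^sup>2 \<le> (\<Sum>k\<le>n. g k)\<^sup>2"
      using control_path_nonneg[OF control_path_reflection_X[OF \<omega>] t] by (intro power_mono) auto
    also have "\<dots> \<le> (\<Sum>k\<le>n. (g k)\<^sup>2) * real (card {..n})" by (rule sum_squared_le_sum_of_squares)
    also have "\<dots> = real (Suc n) * ((max 0 (X 0 \<omega> - b))\<^sup>2 + (\<Sum>k<n. (max 0 (?H k \<omega>))\<^sup>2))"
      by (simp only: shift[of "\<lambda>x. x\<^sup>2"] card_atMost mult.commute)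
    finally have "ennreal ((reflection (\<lambda>u. X u \<omega>) b t)\<^sup>2) \<le>
        ennreal (real (Suc n) * ((max 0 (X 0 \<omega> - b))\<^sup>2 + (\<Sum>k<n. (max 0 (?H k \<omega>))\<^sup>2)))"
      by (rule ennreal_leI)
    also have "\<dots> = ennreal (real (Suc n)) * (positive_square (X 0 \<omega> - b) + (\<Sum>k<n. positive_square (?H k \<omega>)))"
      unfolding positive_square_def
      by (subst sum_ennreal, simp, subst ennreal_plus[symmetric], simp, simp add: sum_nonneg,
          subst ennreal_mult[symmetric], simp, simp add: sum_nonneg, rule refl)
    finally show ?thesis .
  qed
  have "(\<integral>\<^sup>+\<omega>. ennreal ((reflection (\<lambda>u. X u \<omega>) b t)\<^sup>2) \<partial>M) \<le>
      (\<integral>\<^sup>+\<omega>. ennreal (real (Suc n)) * (positive_square (X 0 \<omega> - b) + (\<Sum>k<n. positive_square (?H k \<omega>))) \<partial>M)"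
    by (rule nn_integral_mono[OF pointwise])
  also have "\<dots> = ennreal (real (Suc n)) * ((\<integral>\<^sup>+\<omega>. positive_square (X 0 \<omega> - b) \<partial>M) +
      (\<Sum>k<n. \<integral>\<^sup>+\<omega>. positive_square (?H k \<omega>) \<partial>M))"
    by (subst nn_integral_cmult, measurable, subst nn_integral_add, measurable, subst nn_integral_sum, measurable)
  also have "\<dots> = ennreal (real (Suc n)) * (C + ennreal (real n) * m)"
    using nn_integral_square_height[of "real _"] by (simp add: C m ennreal_of_nat_eq_real_of_nat)
  also have "\<dots> \<le> ennreal (real (Suc n)) * (ennreal (real (Suc n)) * (C + m))"
  proof (rule mult_left_mono)
    have "1 \<le> ennreal (real (Suc n))" by simp
    then have "1 * C \<le> ennreal (real (Suc n)) * C" by (rule mult_right_mono) simp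
    moreover have "ennreal (real n) * m \<le> ennreal (real (Suc n)) * m"
      by (intro mult_right_mono ennreal_leI) simp_all
    ultimately show "C + ennreal (real n) * m \<le> ennreal (real (Suc n)) * (C + m)"
      unfolding distrib_left by (intro add_mono) simp_all
  qed simp
  also have "\<dots> = ennreal ((real (Suc n))\<^sup>2) * (C + m)"
    by (simp only: power2_eq_square ennreal_mult of_nat_0_le_iff mult.assoc)
  also have "\<dots> \<le> ennreal ((t + 2)\<^sup>2) * (C + m)"
    using n t by (intro mult_right_mono ennreal_leI power_mono) simp_all
  finally show ?thesis .
qed

text \<open>
  By Jensen's inequality for the exponential distribution, the squared discounted total of the
  barrier control is bounded by the discounted squares, whose means grow quadratically in time.
\<close>

lemma reflection_singular_control:
  assumes r: "0 < r"
    and m: "dyadic_limit rise positive_square 1 < \<infinity>"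
    and C: "(\<integral>\<^sup>+\<omega>. positive_square (X 0 \<omega> - b) \<partial>M) < \<infinity>"
  shows "(\<integral>\<^sup>+\<omega>. (\<integral>\<^sup>+t. ennreal (exp (- r * t)) \<partial>stieltjes_measure (reflection (\<lambda>u. X u \<omega>) b))\<^sup>2 \<partial>M) < \<infinity>"
proof -
  let ?\<theta> = "\<lambda>t \<omega>. reflection (\<lambda>u. X u \<omega>) b t"
  let ?E = "density lborel (exponential_density r)"
  let ?B = "(\<integral>\<^sup>+\<omega>. positive_square (X 0 \<omega> - b) \<partial>M) +
    dyadic_limit rise positive_square 1"
  define T where "T p = ?\<theta> (max 0 (fst p)) (snd p)" for p
  note integral_measurable = borel_measurable_nn_integral
  interpret pair_sigma_finite lborel M ..
  have T: "T \<in> borel_measurable (borel \<Otimes>\<^sub>M M)"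
    unfolding T_def
  proof (rule right_continuous_joint_measurable[where X="?\<theta>"])
    show "?\<theta> t \<in> borel_measurable M" if "0 \<le> t" for t
      by (rule F_measurable_M[OF that reflection_measurable_F[OF that]])
    show "continuous (at_right t) (\<lambda>t. ?\<theta> t \<omega>)" if "\<omega> \<in> space M" "0 \<le> t" for \<omega> t
      using control_path_reflection_X[OF that(1), of b] that(2) by (simp add: control_path_def cadlag_def)
  qed
  note [measurable] = T
  have Tt: "(\<lambda>t. T (t, \<omega>)) \<in> borel_measurable borel" if "\<omega> \<in> space M" for \<omega>
    using that by measurable
  have T0: "0 \<le> T (t, \<omega>)" if "\<omega> \<in> space M" for t \<omega>
    using control_path_nonneg[OF control_path_reflection_X[OF that, of b], of "max 0 t"] by (simp add: T_def)
  have "(\<integral>\<^sup>+\<omega>. (\<integral>\<^sup>+t. ennreal (exp (- r * t)) \<partial>stieltjes_measure (reflection (\<lambda>u. X u \<omega>) b))\<^sup>2 \<partial>M) \<le>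
      (\<integral>\<^sup>+\<omega>. (\<integral>\<^sup>+t. ennreal (r * exp (- r * t)) * ennreal ((T (t, \<omega>))\<^sup>2) * indicator {0..} t \<partial>lborel) \<partial>M)"
  proof (rule nn_integral_mono)
    fix \<omega> assume \<omega>: "\<omega> \<in> space M"
    note [measurable] = Tt[OF \<omega>]
    have ex: "(\<integral>\<^sup>+t. g t \<partial>?E) = (\<integral>\<^sup>+t. ennreal (r * exp (- r * t)) * g t * indicator {0..} t \<partial>lborel)"
      if "g \<in> borel_measurable borel" for g
      using that by (subst nn_integral_density)
        (auto intro!: nn_integral_cong simp: exponential_density_def indicator_def mult.commute)
    have "(\<integral>\<^sup>+t. ennreal (exp (- r * t)) \<partial>stieltjes_measure (reflection (\<lambda>u. X u \<omega>) b)) =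
        (\<integral>\<^sup>+t. ennreal (r * exp (- r * t)) * ennreal (T (t, \<omega>)) * indicator {0..} t \<partial>lborel)"
      unfolding discounted_control_eq[OF control_path_reflection_X[OF \<omega>] r]
      by (intro nn_integral_cong) (simp add: T_def indicator_def)
    also have "\<dots> = (\<integral>\<^sup>+t. ennreal \<bar>T (t, \<omega>)\<bar> \<partial>?E)"
      using T0[OF \<omega>] by (subst ex) simp_all
    also have "\<dots>\<^sup>2 \<le> (\<integral>\<^sup>+t. ennreal (\<bar>T (t, \<omega>)\<bar>\<^sup>2) \<partial>?E)"
      by (rule nn_integral_power2_le[OF prob_space_exponential_density[OF r]]) simp_all
    also have "\<dots> = (\<integral>\<^sup>+t. ennreal (r * exp (- r * t)) * ennreal ((T (t, \<omega>))\<^sup>2) * indicator {0..} t \<partial>lborel)"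
      by (subst ex) simp_all
    finally show "(\<integral>\<^sup>+t. ennreal (exp (- r * t)) \<partial>stieltjes_measure (reflection (\<lambda>u. X u \<omega>) b))\<^sup>2 \<le>
        (\<integral>\<^sup>+t. ennreal (r * exp (- r * t)) * ennreal ((T (t, \<omega>))\<^sup>2) * indicator {0..} t \<partial>lborel)"
      .
  qed
  also have "\<dots> = (\<integral>\<^sup>+t. (\<integral>\<^sup>+\<omega>. ennreal (r * exp (- r * t)) * ennreal ((T (t, \<omega>))\<^sup>2) * indicator {0..} t \<partial>M) \<partial>lborel)"
    by (rule Fubini') measurable
  also have "\<dots> \<le> (\<integral>\<^sup>+t. (ennreal (r * exp (- r * t)) * ennreal ((t + 2)\<^sup>2) * indicator {0..} t) * ?B \<partial>lborel)"
  proof (rule nn_integral_mono)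
    fix t :: real
    show "(\<integral>\<^sup>+\<omega>. ennreal (r * exp (- r * t)) * ennreal ((T (t, \<omega>))\<^sup>2) * indicator {0..} t \<partial>M) \<le>
        (ennreal (r * exp (- r * t)) * ennreal ((t + 2)\<^sup>2) * indicator {0..} t) * ?B"
    proof (cases "0 \<le> t")
      case True
      have meas: "(\<lambda>\<omega>. ennreal ((?\<theta> t \<omega>)\<^sup>2)) \<in> borel_measurable M"
        using F_measurable_M[OF True reflection_measurable_F[OF True, of b]] by measurable
      have "(\<integral>\<^sup>+\<omega>. ennreal (r * exp (- r * t)) * ennreal ((T (t, \<omega>))\<^sup>2) * indicator {0..} t \<partial>M) =
          ennreal (r * exp (- r * t)) * (\<integral>\<^sup>+\<omega>. ennreal ((?\<theta> t \<omega>)\<^sup>2) \<partial>M)"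
        using True by (subst nn_integral_cmult[OF meas, symmetric]) (simp add: T_def)
      also have "\<dots> \<le> ennreal (r * exp (- r * t)) * (ennreal ((t + 2)\<^sup>2) * ?B)"
        by (intro mult_left_mono nn_integral_reflection_square refl True) simp
      finally show ?thesis using True by (simp add: mult.assoc)
    qed simp
  qed
  also have "\<dots> = (\<integral>\<^sup>+t. ennreal (r * exp (- r * t)) * ennreal ((t + 2)\<^sup>2) * indicator {0..} t \<partial>lborel) * ?B"
    by (intro nn_integral_multc) measurable
  also have "\<dots> < \<infinity>"
    using nn_integral_discounted_square[OF r] m C by (simp add: ennreal_mult_less_top)
  finally show ?thesis .
qed

end

section \<open>Optimality of the barrier control\<close>

lemma tangent_below:
  assumes "\<And>x. (c has_real_derivative c' x) (at x)" "mono c'"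
  shows "c y + c' y * (z - y) \<le> c (z :: real)"
proof (rule linorder_cases[of y z])
  assume "y < z"
  then obtain x where x: "y < x" "c z - c y = (z - y) * c' x"
    using MVT2[of y z c c'] assms(1) by blast
  have "(z - y) * c' y \<le> (z - y) * c' x"
    using x(1) \<open>y < z\<close> monoD[OF assms(2), of y x] by (intro mult_left_mono) simp_all
  then show ?thesis using x(2) by (simp add: mult.commute)
next
  assume "z < y"
  then obtain x where x: "x < y" "c y - c z = (y - z) * c' x"
    using MVT2[of z y c c'] assms(1) by blast
  have "(y - z) * c' x \<le> (y - z) * c' y"
    using x(1) \<open>z < y\<close> monoD[OF assms(2), of x y] by (intro mult_left_mono) simp_all
  then show ?thesis using x(2) by (simp add: algebra_simps)
qed simp

text \<open>
  The shift \<open>m\<close> is a bound with \<open>- m \<le> c\<close>. It makes the running cost nonnegative and changes its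
  discounted integral by the constant \<open>m / r\<close> only.
\<close>

definition shifted_cost :: "(real \<Rightarrow> real) \<Rightarrow> real \<Rightarrow> real \<Rightarrow> (real \<Rightarrow> real) \<Rightarrow> ennreal" where
  "shifted_cost c m r f = (\<integral>\<^sup>+t. ennreal ((c (f t) + m) * exp (- r * t)) * indicator {0..} t \<partial>lborel)"

definition discounted_total :: "real \<Rightarrow> (real \<Rightarrow> real) \<Rightarrow> ennreal" where
  "discounted_total r f = (\<integral>\<^sup>+s. ennreal (exp (- r * s)) \<partial>stieltjes_measure f)"

text \<open>
  The amount by which the slope at distance \<open>y\<close> below the barrier falls short of the slope at the
  barrier. It is monotone in \<open>y\<close> and positive only below the barrier.
\<close>

definition slope_gap :: "(real \<Rightarrow> real) \<Rightarrow> real \<Rightarrow> real \<Rightarrow> ennreal" where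
  "slope_gap c' b y = ennreal (c' b - c' (b - y))"

text \<open>
  The argument \<open>b + reflection f b t - f t\<close> is the distance of the reflected path below the barrier.
\<close>

definition gap_integral :: "(real \<Rightarrow> real) \<Rightarrow> real \<Rightarrow> real \<Rightarrow> (real \<Rightarrow> real) \<Rightarrow> (real \<Rightarrow> real) \<Rightarrow> ennreal" where
  "gap_integral c' b r f \<theta> = (\<integral>\<^sup>+t. ennreal (exp (- r * t)) * slope_gap c' b (b + reflection f b t - f t) *
     ennreal (\<theta> t) * indicator {0..} t \<partial>lborel)"

lemma slope_gap:
  assumes "mono c'" "continuous_on UNIV c'"
  shows "mono (slope_gap c' b)" "continuous_on UNIV (slope_gap c' b)"
proof -
  show "mono (slope_gap c' b)"
    unfolding slope_gap_def by (intro monoI ennreal_leI diff_left_mono monoD[OF assms(1)]) simp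
  show "continuous_on UNIV (slope_gap c' b)"
    unfolding slope_gap_def
    by (intro continuous_on_ennreal continuous_intros continuous_on_compose2[OF assms(2)]) simp_all
qed

lemma cadlag_measurable:
  assumes f: "cadlag f"
  shows "(\<lambda>t. f (max 0 t)) \<in> borel_measurable borel"
proof -
  have 1: "(\<lambda>p. f (max 0 (fst p))) \<in> borel_measurable (borel \<Otimes>\<^sub>M count_space (UNIV :: unit set))"
    using right_continuous_joint_measurable[where M="count_space (UNIV :: unit set)" and X="\<lambda>t _. f t"] f
    by (simp add: cadlag_def)
  have 2: "(\<lambda>t :: real. (t, ())) \<in> measurable borel (borel \<Otimes>\<^sub>M count_space UNIV)" by measurable
  show ?thesis using measurable_compose[OF 2 1] by simp
qed

text \<open>
  Convexity gives the tangent at the reflected path as a lower bound for the cost of any other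
  path. The slope there is \<open>c' b\<close> minus the slope gap, which turns the bound into an inequality
  between nonnegative quantities.
\<close>

lemma pathwise_comparison:
  assumes r: "0 < r" and deriv: "\<And>x. (c has_real_derivative c' x) (at x)"
    and c': "mono c'" "continuous_on UNIV c'" "0 \<le> c' b" and m: "\<And>x. - m \<le> c x"
    and f: "cadlag f" and \<theta>: "control_path \<theta>"
  defines "\<rho> \<equiv> reflection f b"
  shows "shifted_cost c m r (\<lambda>t. f t - \<rho> t) + ennreal (c' b / r) * discounted_total r \<rho> + gap_integral c' b r f \<theta>
    \<le> shifted_cost c m r (\<lambda>t. f t - \<theta> t) + ennreal (c' b / r) * discounted_total r \<theta> + gap_integral c' b r f \<rho>"
proof -
  have \<rho>: "control_path \<rho>" unfolding \<rho>_def by (rule control_path_reflection[OF f])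
  have [measurable]: "(\<lambda>t. f (max 0 t)) \<in> borel_measurable borel"
    "(\<lambda>t. \<theta> (max 0 t)) \<in> borel_measurable borel" "(\<lambda>t. \<rho> (max 0 t)) \<in> borel_measurable borel"
    using f \<theta> \<rho> by (auto intro: cadlag_measurable simp: control_path_def)
  have [measurable]: "slope_gap c' b \<in> borel_measurable borel" "c \<in> borel_measurable borel"
    using slope_gap[OF c'(1,2)] deriv
    by (auto intro!: borel_measurable_continuous_onI DERIV_continuous_on)
  let ?A = "\<lambda>\<eta> t. ennreal ((c (f (max 0 t) - \<eta> (max 0 t)) + m) * exp (- r * t)) * indicator {0..} t"
  let ?B = "\<lambda>\<eta> t. ennreal (c' b * exp (- r * t)) * ennreal (\<eta> (max 0 t)) * indicator {0..} t"
  let ?C = "\<lambda>\<eta> t. ennreal (exp (- r * t)) * slope_gap c' b (b + \<rho> (max 0 t) - f (max 0 t)) *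
      ennreal (\<eta> (max 0 t)) * indicator {0..} t"
  have A: "shifted_cost c m r (\<lambda>t. f t - \<eta> t) = (\<integral>\<^sup>+t. ?A \<eta> t \<partial>lborel)" for \<eta>
    unfolding shifted_cost_def by (intro nn_integral_cong) (simp add: indicator_def)
  have C: "gap_integral c' b r f \<eta> = (\<integral>\<^sup>+t. ?C \<eta> t \<partial>lborel)" for \<eta>
    unfolding gap_integral_def \<rho>_def by (intro nn_integral_cong) (simp add: indicator_def)
  have B: "ennreal (c' b / r) * discounted_total r \<eta> = (\<integral>\<^sup>+t. ?B \<eta> t \<partial>lborel)"
    if \<eta>: "control_path \<eta>" for \<eta>
  proof -
    have [measurable]: "(\<lambda>t. \<eta> (max 0 t)) \<in> borel_measurable borel"
      using \<eta> by (intro cadlag_measurable) (simp add: control_path_def)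
    have "discounted_total r \<eta> =
        (\<integral>\<^sup>+t. ennreal (r * exp (- r * t)) * ennreal (\<eta> (max 0 t)) * indicator {0..} t \<partial>lborel)"
      unfolding discounted_total_def discounted_control_eq[OF \<eta> r]
      by (intro nn_integral_cong) (simp add: indicator_def)
    then have "ennreal (c' b / r) * discounted_total r \<eta> =
        (\<integral>\<^sup>+t. ennreal (c' b / r) * (ennreal (r * exp (- r * t)) * ennreal (\<eta> (max 0 t)) * indicator {0..} t) \<partial>lborel)"
      by (simp add: nn_integral_cmult)
    also have "\<dots> = (\<integral>\<^sup>+t. ?B \<eta> t \<partial>lborel)"
    proof (intro nn_integral_cong)
      fix t
      have "ennreal (c' b / r) * ennreal (r * exp (- r * t)) = ennreal (c' b * exp (- r * t))"
        using r c'(3) by (simp add: ennreal_mult[symmetric])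
      then show "ennreal (c' b / r) * (ennreal (r * exp (- r * t)) * ennreal (\<eta> (max 0 t)) * indicator {0..} t) = ?B \<eta> t"
        by (simp only: mult.assoc[symmetric])
    qed
    finally show ?thesis .
  qed
  have "shifted_cost c m r (\<lambda>t. f t - \<rho> t) + ennreal (c' b / r) * discounted_total r \<rho> + gap_integral c' b r f \<theta> =
      (\<integral>\<^sup>+t. ?A \<rho> t + ?B \<rho> t + ?C \<theta> t \<partial>lborel)"
    unfolding A B[OF \<rho>] C by (subst nn_integral_add, measurable, subst nn_integral_add, measurable)
  also have "\<dots> \<le> (\<integral>\<^sup>+t. ?A \<theta> t + ?B \<theta> t + ?C \<rho> t \<partial>lborel)"
  proof (rule nn_integral_mono)
    fix t :: real
    show "?A \<rho> t + ?B \<rho> t + ?C \<theta> t \<le> ?A \<theta> t + ?B \<theta> t + ?C \<rho> t"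
    proof (cases "0 \<le> t")
      case True
      define e where "e = exp (- r * t)"
      define y where "y = f t - \<rho> t"
      define q where "q = c' b - c' y"
      have e: "0 \<le> e" by (simp add: e_def)
      have nn: "0 \<le> \<theta> t" "0 \<le> \<rho> t" using control_path_nonneg[OF \<theta> True] control_path_nonneg[OF \<rho> True] .
      have "y \<le> b"
        using reflection_eq[OF f True, of b] path_sup_upper[OF f, of 0 t t] True
        by (simp add: y_def \<rho>_def)
      then have q: "0 \<le> q" using monoD[OF c'(1)] by (simp add: q_def)
      have gap: "slope_gap c' b (b + \<rho> t - f t) = ennreal q"
        by (simp add: slope_gap_def q_def y_def algebra_simps)
      have "c y + c' y * ((f t - \<theta> t) - y) \<le> c (f t - \<theta> t)" by (rule tangent_below[OF deriv c'(1)])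
      moreover have "c' y * ((f t - \<theta> t) - y) = c' b * \<rho> t - c' b * \<theta> t - q * \<rho> t + q * \<theta> t"
        by (simp add: q_def y_def algebra_simps)
      ultimately have "(c y + m) + c' b * \<rho> t + q * \<theta> t \<le> (c (f t - \<theta> t) + m) + c' b * \<theta> t + q * \<rho> t"
        by linarith
      then have "((c y + m) + c' b * \<rho> t + q * \<theta> t) * e \<le> ((c (f t - \<theta> t) + m) + c' b * \<theta> t + q * \<rho> t) * e"
        using e by (rule mult_right_mono)
      then have "ennreal ((c y + m) * e + c' b * e * \<rho> t + e * q * \<theta> t) \<le>
          ennreal ((c (f t - \<theta> t) + m) * e + c' b * e * \<theta> t + e * q * \<rho> t)"
        by (intro ennreal_leI) (simp add: algebra_simps)
      moreover have "ennreal ((c z + m) * e + c' b * e * u + e * q * v) =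
          ennreal ((c z + m) * e) + ennreal (c' b * e) * ennreal u + ennreal e * ennreal q * ennreal v"
        if "0 \<le> u" "0 \<le> v" for z u v
        using that m[of z] e q c'(3) by (simp add: ennreal_mult ennreal_plus)
      moreover have "exp (- (r * t)) = e" by (simp add: e_def)
      ultimately show ?thesis using True nn by (simp add: gap y_def)
    qed simp
  qed
  also have "\<dots> = shifted_cost c m r (\<lambda>t. f t - \<theta> t) + ennreal (c' b / r) * discounted_total r \<theta> + gap_integral c' b r f \<rho>"
    unfolding A B[OF \<theta>] C by (subst nn_integral_add, measurable, subst nn_integral_add, measurable)
  finally show ?thesis .
qed

context levy_process
begin

lemma adapted_joint_measurable:
  assumes \<theta>: "adapted F \<theta>" "\<And>\<omega>. \<omega> \<in> space M \<Longrightarrow> cadlag (\<lambda>t. \<theta> t \<omega>)"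
  shows "(\<lambda>p. \<theta> (max 0 (snd p)) (fst p)) \<in> borel_measurable (M \<Otimes>\<^sub>M lborel)"
proof -
  have 1: "(\<lambda>p. \<theta> (max 0 (fst p)) (snd p)) \<in> borel_measurable (borel \<Otimes>\<^sub>M M)"
  proof (rule right_continuous_joint_measurable)
    show "\<theta> t \<in> borel_measurable M" if "0 \<le> t" for t
      using \<theta>(1) that by (intro F_measurable_M[OF that]) (simp add: adapted_def)
    show "continuous (at_right t) (\<lambda>t. \<theta> t \<omega>)" if "\<omega> \<in> space M" "0 \<le> t" for \<omega> t
      using \<theta>(2)[OF that(1)] that(2) by (simp add: cadlag_def)
  qed
  have 2: "(\<lambda>p. (snd p, fst p)) \<in> measurable (M \<Otimes>\<^sub>M lborel) (borel \<Otimes>\<^sub>M M)" by measurable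
  show ?thesis using measurable_compose[OF 2 1] by simp
qed

lemma nonneg_time_integral_measurable:
  fixes h :: "'a \<Rightarrow> real \<Rightarrow> ennreal"
  assumes "(\<lambda>(\<omega>, t). h \<omega> (max 0 t)) \<in> borel_measurable (M \<Otimes>\<^sub>M lborel)"
  shows "(\<lambda>\<omega>. \<integral>\<^sup>+t. h \<omega> t * indicator {0..} t \<partial>lborel) \<in> borel_measurable M"
proof -
  have "(\<lambda>(\<omega>, t). h \<omega> (max 0 t) * indicator {0..} t) \<in> borel_measurable (M \<Otimes>\<^sub>M lborel)"
    using assms unfolding case_prod_beta'
    by (intro borel_measurable_times_ennreal measurable_compose[OF measurable_snd borel_measurable_indicator]) simp_all
  from lborel.borel_measurable_nn_integral[OF this]
  have "(\<lambda>\<omega>. \<integral>\<^sup>+t. h \<omega> (max 0 t) * indicator {0..} t \<partial>lborel) \<in> borel_measurable M" .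
  also have "(\<lambda>\<omega>. \<integral>\<^sup>+t. h \<omega> (max 0 t) * indicator {0..} t \<partial>lborel) =
      (\<lambda>\<omega>. \<integral>\<^sup>+t. h \<omega> t * indicator {0..} t \<partial>lborel)"
    by (intro ext nn_integral_cong) (simp add: indicator_def)
  finally show ?thesis .
qed

lemma shifted_cost_measurable:
  assumes \<theta>: "adapted F \<theta>" "\<And>\<omega>. \<omega> \<in> space M \<Longrightarrow> cadlag (\<lambda>t. \<theta> t \<omega>)"
    and [measurable]: "c \<in> borel_measurable borel"
  shows "(\<lambda>\<omega>. shifted_cost c m r (\<lambda>t. X t \<omega> - \<theta> t \<omega>)) \<in> borel_measurable M"
proof -
  note [measurable] = adapted_joint_measurable[OF \<theta>] adapted_joint_measurable[OF adapted_X cadlag_paths]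
  have "(\<lambda>(\<omega>, t). ennreal ((c (X (max 0 t) \<omega> - \<theta> (max 0 t) \<omega>) + m) * exp (- r * max 0 t)))
      \<in> borel_measurable (M \<Otimes>\<^sub>M lborel)"
    unfolding case_prod_beta' by measurable
  from nonneg_time_integral_measurable[OF this] show ?thesis unfolding shifted_cost_def .
qed

lemma discounted_total_measurable:
  assumes r: "0 < r" and \<theta>: "adapted F \<theta>" "\<And>\<omega>. \<omega> \<in> space M \<Longrightarrow> control_path (\<lambda>t. \<theta> t \<omega>)"
  shows "(\<lambda>\<omega>. discounted_total r (\<lambda>t. \<theta> t \<omega>)) \<in> borel_measurable M"
proof -
  have "cadlag (\<lambda>t. \<theta> t \<omega>)" if "\<omega> \<in> space M" for \<omega> using \<theta>(2)[OF that] by (simp add: control_path_def)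
  note [measurable] = adapted_joint_measurable[OF \<theta>(1) this]
  have "(\<lambda>(\<omega>, t). ennreal (r * exp (- r * max 0 t)) * ennreal (\<theta> (max 0 t) \<omega>)) \<in> borel_measurable (M \<Otimes>\<^sub>M lborel)"
    unfolding case_prod_beta' by measurable
  from nonneg_time_integral_measurable[OF this]
  have "(\<lambda>\<omega>. \<integral>\<^sup>+t. ennreal (r * exp (- r * t)) * ennreal (\<theta> t \<omega>) * indicator {0..} t \<partial>lborel)
      \<in> borel_measurable M" .
  also have "?this \<longleftrightarrow> ?thesis"
    unfolding discounted_total_def
    by (intro measurable_cong discounted_control_eq[symmetric] \<theta>(2) r)
  finally show ?thesis .
qed

lemma adapted_reflection: "adapted F (\<lambda>t \<omega>. reflection (\<lambda>u. X u \<omega>) b t)"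
  unfolding adapted_def using reflection_measurable_F by blast

lemma gap_integral_measurable:
  assumes c': "mono c'" "continuous_on UNIV c'"
    and \<theta>: "adapted F \<theta>" "\<And>\<omega>. \<omega> \<in> space M \<Longrightarrow> cadlag (\<lambda>t. \<theta> t \<omega>)"
  shows "(\<lambda>\<omega>. gap_integral c' b r (\<lambda>t. X t \<omega>) (\<lambda>t. \<theta> t \<omega>)) \<in> borel_measurable M"
proof -
  have [measurable]: "slope_gap c' b \<in> borel_measurable borel"
    using slope_gap[OF c'] by (intro borel_measurable_continuous_onI)
  have "cadlag (reflection (\<lambda>u. X u \<omega>) b)" if "\<omega> \<in> space M" for \<omega>
    using control_path_reflection_X[OF that] by (simp add: control_path_def)
  note [measurable] = adapted_joint_measurable[OF \<theta>] adapted_joint_measurable[OF adapted_X cadlag_paths]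
    adapted_joint_measurable[OF adapted_reflection this]
  have "(\<lambda>(\<omega>, t). ennreal (exp (- r * max 0 t)) *
      slope_gap c' b (b + reflection (\<lambda>u. X u \<omega>) b (max 0 t) - X (max 0 t) \<omega>) *
      ennreal (\<theta> (max 0 t) \<omega>)) \<in> borel_measurable (M \<Otimes>\<^sub>M lborel)"
    unfolding case_prod_beta' by measurable
  from nonneg_time_integral_measurable[OF this] show ?thesis unfolding gap_integral_def .
qed

text \<open>
  The pathwise comparison is integrated. The means of the gap integrals are known from the
  marginal cost of control, as an inequality for \<open>\<theta>\<close> and as an equality for the reflection; since
  \<open>c' b / r = K + L\<close>, all terms with the factor \<open>L\<close> cancel. They are finite because both controls have
  finite discounted mean.
\<close>

lemma reflection_optimal:
  assumes r: "0 < r" and K: "0 \<le> K" and deriv: "\<And>x. (c has_real_derivative c' x) (at x)"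
    and c': "mono c'" "continuous_on UNIV c'" and m: "\<And>x. - m \<le> c x"
    and K_le: "r * K \<le> c' b" and depth: "discounted_depth (slope_gap c' b) r = ennreal (c' b / r - K)"
    and \<theta>: "adapted F \<theta>" "\<And>\<omega>. \<omega> \<in> space M \<Longrightarrow> control_path (\<lambda>t. \<theta> t \<omega>)"
    and finite_\<theta>: "(\<integral>\<^sup>+\<omega>. discounted_total r (\<lambda>t. \<theta> t \<omega>) \<partial>M) < \<infinity>"
    and finite_\<rho>: "(\<integral>\<^sup>+\<omega>. discounted_total r (reflection (\<lambda>u. X u \<omega>) b) \<partial>M) < \<infinity>"
  shows "(\<integral>\<^sup>+\<omega>. shifted_cost c m r (\<lambda>t. X t \<omega> - reflection (\<lambda>u. X u \<omega>) b t) +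
      ennreal K * discounted_total r (reflection (\<lambda>u. X u \<omega>) b) \<partial>M) \<le>
    (\<integral>\<^sup>+\<omega>. shifted_cost c m r (\<lambda>t. X t \<omega> - \<theta> t \<omega>) + ennreal K * discounted_total r (\<lambda>t. \<theta> t \<omega>) \<partial>M)"
proof -
  let ?\<rho> = "\<lambda>t \<omega>. reflection (\<lambda>u. X u \<omega>) b t"
  let ?\<phi> = "slope_gap c' b"
  define L where "L = ennreal (c' b / r - K)"
  have gap: "ennreal (c' b / r) = ennreal K + L"
    unfolding L_def using r K K_le by (subst ennreal_plus[symmetric]) (simp_all add: field_simps)
  have "0 \<le> r * K" using r K by simp
  then have c'b: "0 \<le> c' b" using K_le by linarith
  have \<phi>: "mono ?\<phi>" "continuous_on UNIV ?\<phi>" using slope_gap[OF c'] by simp_all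
  have \<phi>m: "?\<phi> \<in> borel_measurable borel" using \<phi>(2) by (rule borel_measurable_continuous_onI)
  have cm: "c \<in> borel_measurable borel"
    using deriv by (intro borel_measurable_continuous_onI DERIV_continuous_on)
  have \<rho>: "adapted F ?\<rho>" "\<And>\<omega>. \<omega> \<in> space M \<Longrightarrow> control_path (\<lambda>t. ?\<rho> t \<omega>)"
    using adapted_reflection control_path_reflection_X by simp_all
  have cad: "\<And>\<omega>. \<omega> \<in> space M \<Longrightarrow> cadlag (\<lambda>t. \<theta> t \<omega>)" "\<And>\<omega>. \<omega> \<in> space M \<Longrightarrow> cadlag (\<lambda>t. ?\<rho> t \<omega>)"
    using \<theta>(2) \<rho>(2) by (simp_all add: control_path_def)
  note [measurable] = shifted_cost_measurable[OF \<theta>(1) cad(1) cm, of m r]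
    shifted_cost_measurable[OF \<rho>(1) cad(2) cm, of m r]
    discounted_total_measurable[OF r \<theta>] discounted_total_measurable[OF r \<rho>]
    gap_integral_measurable[OF c' \<theta>(1) cad(1), of b r] gap_integral_measurable[OF c' \<rho>(1) cad(2), of b r]
  let ?A = "\<lambda>\<theta>. \<integral>\<^sup>+\<omega>. shifted_cost c m r (\<lambda>t. X t \<omega> - \<theta> t \<omega>) \<partial>M"
  let ?B = "\<lambda>\<theta>. \<integral>\<^sup>+\<omega>. discounted_total r (\<lambda>t. \<theta> t \<omega>) \<partial>M"
  let ?C = "\<lambda>\<theta>. \<integral>\<^sup>+\<omega>. gap_integral c' b r (\<lambda>t. X t \<omega>) (\<lambda>t. \<theta> t \<omega>) \<partial>M"
  have C\<theta>: "L * ?B \<theta> \<le> ?C \<theta>"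
  proof -
    have "L * ?B \<theta> = (\<integral>\<^sup>+\<omega>. (\<integral>\<^sup>+s. future_drawdown ?\<phi> r (\<lambda>u. X u \<omega>) s \<partial>stieltjes_measure (\<lambda>t. \<theta> t \<omega>)) \<partial>M)"
      using nn_integral_future_drawdown_control[OF \<phi> less_imp_le[OF r] \<theta>] by (simp add: depth L_def discounted_total_def)
    also have "\<dots> \<le> ?C \<theta>"
      unfolding gap_integral_def
      by (intro nn_integral_mono future_drawdown_le cadlag_paths \<phi>(1) \<phi>m \<theta>(2))
    finally show ?thesis .
  qed
  have C\<rho>: "L * ?B ?\<rho> = ?C ?\<rho>"
  proof -
    have "L * ?B ?\<rho> = (\<integral>\<^sup>+\<omega>. (\<integral>\<^sup>+s. future_drawdown ?\<phi> r (\<lambda>u. X u \<omega>) s \<partial>stieltjes_measure (\<lambda>t. ?\<rho> t \<omega>)) \<partial>M)"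
      using nn_integral_future_drawdown_control[OF \<phi> less_imp_le[OF r] \<rho>] by (simp add: depth L_def discounted_total_def)
    also have "\<dots> = ?C ?\<rho>"
      unfolding gap_integral_def
      by (intro nn_integral_cong future_drawdown_reflection cadlag_paths \<phi>(1) \<phi>m)
    finally show ?thesis .
  qed
  have "(\<integral>\<^sup>+\<omega>. shifted_cost c m r (\<lambda>t. X t \<omega> - ?\<rho> t \<omega>) + ennreal (c' b / r) * discounted_total r (\<lambda>t. ?\<rho> t \<omega>) +
      gap_integral c' b r (\<lambda>t. X t \<omega>) (\<lambda>t. \<theta> t \<omega>) \<partial>M) \<le>
    (\<integral>\<^sup>+\<omega>. shifted_cost c m r (\<lambda>t. X t \<omega> - \<theta> t \<omega>) + ennreal (c' b / r) * discounted_total r (\<lambda>t. \<theta> t \<omega>) +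
      gap_integral c' b r (\<lambda>t. X t \<omega>) (\<lambda>t. ?\<rho> t \<omega>) \<partial>M)"
    by (intro nn_integral_mono pathwise_comparison r deriv c' c'b m cadlag_paths \<theta>(2))
  then have "?A ?\<rho> + ennreal (c' b / r) * ?B ?\<rho> + ?C \<theta> \<le> ?A \<theta> + ennreal (c' b / r) * ?B \<theta> + ?C ?\<rho>"
    by (simp add: nn_integral_add nn_integral_cmult)
  moreover have "?A ?\<rho> + ennreal (c' b / r) * ?B ?\<rho> + L * ?B \<theta> \<le> ?A ?\<rho> + ennreal (c' b / r) * ?B ?\<rho> + ?C \<theta>"
    by (intro add_left_mono C\<theta>)
  ultimately have "?A ?\<rho> + ennreal (c' b / r) * ?B ?\<rho> + L * ?B \<theta> \<le> ?A \<theta> + ennreal (c' b / r) * ?B \<theta> + L * ?B ?\<rho>"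
    unfolding C\<rho> by (rule order.trans[rotated])
  then have "(L * ?B \<theta> + L * ?B ?\<rho>) + (?A ?\<rho> + ennreal K * ?B ?\<rho>) \<le> (L * ?B \<theta> + L * ?B ?\<rho>) + (?A \<theta> + ennreal K * ?B \<theta>)"
    unfolding gap by (simp add: distrib_right ac_simps)
  moreover have "L * ?B \<theta> + L * ?B ?\<rho> \<noteq> \<infinity>"
    using finite_\<theta> finite_\<rho> by (simp add: L_def ennreal_mult_eq_top_iff less_top)
  ultimately have "?A ?\<rho> + ennreal K * ?B ?\<rho> \<le> ?A \<theta> + ennreal K * ?B \<theta>"
    by (simp add: ennreal_add_left_cancel_le)
  then show ?thesis by (simp add: nn_integral_add nn_integral_cmult)
qed

end

section \<open>Costs as integrals of nonnegative functions\<close>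

text \<open>
  Adding an integrable \<open>h\<close> that dominates the negative part reduces the extended integral to one
  of a nonnegative function, for which additivity and comparison hold in \<^typ>\<open>ennreal\<close>.
\<close>

lemma ext_integral_shift:
  assumes [measurable]: "g \<in> borel_measurable M" "h \<in> borel_measurable M"
    and h: "\<And>x. x \<in> space M \<Longrightarrow> 0 \<le> h x" "(\<integral>\<^sup>+x. ennreal (h x) \<partial>M) < \<infinity>"
    and f: "\<And>x. x \<in> space M \<Longrightarrow> f x = enn2ereal (g x) - ereal (h x)"
  shows "ext_integral M f = enn2ereal (\<integral>\<^sup>+x. g x \<partial>M) - enn2ereal (\<integral>\<^sup>+x. ennreal (h x) \<partial>M)"
proof -
  let ?P = "\<integral>\<^sup>+x. e2ennreal (f x) \<partial>M" and ?N = "\<integral>\<^sup>+x. e2ennreal (- f x) \<partial>M"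
  let ?G = "\<integral>\<^sup>+x. g x \<partial>M" and ?H = "\<integral>\<^sup>+x. ennreal (h x) \<partial>M"
  have "(\<lambda>x. enn2ereal (g x) - ereal (h x)) \<in> borel_measurable M" by measurable
  also have "?this \<longleftrightarrow> f \<in> borel_measurable M" using f by (intro measurable_cong) simp
  finally have [measurable]: "f \<in> borel_measurable M" .
  have pointwise: "e2ennreal (f x) + ennreal (h x) = g x + e2ennreal (- f x) \<and> e2ennreal (- f x) \<le> ennreal (h x)"
    if x: "x \<in> space M" for x
  proof (cases "g x")
    case (real a)
    then have fx: "f x = ereal (a - h x)" using f[OF x] by simp
    show ?thesis
    proof (cases "h x \<le> a")
      case True
      then have "ennreal (a - h x) + ennreal (h x) = ennreal a"
        using h(1)[OF x] by (subst ennreal_plus[symmetric]) simp_all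
      then show ?thesis using True real fx by (simp add: ennreal_neg)
    next
      case False
      then have "ennreal a + ennreal (h x - a) = ennreal (h x)"
        using real(1) by (subst ennreal_plus[symmetric]) simp_all
      then show ?thesis using False real fx by (simp add: ennreal_neg ennreal_leI)
    qed
  next
    case top
    then show ?thesis using f[OF x] by (simp add: e2ennreal_neg)
  qed
  have "?P + ?H = (\<integral>\<^sup>+x. e2ennreal (f x) + ennreal (h x) \<partial>M)"
    by (intro nn_integral_add[symmetric]) measurable
  also have "\<dots> = (\<integral>\<^sup>+x. g x + e2ennreal (- f x) \<partial>M)"
    using pointwise by (intro nn_integral_cong) simp
  also have "\<dots> = ?G + ?N" by (intro nn_integral_add) measurable
  finally have eq: "?P + ?H = ?G + ?N" .
  have "?N \<le> ?H" using pointwise by (intro nn_integral_mono) simp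
  then have "?N < \<infinity>" using h(2) by simp
  have "enn2ereal P - enn2ereal N = enn2ereal G - enn2ereal H"
    if "P + H = G + N" "N < \<infinity>" "H < \<infinity>" for P N G H
    using that by (cases P; cases N; cases G; cases H)
      (auto simp: ennreal_plus[symmetric] ennreal_inj simp del: ennreal_plus)
  from this[OF eq \<open>?N < \<infinity>\<close> h(2)] show ?thesis unfolding ext_integral_def .
qed

lemma running_cost_eq:
  assumes r: "0 < r" and m: "0 \<le> m" "\<And>x. - m \<le> c x" and [measurable]: "c \<in> borel_measurable borel"
    and f: "cadlag f"
  shows "running_cost c r f = enn2ereal (shifted_cost c m r f) - ereal (m / r)"
proof -
  let ?L = "restrict_space lborel {0::real..}"
  have [measurable]: "(\<lambda>t. f (max 0 t)) \<in> borel_measurable borel" by (rule cadlag_measurable[OF f])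
  have restrict: "(\<integral>\<^sup>+t. g t \<partial>?L) = (\<integral>\<^sup>+t. g t * indicator {0..} t \<partial>lborel)" for g :: "real \<Rightarrow> ennreal"
    by (intro nn_integral_restrict_space) simp
  have m_int: "(\<integral>\<^sup>+t. ennreal (m * exp (- r * t)) \<partial>?L) = ennreal (m / r)"
  proof -
    have "(\<integral>\<^sup>+t. ennreal (m * exp (- r * t)) \<partial>?L) =
        (\<integral>\<^sup>+t. ennreal (m / r) * (ennreal (r * exp (- r * t)) * indicator {0..} t) \<partial>lborel)"
      unfolding restrict
    proof (intro nn_integral_cong)
      fix t
      have "ennreal (m / r) * ennreal (r * exp (- r * t)) = ennreal (m * exp (- r * t))"
        using r m by (simp add: ennreal_mult[symmetric])
      then show "ennreal (m * exp (- r * t)) * indicator {0..} t =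
          ennreal (m / r) * (ennreal (r * exp (- r * t)) * indicator {0..} t)"
        by (simp only: mult.assoc[symmetric])
    qed
    also have "\<dots> = ennreal (m / r) * (\<integral>\<^sup>+t. ennreal (r * exp (- r * t)) * indicator {0..} t \<partial>lborel)"
      by (intro nn_integral_cmult) measurable
    finally show ?thesis using nn_integral_discount[OF r, of 0] by simp
  qed
  have "running_cost c r f = enn2ereal (\<integral>\<^sup>+t. ennreal ((c (f t) + m) * exp (- r * t)) \<partial>?L) -
      enn2ereal (\<integral>\<^sup>+t. ennreal (m * exp (- r * t)) \<partial>?L)"
    unfolding running_cost_def
  proof (rule ext_integral_shift)
    have "(\<lambda>t. ennreal ((c (f (max 0 t)) + m) * exp (- r * t))) \<in> borel_measurable ?L"
      by (intro measurable_restrict_space1) measurable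
    also have "?this \<longleftrightarrow> (\<lambda>t. ennreal ((c (f t) + m) * exp (- r * t))) \<in> borel_measurable ?L"
      by (intro measurable_cong) (simp add: space_restrict_space)
    finally show "(\<lambda>t. ennreal ((c (f t) + m) * exp (- r * t))) \<in> borel_measurable ?L" .
    show "(\<lambda>t. m * exp (- r * t)) \<in> borel_measurable ?L"
      by (intro measurable_restrict_space1) measurable
    show "0 \<le> m * exp (- r * t)" for t using m by simp
    show "(\<integral>\<^sup>+t. ennreal (m * exp (- r * t)) \<partial>?L) < \<infinity>" unfolding m_int by simp
    fix t
    have "0 \<le> (c (f t) + m) * exp (- r * t)" using m(2)[of "f t"] by simp
    then show "ereal (c (f t) * exp (- r * t)) = enn2ereal (ennreal ((c (f t) + m) * exp (- r * t))) - ereal (m * exp (- r * t))"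
      by (simp add: distrib_right)
  qed
  then show ?thesis
    unfolding m_int using r m(1) by (simp add: restrict shifted_cost_def)
qed

lemma control_cost_eq:
  assumes K: "0 \<le> K"
  shows "control_cost K r f = enn2ereal (ennreal K * discounted_total r f)"
proof -
  have "(\<integral>\<^sup>+t. e2ennreal (ereal (K * exp (- r * t))) \<partial>stieltjes_measure f) = ennreal K * discounted_total r f"
    unfolding discounted_total_def
    by (subst nn_integral_cmult[symmetric]) (auto intro!: nn_integral_cong simp: ennreal_mult K)
  moreover have "(\<integral>\<^sup>+t. e2ennreal (- ereal (K * exp (- r * t))) \<partial>stieltjes_measure f) = 0"
    using K by (simp add: ennreal_neg)
  ultimately show ?thesis by (simp add: control_cost_def ext_integral_def zero_ennreal.rep_eq)
qed

context levy_process
begin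

lemma expected_cost_eq:
  assumes r: "0 < r" and K: "0 \<le> K" and m: "0 \<le> m" "\<And>x. - m \<le> c x" and c: "c \<in> borel_measurable borel"
    and \<theta>: "adapted F \<theta>" "\<And>\<omega>. \<omega> \<in> space M \<Longrightarrow> control_path (\<lambda>t. \<theta> t \<omega>)"
  shows "expected_cost M X c K r \<theta> =
    enn2ereal (\<integral>\<^sup>+\<omega>. shifted_cost c m r (\<lambda>t. X t \<omega> - \<theta> t \<omega>) + ennreal K * discounted_total r (\<lambda>t. \<theta> t \<omega>) \<partial>M) -
    ereal (m / r)"
proof -
  have cad: "cadlag (\<lambda>t. \<theta> t \<omega>)" if "\<omega> \<in> space M" for \<omega> using \<theta>(2)[OF that] by (simp add: control_path_def)
  note [measurable] = shifted_cost_measurable[OF \<theta>(1) cad c, of m r] discounted_total_measurable[OF r \<theta>]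
  have const: "(\<integral>\<^sup>+\<omega>. ennreal (m / r) \<partial>M) = ennreal (m / r)" by (simp add: emeasure_space_1)
  have "expected_cost M X c K r \<theta> =
    enn2ereal (\<integral>\<^sup>+\<omega>. shifted_cost c m r (\<lambda>t. X t \<omega> - \<theta> t \<omega>) + ennreal K * discounted_total r (\<lambda>t. \<theta> t \<omega>) \<partial>M) -
    enn2ereal (\<integral>\<^sup>+\<omega>. ennreal (m / r) \<partial>M)"
    unfolding expected_cost_def
  proof (rule ext_integral_shift)
    fix \<omega> assume \<omega>: "\<omega> \<in> space M"
    have "enn2ereal a - ereal d + enn2ereal b = enn2ereal (a + b) - ereal d" for a b d
      by (cases a; cases b) (auto simp: ennreal_plus[symmetric] simp del: ennreal_plus)
    then show "running_cost c r (\<lambda>t. X t \<omega> - \<theta> t \<omega>) + control_cost K r (\<lambda>t. \<theta> t \<omega>) =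
        enn2ereal (shifted_cost c m r (\<lambda>t. X t \<omega> - \<theta> t \<omega>) + ennreal K * discounted_total r (\<lambda>t. \<theta> t \<omega>)) - ereal (m / r)"
      using running_cost_eq[OF r m c cadlag_minus[OF cadlag_paths[OF \<omega>] cad[OF \<omega>]]] control_cost_eq[OF K]
      by simp
  qed (use r m const in \<open>simp_all\<close>)
  then show ?thesis unfolding const using r m by simp
qed

section \<open>The equation for the barrier\<close>

text \<open>
  The equation for the barrier says that the mean slope along the running minimum is \<open>r K\<close>;
  written with the nonnegative slope gap, it determines the discounted mean of the depth.
\<close>

lemma kappa_zero:
  assumes r: "0 < r" and c': "mono c'" "continuous_on UNIV c'"
    and X0: "AE \<omega> in M. X 0 \<omega> = 0" and kappa: "kappa M X c' K r b = 0"
  shows "r * K \<le> c' b" "discounted_depth (slope_gap c' b) r = ennreal (c' b / r - K)"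
proof -
  have c'm[measurable]: "c' \<in> borel_measurable borel" using c'(2) by (rule borel_measurable_continuous_onI)
  have \<phi>: "mono (slope_gap c' b)" "continuous_on UNIV (slope_gap c' b)" using slope_gap[OF c'] by simp_all
  \<comment> \<open>The depth relative to \<open>X 0\<close> equals minus the running minimum almost surely, and
    it is nonnegative everywhere; negative times have no mass.\<close>
  define D where "D \<omega> t = (if 0 \<le> t then path_sup (\<lambda>u. X 0 \<omega> - X u \<omega>) 0 t else 0)" for \<omega> t
  define g where "g p = c' (b - D (fst p) (snd p))" for p
  let ?E = "density lborel (exponential_density r)"
  let ?N = "M \<Otimes>\<^sub>M ?E"
  interpret E: prob_space ?E by (rule prob_space_exponential_density[OF r])
  interpret N: pair_prob_space M ?E ..
  have sets_N: "sets ?N = sets (M \<Otimes>\<^sub>M borel)" by (intro sets_pair_measure_cong) simp_all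
  have sup_measurable: "(\<lambda>p. if 0 \<le> snd p then path_sup (\<lambda>u. Y u (fst p)) 0 (snd p) else 0) \<in> borel_measurable (M \<Otimes>\<^sub>M borel)"
    if "\<And>t. 0 \<le> t \<Longrightarrow> Y t \<in> borel_measurable M" "\<And>\<omega>. \<omega> \<in> space M \<Longrightarrow> cadlag (\<lambda>t. Y t \<omega>)" for Y :: "real \<Rightarrow> 'a \<Rightarrow> real"
  proof -
    have "(\<lambda>p. (0 :: real, snd p, fst p)) \<in> measurable (M \<Otimes>\<^sub>M borel) (borel \<Otimes>\<^sub>M borel \<Otimes>\<^sub>M M)" by measurable
    from measurable_compose[OF this path_sup_measurable[OF that]] show ?thesis by simp
  qed
  have D_measurable: "(\<lambda>p. D (fst p) (snd p)) \<in> borel_measurable (M \<Otimes>\<^sub>M borel)"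
    unfolding D_def
    by (rule sup_measurable) (auto intro!: borel_measurable_diff X_measurable cadlag_minus cadlag_const cadlag_paths)
  have D_nonneg: "0 \<le> D \<omega> t" if "\<omega> \<in> space M" for \<omega> t
    using path_sup_upper[OF cadlag_minus[OF cadlag_const cadlag_paths[OF that]], of 0 0 t "X 0 \<omega>"]
    by (simp add: D_def)
  have inf_eq: "running_inf X t \<omega> = - path_sup (\<lambda>u. - X u \<omega>) 0 t" for t \<omega>
    by (simp add: running_inf_def path_sup_def Inf_real_def image_image)
  have inf_measurable: "(\<lambda>p. running_inf X (snd p) (fst p)) \<in> borel_measurable (M \<Otimes>\<^sub>M borel)"
  proof -
    have [measurable]: "(\<lambda>p. if 0 \<le> snd p then path_sup (\<lambda>u. - X u (fst p)) 0 (snd p) else 0) \<in> borel_measurable (M \<Otimes>\<^sub>M borel)"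
      by (rule sup_measurable[of "\<lambda>u \<omega>. - X u \<omega>"])
        (auto intro!: borel_measurable_uminus X_measurable cadlag_minus[OF cadlag_const[of 0], simplified] cadlag_paths)
    have "(\<lambda>p. if 0 \<le> snd p then - (if 0 \<le> snd p then path_sup (\<lambda>u. - X u (fst p)) 0 (snd p) else 0) else Inf {})
        \<in> borel_measurable (M \<Otimes>\<^sub>M borel)" by measurable
    also have "(\<lambda>p. if 0 \<le> snd p then - (if 0 \<le> snd p then path_sup (\<lambda>u. - X u (fst p)) 0 (snd p) else 0) else Inf {}) =
        (\<lambda>p. running_inf X (snd p) (fst p))"
      by (auto simp: fun_eq_iff inf_eq) (simp add: running_inf_def inf_eq[symmetric])
    finally show ?thesis .
  qed
  have iterate: "(\<integral>\<^sup>+p. h p \<partial>?N) = (\<integral>\<^sup>+t. ennreal (r * exp (- r * t)) * (\<integral>\<^sup>+\<omega>. h (\<omega>, t) \<partial>M) * indicator {0..} t \<partial>lborel)"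
    if h: "h \<in> borel_measurable (M \<Otimes>\<^sub>M borel)" for h
  proof -
    have [measurable]: "h \<in> borel_measurable ?N" using h by (simp add: measurable_cong_sets[OF sets_N refl])
    have [measurable]: "(\<lambda>t. \<integral>\<^sup>+\<omega>. h (\<omega>, t) \<partial>M) \<in> borel_measurable borel"
      using borel_measurable_nn_integral[of "\<lambda>t \<omega>. h (\<omega>, t)" borel] measurable_pair_swap[OF h]
      by (simp add: case_prod_beta')
    have "(\<integral>\<^sup>+p. h p \<partial>?N) = (\<integral>\<^sup>+t. (\<integral>\<^sup>+\<omega>. h (\<omega>, t) \<partial>M) \<partial>?E)"
      by (rule N.nn_integral_snd[symmetric]) measurable
    also have "\<dots> = (\<integral>\<^sup>+t. ennreal (exponential_density r t) * (\<integral>\<^sup>+\<omega>. h (\<omega>, t) \<partial>M) \<partial>lborel)"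
      by (rule nn_integral_density) measurable
    also have "\<dots> = (\<integral>\<^sup>+t. ennreal (r * exp (- r * t)) * (\<integral>\<^sup>+\<omega>. h (\<omega>, t) \<partial>M) * indicator {0..} t \<partial>lborel)"
      by (intro nn_integral_cong) (simp add: exponential_density_def indicator_def mult.commute)
    finally show ?thesis .
  qed
  have same: "(\<integral>\<^sup>+p. h (running_inf X (snd p) (fst p)) \<partial>?N) = (\<integral>\<^sup>+p. h (- D (fst p) (snd p)) \<partial>?N)"
    if h: "h \<in> borel_measurable borel" for h
  proof -
    have "(\<integral>\<^sup>+\<omega>. h (running_inf X t \<omega>) \<partial>M) = (\<integral>\<^sup>+\<omega>. h (- D \<omega> t) \<partial>M)" if "0 \<le> t" for t
    proof (rule nn_integral_cong_AE, use X0 in eventually_elim)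
      case (elim \<omega>)
      then show ?case using that by (simp add: D_def inf_eq)
    qed
    then show ?thesis
      using iterate[OF measurable_compose[OF inf_measurable h]]
        iterate[OF measurable_compose[OF borel_measurable_uminus[OF D_measurable] h]]
      by (simp add: indicator_def cong: if_cong) (intro nn_integral_cong, simp)
  qed
  have g[measurable]: "g \<in> borel_measurable ?N"
    unfolding g_def measurable_cong_sets[OF sets_N refl]
    by (intro measurable_compose[OF _ c'm] borel_measurable_diff measurable_const D_measurable) simp
  have g_le: "g p \<le> c' b" if "p \<in> space ?N" for p
    using that D_nonneg[of "fst p" "snd p"] unfolding g_def
    by (intro monoD[OF c'(1)]) (auto simp: space_pair_measure)
  let ?P = "\<integral>\<^sup>+p. ennreal (g p) \<partial>?N" and ?Q = "\<integral>\<^sup>+p. ennreal (- g p) \<partial>?N"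
  have "ext_integral ?N (\<lambda>(\<omega>, T). ereal (c' (b + running_inf X T \<omega>))) = enn2ereal ?P - enn2ereal ?Q"
    unfolding ext_integral_def
    using same[of "\<lambda>y. ennreal (c' (b + y))"] same[of "\<lambda>y. ennreal (- c' (b + y))"]
    by (simp add: case_prod_beta' g_def)
  then have eq: "ereal (1 / r) * (enn2ereal ?P - enn2ereal ?Q) - ereal K = 0"
    using kappa by (simp add: kappa_def)
  have "?P \<le> (\<integral>\<^sup>+p. ennreal (c' b) \<partial>?N)" by (intro nn_integral_mono ennreal_leI g_le)
  also have "\<dots> < \<infinity>" by (simp add: N.emeasure_space_1)
  finally have P_fin: "?P < \<infinity>" .
  have "P = ennreal (enn2real P) \<and> Q \<noteq> \<infinity> \<and> enn2real P - enn2real Q = r * K"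
    if "ereal (1 / r) * (enn2ereal P - enn2ereal Q) - ereal K = 0" "P < \<infinity>" for P Q
    using that r by (cases P; cases Q) (auto simp: field_simps)
  from this[OF eq P_fin] have Q_fin: "?Q \<noteq> \<infinity>" and PQ: "enn2real ?P - enn2real ?Q = r * K" by blast+
  have int: "integrable ?N g"
    using P_fin Q_fin by (simp add: real_integrable_def)
  then have int_g: "integral\<^sup>L ?N g = r * K"
    using PQ by (simp add: real_lebesgue_integral_def)
  have "integral\<^sup>L ?N g \<le> (LINT p|?N. c' b)"
    using int g_le by (intro integral_mono_AE AE_I2) simp_all
  then show le: "r * K \<le> c' b" unfolding int_g by (simp add: N.prob_space)
  have "(\<integral>\<^sup>+p. ennreal (c' b - g p) \<partial>?N) = ennreal (LINT p|?N. c' b - g p)"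
    using int g_le by (intro nn_integral_eq_integral AE_I2) simp_all
  also have "\<dots> = ennreal (c' b - r * K)"
    using int int_g by (simp add: N.prob_space)
  finally have "(\<integral>\<^sup>+p. ennreal (c' b - g p) \<partial>?N) = ennreal (c' b - r * K)" .
  moreover have "(\<integral>\<^sup>+p. ennreal (c' b - g p) \<partial>?N) = ennreal r * discounted_depth (slope_gap c' b) r"
  proof -
    have "(\<lambda>p. ennreal (c' b - g p)) \<in> borel_measurable (M \<Otimes>\<^sub>M borel)"
      using g unfolding measurable_cong_sets[OF sets_N refl] by measurable
    from iterate[OF this] have "(\<integral>\<^sup>+p. ennreal (c' b - g p) \<partial>?N) =
        (\<integral>\<^sup>+t. ennreal r * (ennreal (exp (- r * t)) * depth_mean (slope_gap c' b) t * indicator {0..} t) \<partial>lborel)"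
      using r by (auto intro!: nn_integral_cong simp: indicator_def g_def D_def depth_mean_def slope_gap_def ennreal_mult mult.assoc)
    also have "\<dots> = ennreal r * discounted_depth (slope_gap c' b) r"
      unfolding discounted_depth_def using depth_mean_measurable[OF \<phi>] by (intro nn_integral_cmult) simp
    finally show ?thesis .
  qed
  ultimately have "ennreal (1 / r) * (ennreal r * discounted_depth (slope_gap c' b) r) = ennreal (1 / r) * ennreal (c' b - r * K)"
    by simp
  then have "(ennreal (1 / r) * ennreal r) * discounted_depth (slope_gap c' b) r = ennreal (1 / r * (c' b - r * K))"
    using r le by (simp only: mult.assoc) (subst ennreal_mult, simp_all)
  moreover have "ennreal (1 / r) * ennreal r = 1" using r by (subst ennreal_mult[symmetric]) simp_all
  moreover have "1 / r * (c' b - r * K) = c' b / r - K" using r by (simp add: field_simps)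
  ultimately show "discounted_depth (slope_gap c' b) r = ennreal (c' b / r - K)" by simp
qed

end

section \<open>The monotone follower problem\<close>

text \<open>
  Increments do not see the starting point, so the common law of the shifted paths determines
  them. Means of heights and depths are functions of these laws and so agree for \<open>P x\<close> and \<open>P 0\<close>.
\<close>

lemma levy_family_increment_law:
  assumes X: "levy_family P F X" and h: "0 \<le> h"
  shows "distr (P x) borel (\<lambda>\<omega>. X h \<omega> - X 0 \<omega>) = distr (P 0) borel (\<lambda>\<omega>. X h \<omega> - X 0 \<omega>)"
proof -
  let ?\<Pi> = "Pi\<^sub>M {0..} (\<lambda>_. borel) :: (real \<Rightarrow> real) measure"
  let ?g = "\<lambda>p. p h - p 0 :: real"
  have levy: "levy_process (P y) F X" for y using X by (simp add: levy_family_def)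
  have meas: "(\<lambda>\<omega>. \<lambda>t\<in>{0..}. a + X t \<omega>) \<in> measurable (P y) ?\<Pi>" for y a
    using levy_process.X_measurable[OF levy[of y]] by (intro measurable_restrict borel_measurable_add) simp_all
  have g: "?g \<in> borel_measurable ?\<Pi>"
    using h by (intro borel_measurable_diff measurable_component_singleton) simp_all
  have law: "distr (distr (P y) ?\<Pi> (\<lambda>\<omega>. \<lambda>t\<in>{0..}. a + X t \<omega>)) borel ?g = distr (P y) borel (\<lambda>\<omega>. X h \<omega> - X 0 \<omega>)" for y a
    using h by (subst distr_distr[OF g meas]) (simp add: comp_def)
  have "distr (P x) ?\<Pi> (\<lambda>\<omega>. \<lambda>t\<in>{0..}. 0 + X t \<omega>) = distr (P 0) ?\<Pi> (\<lambda>\<omega>. \<lambda>t\<in>{0..}. x + X t \<omega>)"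
    using X by (simp add: levy_family_def)
  then show ?thesis using law[of x 0] law[of 0 x] by simp
qed

lemma control_path_cong:
  assumes eq: "\<And>t. 0 \<le> t \<Longrightarrow> f t = g t" and f: "control_path f"
  shows "control_path g"
proof -
  have "(g \<longlongrightarrow> g t) (at_right t)" if t: "0 \<le> t" for t
  proof -
    have "\<forall>\<^sub>F u in at_right t. f u = g u"
      using eventually_at_right_less[of t] by (rule eventually_mono) (use t in \<open>simp add: eq\<close>)
    moreover have "(f \<longlongrightarrow> f t) (at_right t)"
      using f t by (simp add: control_path_def cadlag_def continuous_within)
    ultimately show ?thesis using eq[OF t] Lim_transform_eventually by fastforce
  qed
  moreover have "\<exists>l. (g \<longlongrightarrow> l) (at_left t)" if t: "0 < t" for t
  proof -
    have "\<forall>\<^sub>F u in at_left t. 0 < u" unfolding eventually_at_left[OF t] using t by (intro exI[of _ 0]) simp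
    then have "\<forall>\<^sub>F u in at_left t. f u = g u" by (rule eventually_mono) (simp add: eq)
    moreover obtain l where "(f \<longlongrightarrow> l) (at_left t)"
      using f t unfolding control_path_def cadlag_def by blast
    ultimately show ?thesis using Lim_transform_eventually by blast
  qed
  moreover have "mono_on {0..} g" "0 \<le> g 0"
    using f eq by (auto simp: control_path_def mono_on_def)
  ultimately show ?thesis by (simp add: control_path_def cadlag_def continuous_within)
qed

lemma control_costs_cong:
  assumes "\<And>t. 0 \<le> t \<Longrightarrow> f t = g t"
  shows "stieltjes_measure f = stieltjes_measure g" "discounted_total r f = discounted_total r g"
    and "shifted_cost c m r (\<lambda>t. h t - f t) = shifted_cost c m r (\<lambda>t. h t - g t)"
proof -
  have "(\<lambda>t. if t < 0 then 0 else f t) = (\<lambda>t. if t < 0 then 0 else g t)"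
    using assms by (auto simp: fun_eq_iff)
  then show "stieltjes_measure f = stieltjes_measure g" by (simp add: stieltjes_measure_def)
  then show "discounted_total r f = discounted_total r g" by (simp add: discounted_total_def)
  show "shifted_cost c m r (\<lambda>t. h t - f t) = shifted_cost c m r (\<lambda>t. h t - g t)"
    unfolding shifted_cost_def by (intro nn_integral_cong) (simp add: indicator_def assms)
qed

lemma (in prob_space) nn_integral_finite_of_square:
  assumes "Y \<in> borel_measurable M" "(\<integral>\<^sup>+\<omega>. (Y \<omega>)\<^sup>2 \<partial>M) < \<infinity>"
  shows "(\<integral>\<^sup>+\<omega>. Y \<omega> \<partial>M) < \<infinity>"
proof -
  have "y \<le> 1 + y\<^sup>2" for y :: ennreal
  proof (cases "y \<le> 1")
    case True then show ?thesis by (rule order.trans) simp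
  next
    case False
    then have "y * 1 \<le> y * y" by (intro mult_left_mono) simp_all
    then show ?thesis by (simp add: power2_eq_square add_increasing)
  qed
  then have "(\<integral>\<^sup>+\<omega>. Y \<omega> \<partial>M) \<le> (\<integral>\<^sup>+\<omega>. 1 + (Y \<omega>)\<^sup>2 \<partial>M)" by (intro nn_integral_mono)
  also have "\<dots> = 1 + (\<integral>\<^sup>+\<omega>. (Y \<omega>)\<^sup>2 \<partial>M)"
    using assms(1) by (simp add: nn_integral_add emeasure_space_1)
  also have "\<dots> < \<infinity>" using assms(2) by simp
  finally show ?thesis .
qed

theorem theorem15:
  fixes P :: "real \<Rightarrow> 'a measure"
    and F :: "real \<Rightarrow> 'a measure"
    and X :: "real \<Rightarrow> 'a \<Rightarrow> real"
    and \<nu> :: "real measure"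
    and c c' :: "real \<Rightarrow> real"
    and r K x_star :: real
    and \<theta>_star :: "real \<Rightarrow> 'a \<Rightarrow> real"
  assumes r: "r > 0"
    and K: "K \<ge> 0"
    and X: "levy_family P F X"
    and c_deriv: "\<And>x. (c has_real_derivative c' x) (at x)"
    and c'_cont: "continuous_on UNIV c'"
    and c'_mono: "mono c'"
    and c_bdd: "bdd_below (range c)"
    and cost_finite: "\<And>x. ext_integral (P x) (\<lambda>\<omega>. running_cost c r (\<lambda>t. X t \<omega>)) < \<infinity>"
    and \<nu>: "has_levy_measure (P 0) X \<nu>"
    and \<nu>_moment: "(\<integral>\<^sup>+y\<in>{1<..}. ennreal (y\<^sup>2) \<partial>\<nu>) < \<infinity>"
    and x_star: "kappa (P 0) X c' K r x_star = 0"
    and \<theta>_star: "\<And>t \<omega>. 0 \<le> t \<Longrightarrow> \<theta>_star t \<omega> = (SUP u\<in>{0..t}. max (X u \<omega> - x_star) 0)"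
  shows "\<forall>x. \<theta>_star \<in> singular_controls (P x) F r \<and>
             expected_cost (P x) X c K r \<theta>_star = value_function P F X c K r x"
proof
  fix x
  let ?\<rho> = "\<lambda>\<omega>. reflection (\<lambda>u. X u \<omega>) x_star"
  interpret L0: levy_process "P 0" F X using X by (simp add: levy_family_def)
  interpret levy_process "P x" F X using X by (simp add: levy_family_def)
  have X0: "AE \<omega> in P y. X 0 \<omega> = y" for y using X by (simp add: levy_family_def)
  have law: "increment_law h = L0.increment_law h" if "0 \<le> h" for h
    using levy_family_increment_law[OF X that] .
  obtain m where m: "0 \<le> m" "\<And>y. - m \<le> c y"
  proof -
    obtain l where "\<And>y. l \<le> c y" using c_bdd by (auto simp: bdd_below_def)
    then show ?thesis by (intro that[of "max 0 (- l)"]) (simp_all add: minus_max_eq_min min.coboundedI2)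
  qed
  have cm: "c \<in> borel_measurable borel"
    using c_deriv by (intro borel_measurable_continuous_onI DERIV_continuous_on)
  have \<theta>_eq: "\<theta>_star t \<omega> = ?\<rho> \<omega> t" if "0 \<le> t" for t \<omega>
    using \<theta>_star[OF that] by (simp add: reflection_def)
  have same_measure: "stieltjes_measure (\<lambda>t. \<theta>_star t \<omega>) = stieltjes_measure (?\<rho> \<omega>)"
    and same_total: "discounted_total r (\<lambda>t. \<theta>_star t \<omega>) = discounted_total r (?\<rho> \<omega>)"
    and same_cost: "shifted_cost c m r (\<lambda>t. X t \<omega> - \<theta>_star t \<omega>) = shifted_cost c m r (\<lambda>t. X t \<omega> - ?\<rho> \<omega> t)" for \<omega>
    by (rule control_costs_cong, rule \<theta>_eq, assumption)+
  have \<theta>_path: "control_path (\<lambda>t. \<theta>_star t \<omega>)" if "\<omega> \<in> space (P x)" for \<omega>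
    by (rule control_path_cong[OF _ control_path_reflection_X[OF that, of x_star]]) (simp add: \<theta>_eq)
  have \<theta>_adapted: "adapted F \<theta>_star"
  proof -
    have "\<theta>_star t = (\<lambda>\<omega>. ?\<rho> \<omega> t)" if "0 \<le> t" for t using \<theta>_eq[OF that] by blast
    then show ?thesis using adapted_reflection[of x_star] by (simp add: adapted_def)
  qed
  have "dyadic_limit rise positive_square 1 =
      L0.dyadic_limit rise positive_square 1"
    by (simp add: law)
  also have "\<dots> = (\<integral>\<^sup>+\<omega>. positive_square (path_sup (\<lambda>u. X u \<omega> - X 0 \<omega>) 0 (0 + 1)) \<partial>P 0)"
    by (rule L0.nn_integral_square_height[symmetric]) simp
  also have "\<dots> < \<infinity>"
    using L0.height_square_integrable[OF \<nu> \<nu>_moment] by (simp add: positive_square_def L0.height_def)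
  finally have square_height: "dyadic_limit rise positive_square 1 < \<infinity>" .
  have "(\<integral>\<^sup>+\<omega>. positive_square (X 0 \<omega> - x_star) \<partial>P x) = (\<integral>\<^sup>+\<omega>. positive_square (x - x_star) \<partial>P x)"
    using X0[of x] by (intro nn_integral_cong_AE) auto
  also have "\<dots> < \<infinity>" by (simp add: emeasure_space_1 positive_square_def)
  finally have start: "(\<integral>\<^sup>+\<omega>. positive_square (X 0 \<omega> - x_star) \<partial>P x) < \<infinity>" .
  have admissible: "\<theta>_star \<in> singular_controls (P x) F r"
    using reflection_singular_control[OF r square_height start] \<theta>_adapted \<theta>_path
    by (simp add: singular_controls_def same_measure control_path_def)
  have control: "adapted F \<theta>" "\<And>\<omega>. \<omega> \<in> space (P x) \<Longrightarrow> control_path (\<lambda>t. \<theta> t \<omega>)"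
      "(\<integral>\<^sup>+\<omega>. discounted_total r (\<lambda>t. \<theta> t \<omega>) \<partial>P x) < \<infinity>"
    if "\<theta> \<in> singular_controls (P x) F r" for \<theta>
  proof -
    show \<theta>: "adapted F \<theta>" "\<And>\<omega>. \<omega> \<in> space (P x) \<Longrightarrow> control_path (\<lambda>t. \<theta> t \<omega>)"
      using that by (simp_all add: singular_controls_def control_path_def)
    show "(\<integral>\<^sup>+\<omega>. discounted_total r (\<lambda>t. \<theta> t \<omega>) \<partial>P x) < \<infinity>"
    proof (rule nn_integral_finite_of_square[OF discounted_total_measurable[OF r \<theta>]])
      show "(\<integral>\<^sup>+\<omega>. (discounted_total r (\<lambda>t. \<theta> t \<omega>))\<^sup>2 \<partial>P x) < \<infinity>"
        using that unfolding singular_controls_def discounted_total_def by blast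
    qed
  qed
  have cost_eq: "expected_cost (P x) X c K r \<theta> = enn2ereal (\<integral>\<^sup>+\<omega>. shifted_cost c m r (\<lambda>t. X t \<omega> - \<theta> t \<omega>) +
      ennreal K * discounted_total r (\<lambda>t. \<theta> t \<omega>) \<partial>P x) - ereal (m / r)"
    if "\<theta> \<in> singular_controls (P x) F r" for \<theta>
    by (rule expected_cost_eq[OF r K m cm control(1,2)[OF that]])
  have kappa: "r * K \<le> c' x_star" "L0.discounted_depth (slope_gap c' x_star) r = ennreal (c' x_star / r - K)"
    using L0.kappa_zero[OF r c'_mono c'_cont X0 x_star] by simp_all
  have depth: "discounted_depth (slope_gap c' x_star) r = ennreal (c' x_star / r - K)"
  proof -
    have "depth_mean (slope_gap c' x_star) t = L0.depth_mean (slope_gap c' x_star) t" if "0 \<le> t" for t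
      using depth_mean_eq[OF slope_gap[OF c'_mono c'_cont] that]
        L0.depth_mean_eq[OF slope_gap[OF c'_mono c'_cont] that] that by (simp add: law)
    then have "discounted_depth (slope_gap c' x_star) r = L0.discounted_depth (slope_gap c' x_star) r"
      unfolding discounted_depth_def L0.discounted_depth_def
      by (intro nn_integral_cong) (simp add: indicator_def)
    then show ?thesis using kappa(2) by simp
  qed
  have "expected_cost (P x) X c K r \<theta>_star \<le> expected_cost (P x) X c K r \<theta>"
    if \<theta>: "\<theta> \<in> singular_controls (P x) F r" for \<theta>
  proof -
    note opt = reflection_optimal[OF r K c_deriv c'_mono c'_cont m(2) kappa(1) depth control[OF \<theta>]]
    have "(\<integral>\<^sup>+\<omega>. shifted_cost c m r (\<lambda>t. X t \<omega> - \<theta>_star t \<omega>) + ennreal K * discounted_total r (\<lambda>t. \<theta>_star t \<omega>) \<partial>P x) \<le>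
        (\<integral>\<^sup>+\<omega>. shifted_cost c m r (\<lambda>t. X t \<omega> - \<theta> t \<omega>) + ennreal K * discounted_total r (\<lambda>t. \<theta> t \<omega>) \<partial>P x)"
      using opt control(3)[OF admissible] unfolding same_total same_cost by simp
    then show ?thesis
      unfolding cost_eq[OF admissible] cost_eq[OF \<theta>]
      by (intro ereal_minus_mono order_refl) (simp add: less_eq_ennreal.rep_eq)
  qed
  then have "expected_cost (P x) X c K r \<theta>_star = value_function P F X c K r x"
    unfolding value_function_def
    using admissible by (intro antisym INF_greatest INF_lower)
  with admissible show "\<theta>_star \<in> singular_controls (P x) F r \<and>
      expected_cost (P x) X c K r \<theta>_star = value_function P F X c K r x" by blast
qed

end
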